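(* Let $G$ be a generalized H-type Carnot group of rank $k$ and dimension $n$, with identity $e$, let $\alpha_d$ be the largest eigenvalue of $S$, and let $$D:=\left\{\lambda=(u,v)\in T_e^*G\ \text{ such that }\ |v|<\frac{2\pi}{\alpha_d}\ \text{ and }\ Su\ne0\right\}\subset T_e^*G.$$ Then $\exp_e:D\to\exp_e(D)$ is a smooth diffeomorphism and $\mathcal C(e):=G\setminus\exp_e(D)$ is a closed set with zero measure. Moreover, for all $\lambda\in D$, the curve $\gamma_\lambda(t)=\exp_e(t\lambda)$, with $t\in[0,1]$, is the unique minimizing geodesic joining its endpoints.
   Context: **Generalized H-type Carnot groups.** A step 2 Carnot group of rank $k$ and dimension $n$ is a connected, simply connected Lie group $G$ of dimension $n$ whose Lie algebra splits as $\mathfrak g=\mathfrak g_1\oplus\mathfrak g_2$ with $\dim\mathfrak g_1=k$, $\dim\mathfrak g_2=n-k\ge 1$, $[\mathfrak g_1,\mathfrak g_1]=\mathfrak g_2$, $[\mathfrak g_1,\mathfrak g_2]=[\mathfrak g_2,\mathfrak g_2]=0$, with a fixed scalar product $g$ on $\mathfrak g$ such that $\mathfrak g_1\perp\mathfrak g_2$. For $V\in\mathfrak g_2$, $J_V:\mathfrak g_1\to\mathfrak g_1$ is the skew-symmetric operator with $g(X,J_VY)=g(V,[X,Y])$ for all $X,Y\in\mathfrak g_1$. The group is of generalized H-type if there is a symmetric, non-zero, non-negative operator $S:\mathfrak g_1\to\mathfrak g_1$ with $J_VJ_W+J_WJ_V=-2g(V,W)S^2$ for all $V,W\in\mathfrak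 g_2$. The sub-Riemannian structure is the left-invariant distribution generated by $\mathfrak g_1$ with the left-invariant metric induced by $g|_{\mathfrak g_1}$. "Zero measure" refers to a left-invariant (Haar) measure, i.e. to the Lebesgue measure in the coordinates below. **Coordinates.** Fix orthonormal bases $e_1,\dots,e_k$ of $\mathfrak g_1$ (chosen so that $S$ is diagonal) and $f_1,\dots,f_{n-k}$ of $\mathfrak g_2$. A point $p\in G$ has coordinates $(x,z)\in\mathbb R^k\times\mathbb R^{n-k}$ iff $p=\mathrm{exp}_G(\sum_i x_ie_i+\sum_\alpha z_\alpha f_\alpha)$, with $\mathrm{exp}_G$ the group exponential; $e=(0,0)$. With $[e_i,e_j]=\sum_\alpha L^\alpha_{ij}f_\alpha$, a global orthonormal frame of the distribution is $X_i=\partial_{x_i}-\frac12\sum_{\alpha,j}L^\alpha_{ij}x_j\partial_{z_\alpha}$, $i=1,\dots,k$. $S$ is identified with its matrix, acting on $\mathbb R^k$. A covector $\lambda\in T_e^*G$ is written $\lambda=\sum_iu_i\,dx_i+\sum_\alpha v_\alpha\,dz_\alpha=(u,v)\in\mathbb R^k\times\mathbb R^{n-k}$, and $|\cdot|$ is the Euclidean norm. **Geodesics and exponential map.** A horizontal curve is a Lipschitz curve $\gamma:[0,1]\to G$ almost everywhere tangent to the distribution; geodesics are horizontal curves that locally minimize the energy $\frac12\int g(\dot\gamma,\dot\gamma)\,dt$ between their endpoints (hence have constant speed), and a minimizing geodesic minimizes the energy (equivalently, has constant speed and minimizes the length) among all horizontal curves $[0,1]\to G$ with the same endpoints. The Hamiltonian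 is $H(\lambda)=\frac12\sum_i\langle\lambda,X_i\rangle^2$ on $T^*G$, with Hamiltonian vector field $\vec H$; $\exp_e(\lambda)=\pi(\lambda(1))$, where $\pi:T^*G\to G$ is the projection and $\lambda(t)$ is the integral curve of $\vec H$ with $\lambda(0)=\lambda$. *)

theory Defs
  imports "HOL-Analysis.Analysis"
begin

section \<open>Step 2 Carnot groups in exponential coordinates\<close>

text \<open>
  The two layers of the Lie algebra are the Euclidean spaces \<open>'a\<close> (of dimension \<open>k = DIM('a)\<close>) and
  \<open>'b\<close> (of dimension \<open>n - k = DIM('b) \<ge> 1\<close>), and \<open>br X Y\<close> is the bracket of two elements of the first
  layer; every other bracket vanishes. The Lie algebra is the orthogonal sum \<open>'a \<times> 'b\<close> with the
  product inner product. The group exponential of a connected and simply connected nilpotent Lie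
  group is a global diffeomorphism, so the group is \<open>'a \<times> 'b\<close> as well, a point \<open>(x, z)\<close> standing for
  the group exponential of \<open>x + z\<close>, and the group law is the Baker-Campbell-Hausdorff formula. The
  identity is \<open>0\<close>. Tangent vectors, and covectors via the inner product, are elements of \<open>'a \<times> 'b\<close>.
\<close>

definition step2_bracket :: "('a::euclidean_space \<Rightarrow> 'a \<Rightarrow> 'b::euclidean_space) \<Rightarrow> bool" where
  "step2_bracket br \<longleftrightarrow>
     bilinear br \<and> (\<forall>X. br X X = 0) \<and> span {br X Y |X Y. True} = UNIV"

definition lie_bracket ::
  "('a::euclidean_space \<Rightarrow> 'a \<Rightarrow> 'b::euclidean_space) \<Rightarrow> 'a \<times> 'b \<Rightarrow> 'a \<times> 'b \<Rightarrow> 'a \<times> 'b" where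
  "lie_bracket br P Q = (0, br (fst P) (fst Q))"

definition group_mult ::
  "('a::euclidean_space \<Rightarrow> 'a \<Rightarrow> 'b::euclidean_space) \<Rightarrow> 'a \<times> 'b \<Rightarrow> 'a \<times> 'b \<Rightarrow> 'a \<times> 'b" where
  "group_mult br p q = p + q + (1/2) *\<^sub>R lie_bracket br p q"

text \<open>
  \<open>J br V Y\<close> is characterized by \<open>X \<bullet> J br V Y = V \<bullet> br X Y\<close>, see \<open>inner_J\<close> below.
\<close>

definition J :: "('a::euclidean_space \<Rightarrow> 'a \<Rightarrow> 'b::euclidean_space) \<Rightarrow> 'b \<Rightarrow> 'a \<Rightarrow> 'a" where
  "J br V Y = adjoint (\<lambda>X. br X Y) V"

definition generalized_H_type ::
  "('a::euclidean_space \<Rightarrow> 'a \<Rightarrow> 'b::euclidean_space) \<Rightarrow> ('a \<Rightarrow> 'a) \<Rightarrow> bool" where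
  "generalized_H_type br S \<longleftrightarrow>
     step2_bracket br \<and>
     linear S \<and> (\<forall>X Y. S X \<bullet> Y = X \<bullet> S Y) \<and> S \<noteq> (\<lambda>_. 0) \<and> (\<forall>X. 0 \<le> S X \<bullet> X) \<and>
     (\<forall>V W X. J br V (J br W X) + J br W (J br V X) = - (2 * (V \<bullet> W)) *\<^sub>R S (S X))"

definition eigenvalues :: "('a::real_vector \<Rightarrow> 'a) \<Rightarrow> real set" where
  "eigenvalues S = {\<mu>. \<exists>X. X \<noteq> 0 \<and> S X = \<mu> *\<^sub>R X}"

definition largest_eigenvalue :: "('a::real_vector \<Rightarrow> 'a) \<Rightarrow> real" where
  "largest_eigenvalue S = Max (eigenvalues S)"


section \<open>The sub-Riemannian structure\<close>

text \<open>
  \<open>horizontal_field br w\<close> is the left-invariant vector field with value \<open>(w, 0)\<close> at the identity; for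
  \<open>w\<close> in an orthonormal basis these fields form the orthonormal frame of the distribution.
\<close>

definition horizontal_field ::
  "('a::euclidean_space \<Rightarrow> 'a \<Rightarrow> 'b::euclidean_space) \<Rightarrow> 'a \<Rightarrow> 'a \<times> 'b \<Rightarrow> 'a \<times> 'b" where
  "horizontal_field br w p = (w, - (1/2) *\<^sub>R br w (fst p))"

definition distribution ::
  "('a::euclidean_space \<Rightarrow> 'a \<Rightarrow> 'b::euclidean_space) \<Rightarrow> 'a \<times> 'b \<Rightarrow> ('a \<times> 'b) set" where
  "distribution br p = span ((\<lambda>w. horizontal_field br w p) ` Basis)"

definition horizontal_curve ::
  "('a::euclidean_space \<Rightarrow> 'a \<Rightarrow> 'b::euclidean_space) \<Rightarrow> (real \<Rightarrow> 'a \<times> 'b) \<Rightarrow> bool" where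
  "horizontal_curve br \<gamma> \<longleftrightarrow>
     (\<exists>L. L-lipschitz_on {0..1} \<gamma>) \<and>
     (AE t in lebesgue_on {0..1}.
        \<exists>V \<in> distribution br (\<gamma> t). (\<gamma> has_vector_derivative V) (at t within {0..1}))"

text \<open>
  A vector of the distribution is \<open>horizontal_field br w p\<close> for a unique \<open>w\<close>, namely its first
  component, and its length in the sub-Riemannian metric is the norm of \<open>w\<close>.
\<close>

definition energy :: "(real \<Rightarrow> 'a::euclidean_space \<times> 'b::euclidean_space) \<Rightarrow> real" where
  "energy \<gamma> =
     1/2 * integral {0..1} (\<lambda>t. (norm (fst (vector_derivative \<gamma> (at t within {0..1}))))\<^sup>2)"

definition minimizing_geodesic ::
  "('a::euclidean_space \<Rightarrow> 'a \<Rightarrow> 'b::euclidean_space) \<Rightarrow> (real \<Rightarrow> 'a \<times> 'b) \<Rightarrow> bool" where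
  "minimizing_geodesic br \<gamma> \<longleftrightarrow>
     horizontal_curve br \<gamma> \<and>
     (\<forall>\<eta>. horizontal_curve br \<eta> \<and> \<eta> 0 = \<gamma> 0 \<and> \<eta> 1 = \<gamma> 1 \<longrightarrow> energy \<gamma> \<le> energy \<eta>)"

text \<open>Only the values on the unit interval are part of a curve.\<close>

definition unique_minimizing_geodesic ::
  "('a::euclidean_space \<Rightarrow> 'a \<Rightarrow> 'b::euclidean_space) \<Rightarrow> (real \<Rightarrow> 'a \<times> 'b) \<Rightarrow> bool" where
  "unique_minimizing_geodesic br \<gamma> \<longleftrightarrow>
     minimizing_geodesic br \<gamma> \<and>
     (\<forall>\<eta>. minimizing_geodesic br \<eta> \<and> \<eta> 0 = \<gamma> 0 \<and> \<eta> 1 = \<gamma> 1 \<longrightarrow> (\<forall>t\<in>{0..1}. \<eta> t = \<gamma> t))"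


section \<open>The sub-Riemannian exponential map\<close>

definition hamiltonian ::
  "('a::euclidean_space \<Rightarrow> 'a \<Rightarrow> 'b::euclidean_space) \<Rightarrow> 'a \<times> 'b \<Rightarrow> 'a \<times> 'b \<Rightarrow> real" where
  "hamiltonian br p \<xi> = 1/2 * (\<Sum>w\<in>Basis. (\<xi> \<bullet> horizontal_field br w p)\<^sup>2)"

text \<open>
  Hamilton's equations for a curve \<open>t \<mapsto> (p t, \<xi> t)\<close> in the cotangent bundle, with base point \<open>p t\<close>
  and covector \<open>\<xi> t\<close>; \<open>Hp\<close> and \<open>H\<xi>\<close> are the partial gradients of the Hamiltonian.
\<close>

definition hamiltonian_curve ::
  "('a::euclidean_space \<Rightarrow> 'a \<Rightarrow> 'b::euclidean_space) \<Rightarrow>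
     (real \<Rightarrow> 'a \<times> 'b) \<Rightarrow> (real \<Rightarrow> 'a \<times> 'b) \<Rightarrow> bool" where
  "hamiltonian_curve br p \<xi> \<longleftrightarrow>
     (\<forall>t\<in>{0..1}. \<exists>Hp H\<xi>.
        (GDERIV (\<lambda>q. hamiltonian br q (\<xi> t)) (p t) :> Hp) \<and>
        (GDERIV (\<lambda>\<eta>. hamiltonian br (p t) \<eta>) (\<xi> t) :> H\<xi>) \<and>
        (p has_vector_derivative H\<xi>) (at t within {0..1}) \<and>
        (\<xi> has_vector_derivative - Hp) (at t within {0..1}))"

definition sr_exp ::
  "('a::euclidean_space \<Rightarrow> 'a \<Rightarrow> 'b::euclidean_space) \<Rightarrow> 'a \<times> 'b \<Rightarrow> 'a \<times> 'b" where
  "sr_exp br \<xi>\<^sub>0 = (THE q. \<exists>p \<xi>. hamiltonian_curve br p \<xi> \<and> p 0 = 0 \<and> \<xi> 0 = \<xi>\<^sub>0 \<and> q = p 1)"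


section \<open>Smooth diffeomorphisms\<close>

text \<open>
  For open \<open>U\<close>, \<open>Ck_on n U f\<close> says that \<open>f\<close> is n times continuously differentiable on \<open>U\<close>: all
  iterated directional derivatives up to order \<open>n\<close> exist as Frechet derivatives and are continuous.
\<close>

fun Ck_on ::
  "nat \<Rightarrow> 'a::real_normed_vector set \<Rightarrow> ('a \<Rightarrow> 'b::real_normed_vector) \<Rightarrow> bool" where
  "Ck_on 0 U f \<longleftrightarrow> continuous_on U f"
| "Ck_on (Suc n) U f \<longleftrightarrow>
     (\<forall>x\<in>U. f differentiable (at x)) \<and> (\<forall>v. Ck_on n U (\<lambda>x. frechet_derivative f (at x) v))"

definition smooth_on :: "'a::real_normed_vector set \<Rightarrow> ('a \<Rightarrow> 'b::real_normed_vector) \<Rightarrow> bool" where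
  "smooth_on U f \<longleftrightarrow> (\<forall>n. Ck_on n U f)"

definition smooth_diffeomorphism ::
  "'a::real_normed_vector set \<Rightarrow> 'b::real_normed_vector set \<Rightarrow> ('a \<Rightarrow> 'b) \<Rightarrow> bool" where
  "smooth_diffeomorphism U V f \<longleftrightarrow>
     open U \<and> open V \<and> bij_betw f U V \<and> smooth_on U f \<and> smooth_on V (inv_into U f)"


section \<open>Consistency of the coordinate description\<close>

lemma inner_J:
  assumes "bilinear br"
  shows "X \<bullet> J br V Y = V \<bullet> br X Y"
proof -
  have "linear (\<lambda>X. br X Y)"
    using assms by (simp add: bilinear_def)
  then show ?thesis
    unfolding J_def by (simp add: adjoint_works inner_commute)
qed

lemma step2_bracket_skew:
  assumes "step2_bracket br"
  shows "br X Y = - br Y X"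
proof -
  have bl: "bilinear br" and z: "\<And>X. br X X = 0"
    using assms by (auto simp: step2_bracket_def)
  have "br (X + Y) (X + Y) = br X X + br X Y + (br Y X + br Y Y)"
    by (simp add: bilinear_ladd[OF bl] bilinear_radd[OF bl])
  then show ?thesis
    by (simp add: z eq_neg_iff_add_eq_0)
qed

lemma group_mult_group:
  assumes "step2_bracket br"
  shows "group_mult br (group_mult br p q) r = group_mult br p (group_mult br q r)"
    and "group_mult br 0 p = p" "group_mult br p 0 = p"
    and "group_mult br (- p) p = 0" "group_mult br p (- p) = 0"
proof -
  have bl: "bilinear br" and z: "\<And>X. br X X = 0"
    using assms by (auto simp: step2_bracket_def)
  note bs = bilinear_ladd[OF bl] bilinear_radd[OF bl] bilinear_lzero[OF bl] bilinear_rzero[OF bl]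
    bilinear_lneg[OF bl] bilinear_rneg[OF bl]
  show "group_mult br (group_mult br p q) r = group_mult br p (group_mult br q r)"
    by (simp add: group_mult_def lie_bracket_def prod_eq_iff bs algebra_simps)
  show "group_mult br 0 p = p" "group_mult br p 0 = p"
    "group_mult br (- p) p = 0" "group_mult br p (- p) = 0"
    by (simp_all add: group_mult_def lie_bracket_def prod_eq_iff bs z)
qed

lemma horizontal_field_at_0:
  assumes "bilinear br"
  shows "horizontal_field br w 0 = (w, 0)"
  by (simp add: horizontal_field_def bilinear_rzero[OF assms])

lemma horizontal_field_left_invariant:
  assumes "step2_bracket br"
  obtains D where "(group_mult br p has_derivative D) (at q)"
    and "\<And>w. D (horizontal_field br w q) = horizontal_field br w (group_mult br p q)"
proof -
  have bl: "bilinear br"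
    using assms by (simp add: step2_bracket_def)
  define D where "D = (\<lambda>h. h + (1/2) *\<^sub>R lie_bracket br p h)"
  have "linear (\<lambda>h. lie_bracket br p h)"
    unfolding lie_bracket_def
    by (rule linearI) (simp_all add: bilinear_radd[OF bl] bilinear_rmul[OF bl])
  then have "bounded_linear (\<lambda>h. lie_bracket br p h)"
    by (simp add: linear_conv_bounded_linear)
  then have "(lie_bracket br p has_derivative lie_bracket br p) (at q)"
    by (rule bounded_linear_imp_has_derivative)
  then have "((\<lambda>h. p + h + (1/2) *\<^sub>R lie_bracket br p h) has_derivative D) (at q)"
    unfolding D_def by (auto intro!: derivative_eq_intros)
  then have 1: "(group_mult br p has_derivative D) (at q)"
    by (simp add: group_mult_def[abs_def])
  have 2: "D (horizontal_field br w q) = horizontal_field br w (group_mult br p q)" for w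
    using step2_bracket_skew[OF assms, of "fst p" w]
    by (simp add: D_def horizontal_field_def group_mult_def lie_bracket_def prod_eq_iff
        bilinear_radd[OF bl] algebra_simps)
  from 1 2 that show thesis by blast
qed

lemma distribution_eq:
  assumes "bilinear br"
  shows "distribution br p = range (\<lambda>w. horizontal_field br w p)"
proof -
  have "linear (\<lambda>w. horizontal_field br w p)"
    unfolding horizontal_field_def
    by (rule linearI)
      (simp_all add: bilinear_ladd[OF assms] bilinear_lmul[OF assms] algebra_simps)
  then show ?thesis
    unfolding distribution_def by (simp add: linear_span_image)
qed

end

theory Submission
  imports Defs
begin

text \<open>
  The operators \<open>J_v\<close> commute with \<open>S\<close> and \<open>J_v\<^sup>2 = - |v|\<^sup>2 S\<^sup>2\<close>, so Hamilton's equations integrate in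
  closed form: \<open>exp (u, v) = (x, z)\<close> with \<open>x = f(S) u - g(S) J_v u\<close> and \<open>z\<close> a positive multiple of \<open>v\<close>.
  For the inverse, \<open>u\<close> is an explicit function of \<open>x\<close> and \<open>v\<close>, and \<open>v = \<rho> z\<close> where the scalar \<open>\<rho>\<close> solves
  one equation \<open>\<Theta> (x, z, \<rho>) = 1\<close> whose left-hand side has positive \<open>\<rho>\<close>-derivative as long as
  \<open>\<rho> |z| < 2 \<pi> / \<alpha>\<close>; the implicit function theorem makes \<open>\<rho>\<close> smooth. If \<open>x\<close> has a component along a top
  eigenvector of \<open>S\<close>, then \<open>\<Theta>\<close> runs from \<open>0\<close> to \<open>\<infinity>\<close>, so the image misses at most a hyperplane.

  For minimality take \<open>v\<close> as a Lagrange multiplier for the vertical displacement. The energy of a competitor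
  minus that of the geodesic becomes a quadratic form in the deviation \<open>\<phi>\<close>, and after adding the
  exact derivative of \<open>\<phi> \<bullet> T \<phi>\<close>, with \<open>T\<close> the matrix of tangents of \<open>(|v| S / 2) (t - 1/2)\<close>, it is a
  perfect square. This needs \<open>|v| \<alpha> / 4 < \<pi> / 2\<close>, which is the bound defining \<open>D\<close>.
\<close>

section \<open>Calculus of smooth maps\<close>

text \<open>Two obstacles shape the details. The formulas involve |v|, which is not differentiable
  at v = 0, and quotients like sin \<tau> / \<tau>; both are harmless once every coefficient is an
  entire function of |v|^2 s^2, with s an eigenvalue of \<open>S\<close>. Horizontal curves are only
  Lipschitz, so the calibration needs a fundamental theorem of calculus for a derivative that exists
  almost everywhere, with integrability as part of its conclusion. The bound 2 \<pi> / \<alpha>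
  enters twice. It is where 1 - cos (|v| s) first vanishes again for the top eigenvalue, so that x
  stops determining u; and it is where the tangent stops being finite on an interval of length 1.
  The tangent has frequency |v| S / 2, half of the naive one: the quadratic form |p|^2 + p \<bullet>
  J_v \<phi>, with p the derivative of \<phi>, is the square of p + J_v \<phi> / 2 up to the defect
  |J_v \<phi>|^2 / 4, and T absorbs this defect by solving the Riccati equation T' = (|v| S / 2)^2 +
  T^2.\<close>

lemma Ck_on_cong:
  assumes "open U" "\<And>x. x \<in> U \<Longrightarrow> f x = g x"
  shows "Ck_on n U f \<longleftrightarrow> Ck_on n U g"
  using assms(2)
proof (induction n arbitrary: f g)
  case 0
  then show ?case by (simp cong: continuous_on_cong)
next
  case (Suc n)
  have *: "(f has_derivative D) (at x) \<longleftrightarrow> (g has_derivative D) (at x)" if "x \<in> U" for D x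
    using has_derivative_transform_within_open[of f D x UNIV U g]
      has_derivative_transform_within_open[of g D x UNIV U f] assms(1) that Suc.prems by auto
  have "frechet_derivative f (at x) = frechet_derivative g (at x)" if "x \<in> U" for x
    unfolding frechet_derivative_def using *[OF that] by simp
  then have "Ck_on n U (\<lambda>x. frechet_derivative f (at x) v) \<longleftrightarrow>
    Ck_on n U (\<lambda>x. frechet_derivative g (at x) v)" for v
    by (intro Suc.IH) simp
  moreover have "f differentiable at x \<longleftrightarrow> g differentiable at x" if "x \<in> U" for x
    unfolding differentiable_def using *[OF that] by simp
  ultimately show ?case by simp
qed

text \<open>\<open>frechet_derivative\<close> is a choice, but derivatives at points of an open set
  are unique, so any explicit formula may take its place. Most closure rules below go through this
  introduction rule.\<close>

lemma Ck_on_SucI: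
  assumes "open U" "\<And>x. x \<in> U \<Longrightarrow> (f has_derivative f' x) (at x)"
    and "\<And>v. Ck_on n U (\<lambda>x. f' x v)"
  shows "Ck_on (Suc n) U f"
proof -
  have "f' x = frechet_derivative f (at x)" if "x \<in> U" for x
    using assms(2)[OF that] by (rule frechet_derivative_at)
  then have "Ck_on n U (\<lambda>x. frechet_derivative f (at x) v)" for v
    using Ck_on_cong[OF assms(1), of "\<lambda>x. f' x v" "\<lambda>x. frechet_derivative f (at x) v" n] assms(3)
    by simp
  then show ?thesis
    using assms(2) by (auto intro: differentiableI)
qed

lemma Ck_on_SucD:
  assumes "Ck_on (Suc n) U f" "x \<in> U"
  shows "(f has_derivative frechet_derivative f (at x)) (at x)"
  using assms by (simp add: frechet_derivative_works)

lemma Ck_on_pred: "Ck_on (Suc n) U f \<Longrightarrow> Ck_on n U f"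
proof (induction n arbitrary: f)
  case 0
  then show ?case
    by (auto intro!: continuous_at_imp_continuous_on differentiable_imp_continuous_within)
qed auto

lemma Ck_on_continuous: "Ck_on n U f \<Longrightarrow> continuous_on U f"
  by (induction n) (auto dest: Ck_on_pred simp del: Ck_on.simps(2))

lemma Ck_on_subset: "Ck_on n U f \<Longrightarrow> W \<subseteq> U \<Longrightarrow> Ck_on n W f"
  by (induction n arbitrary: f) (auto intro: continuous_on_subset)

lemma Ck_on_const: "Ck_on n U (\<lambda>x. c)"
  by (induction n arbitrary: c) auto

lemma Ck_on_compose_linear:
  assumes "open U" "bounded_linear L" "Ck_on n U f"
  shows "Ck_on n U (\<lambda>x. L (f x))"
  using assms(3)
proof (induction n arbitrary: f)
  case 0
  then show ?case
    using bounded_linear.continuous_on[OF assms(2)] by simp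
next
  case (Suc n)
  show ?case
  proof (rule Ck_on_SucI[OF assms(1)])
    show "((\<lambda>x. L (f x)) has_derivative (\<lambda>v. L (frechet_derivative f (at x) v))) (at x)"
      if "x \<in> U" for x
      using bounded_linear.has_derivative[OF assms(2) Ck_on_SucD[OF Suc.prems that]] .
    show "Ck_on n U (\<lambda>x. L (frechet_derivative f (at x) v))" for v
      using Suc by simp
  qed
qed

lemma Ck_on_ident: "open U \<Longrightarrow> Ck_on n U (\<lambda>x. x)"
  by (cases n, simp, simp only:, rule Ck_on_SucI[where f' = "\<lambda>x v. v"])
    (simp_all add: Ck_on_const has_derivative_ident)

lemma Ck_on_add:
  assumes "open U" "Ck_on n U f" "Ck_on n U g"
  shows "Ck_on n U (\<lambda>x. f x + g x)"
  using assms(2,3)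
proof (induction n arbitrary: f g)
  case 0
  then show ?case by (simp add: continuous_on_add)
next
  case (Suc n)
  note f = Ck_on_SucD[OF Suc.prems(1)] and g = Ck_on_SucD[OF Suc.prems(2)]
  show ?case
    by (rule Ck_on_SucI[OF assms(1) has_derivative_add[OF f g]])
      (use Suc in auto)
qed

lemma Ck_on_sum:
  assumes "open U" "\<And>i. i \<in> I \<Longrightarrow> Ck_on n U (f i)"
  shows "Ck_on n U (\<lambda>x. \<Sum>i\<in>I. f i x)"
  using assms(2)
  by (induction I rule: infinite_finite_induct) (auto intro!: Ck_on_add assms(1) Ck_on_const)

text \<open>The product rule leaves one factor undifferentiated, which \<open>Ck_on_pred\<close>
  lowers to order n before the induction hypothesis applies. Products, scaling, inner products and
  later \<open>J br\<close> are instances.\<close>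

lemma Ck_on_bilinear:
  assumes "open U" "bounded_bilinear p" "Ck_on n U f" "Ck_on n U g"
  shows "Ck_on n U (\<lambda>x. p (f x) (g x))"
  using assms(3,4)
proof (induction n arbitrary: f g)
  case 0
  then show ?case using bounded_bilinear.continuous_on[OF assms(2)] by simp
next
  case (Suc n)
  note f = Ck_on_SucD[OF Suc.prems(1)] and g = Ck_on_SucD[OF Suc.prems(2)]
  show ?case
  proof (rule Ck_on_SucI[OF assms(1)])
    show "((\<lambda>x. p (f x) (g x)) has_derivative (\<lambda>v. p (f x) (frechet_derivative g (at x) v)
        + p (frechet_derivative f (at x) v) (g x))) (at x)" if "x \<in> U" for x
      using bounded_bilinear.FDERIV[OF assms(2) f[OF that] g[OF that]] .
    show "Ck_on n U (\<lambda>x. p (f x) (frechet_derivative g (at x) v)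
        + p (frechet_derivative f (at x) v) (g x))" for v
      using Suc.prems Suc.prems[THEN Ck_on_pred] by (auto intro!: Ck_on_add assms(1) Suc.IH)
  qed
qed

lemmas Ck_on_mult = Ck_on_bilinear[OF _ bounded_bilinear_mult]
  and Ck_on_scaleR = Ck_on_bilinear[OF _ bounded_bilinear_scaleR]
  and Ck_on_inner = Ck_on_bilinear[OF _ bounded_bilinear_inner]

lemma Ck_on_power:
  fixes f :: "'a::real_normed_vector \<Rightarrow> 'b::real_normed_algebra_1"
  shows "open U \<Longrightarrow> Ck_on n U f \<Longrightarrow> Ck_on n U (\<lambda>x. f x ^ m)"
  by (induction m) (auto intro!: Ck_on_const Ck_on_mult)

lemma Ck_on_Pair:
  assumes "open U" "Ck_on n U f" "Ck_on n U g"
  shows "Ck_on n U (\<lambda>x. (f x, g x))"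
proof -
  have "Ck_on n U (\<lambda>x. (f x, 0) + (0, g x))"
    using assms bounded_linear_Pair[OF bounded_linear_ident bounded_linear_zero]
      bounded_linear_Pair[OF bounded_linear_zero bounded_linear_ident]
    by (intro Ck_on_add) (auto intro: Ck_on_compose_linear)
  then show ?thesis by simp
qed

text \<open>\<open>Ck_on\<close> knows derivatives only in fixed directions, while the chain rule
  feeds the outer derivative a direction that varies with x. Expanding that direction in
  \<open>Basis\<close> leaves fixed directions with scalar coefficients.\<close>

lemma Ck_on_compose:
  fixes f :: "'a::real_normed_vector \<Rightarrow> 'b::euclidean_space"
    and g :: "'b \<Rightarrow> 'c::real_normed_vector"
  assumes "open U" "Ck_on n U f" "Ck_on n V g" "f ` U \<subseteq> V"
  shows "Ck_on n U (\<lambda>x. g (f x))"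
  using assms(2,3)
proof (induction n arbitrary: g)
  case 0
  then show ?case
    using continuous_on_compose2[of V g U f] assms(4) by simp
next
  case (Suc n)
  note f = Ck_on_SucD[OF Suc.prems(1)] and g = Ck_on_SucD[OF Suc.prems(2)]
  show ?case
  proof (rule Ck_on_SucI[OF assms(1)])
    fix x assume x: "x \<in> U"
    define G where "G = frechet_derivative g (at (f x))"
    have G: "(g has_derivative G) (at (f x))"
      unfolding G_def by (rule g) (use assms(4) x in blast)
    have "linear G"
      by (rule bounded_linear.linear[OF has_derivative_bounded_linear[OF G]])
    then have "G (\<Sum>i\<in>Basis. (w \<bullet> i) *\<^sub>R i) = (\<Sum>i\<in>Basis. (w \<bullet> i) *\<^sub>R G i)" for w
      by (simp add: linear_sum linear_scale)
    then have *: "G w = (\<Sum>i\<in>Basis. (w \<bullet> i) *\<^sub>R G i)" for w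
      unfolding euclidean_representation .
    have "((\<lambda>x. g (f x)) has_derivative (\<lambda>v. G (frechet_derivative f (at x) v))) (at x)"
      by (rule has_derivative_compose[OF f[OF x] G])
    then show "((\<lambda>x. g (f x)) has_derivative (\<lambda>v. \<Sum>i\<in>Basis.
      (frechet_derivative f (at x) v \<bullet> i) *\<^sub>R frechet_derivative g (at (f x)) i)) (at x)"
      by (subst (asm) *) (unfold G_def)
  next
    have f: "Ck_on n U (\<lambda>x. frechet_derivative f (at x) v)" for v
      using Suc.prems(1) by simp
    have g: "Ck_on n U (\<lambda>x. frechet_derivative g (at (f x)) i)" for i
      by (rule Suc.IH[OF Ck_on_pred[OF Suc.prems(1)], where g = "\<lambda>y. frechet_derivative g (at y) i"])
        (use Suc.prems(2) in simp)
    show "Ck_on n U (\<lambda>x. \<Sum>i\<in>Basis.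
      (frechet_derivative f (at x) v \<bullet> i) *\<^sub>R frechet_derivative g (at (f x)) i)" for v
      by (rule Ck_on_sum[OF assms(1)])
        (rule Ck_on_scaleR[OF assms(1) Ck_on_inner[OF assms(1) f Ck_on_const] g])
  qed
qed

text \<open>The derivative is a constant times the square of the function itself, so the induction
  feeds itself.\<close>

lemma Ck_on_inverse_real: "Ck_on n {x::real. x \<noteq> 0} inverse"
proof (induction n)
  case 0
  then show ?case by (auto intro!: continuous_on_inverse)
next
  case (Suc n)
  have op: "open {x::real. x \<noteq> 0}"
    by (intro open_Collect_neq continuous_intros)
  show ?case
  proof (rule Ck_on_SucI[OF op])
    show "(inverse has_derivative (\<lambda>v. (- v) *\<^sub>R (inverse x * inverse x))) (at x)"
      if "x \<in> {x::real. x \<noteq> 0}" for x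
      using has_derivative_inverse'[of x] that by (simp add: mult.assoc mult.commute mult.left_commute)
    show "Ck_on n {x::real. x \<noteq> 0} (\<lambda>x. (- v) *\<^sub>R (inverse x * inverse x))" for v
      by (rule Ck_on_scaleR[OF op Ck_on_const Ck_on_mult[OF op Suc Suc]])
  qed
qed

lemma Ck_on_divide:
  fixes f g :: "'a::real_normed_vector \<Rightarrow> real"
  assumes "open U" "Ck_on n U f" "Ck_on n U g" "\<And>x. x \<in> U \<Longrightarrow> g x \<noteq> 0"
  shows "Ck_on n U (\<lambda>x. f x / g x)"
proof -
  have "Ck_on n U (\<lambda>x. inverse (g x))"
    by (rule Ck_on_compose[OF assms(1,3) Ck_on_inverse_real]) (use assms(4) in auto)
  then show ?thesis
    unfolding divide_inverse by (rule Ck_on_mult[OF assms(1,2)])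
qed

text \<open>Termwise differentiation gives another everywhere convergent series, so the induction
  runs over all coefficient sequences at once.\<close>

lemma Ck_on_power_series:
  fixes c :: "nat \<Rightarrow> real"
  assumes "\<And>y. summable (\<lambda>n. c n * y ^ n)" "open U"
  shows "Ck_on m U (\<lambda>x. \<Sum>n. c n * x ^ n)"
  using assms(1)
proof (induction m arbitrary: c)
  case 0
  have "isCont (\<lambda>x. \<Sum>n. c n * x ^ n) x" for x
    by (rule DERIV_isCont, rule termdiffs_strong_converges_everywhere, rule 0)
  then show ?case
    unfolding Ck_on.simps by (intro continuous_at_imp_continuous_on ballI)
next
  case (Suc m)
  show ?case
  proof (rule Ck_on_SucI[OF assms(2)])
    show "((\<lambda>x. \<Sum>n. c n * x ^ n) has_derivative (\<lambda>v. v *\<^sub>R (\<Sum>n. diffs c n * x ^ n))) (at x)" for x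
    proof -
      have "((\<lambda>x. \<Sum>n. c n * x ^ n) has_field_derivative (\<Sum>n. diffs c n * x ^ n)) (at x)"
        by (rule termdiffs_strong_converges_everywhere, rule Suc.prems)
      then show ?thesis
        unfolding has_field_derivative_def real_scaleR_def mult_commute_abs .
    qed
    show "Ck_on m U (\<lambda>x. v *\<^sub>R (\<Sum>n. diffs c n * x ^ n))" for v
      by (rule Ck_on_scaleR[OF assms(2) Ck_on_const Suc.IH], rule termdiff_converges_all, rule Suc.prems)
  qed
qed

lemma smooth_on_continuous: "smooth_on U f \<Longrightarrow> continuous_on U f"
  unfolding smooth_on_def using Ck_on_continuous by blast

section \<open>Functions defined implicitly by one scalar equation\<close>

text \<open>Here g is given and only its differentiability is at stake; not even its continuity is
  presupposed. The map (y, s) to (y, \<Theta> (y, s)) is injective on \<open>U\<close> by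
  \<open>inj\<close>, so it has a left inverse to which the inverse function theorem applies, and g
  is the last component of that inverse on the slice \<Theta> = c.\<close>

lemma implicit_function_derivative:
  fixes \<Theta> :: "'a::euclidean_space \<times> real \<Rightarrow> real"
  assumes "open U" "open W" "continuous_on U \<Theta>"
    and der: "(\<Theta> has_derivative \<Theta>') (at (y, g y))" and "\<Theta>' (0, 1) \<noteq> 0"
    and inj: "\<And>y s t. (y, s) \<in> U \<Longrightarrow> (y, t) \<in> U \<Longrightarrow> \<Theta> (y, s) = \<Theta> (y, t) \<Longrightarrow> s = t"
    and sol: "\<And>y. y \<in> W \<Longrightarrow> (y, g y) \<in> U \<and> \<Theta> (y, g y) = c"
    and "y \<in> W"
  shows "(g has_derivative (\<lambda>w. - \<Theta>' (w, 0) / \<Theta>' (0, 1))) (at y)"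
proof -
  define \<Psi> where "\<Psi> = (\<lambda>p. (fst p, \<Theta> p))"
  define G where "G = inv_into U \<Psi>"
  have lin: "linear \<Theta>'"
    by (rule bounded_linear.linear[OF has_derivative_bounded_linear[OF der]])
  have split: "\<Theta>' (w, s) = \<Theta>' (w, 0) + s * \<Theta>' (0, 1)" for w s
  proof -
    have "(w, s) = (w, 0) + s *\<^sub>R (0, 1)" by simp
    then show ?thesis by (simp only: linear_add[OF lin] linear_scale[OF lin] real_scaleR_def)
  qed
  have "inj_on \<Psi> U"
  proof (rule inj_onI)
    fix p q assume "p \<in> U" "q \<in> U" "\<Psi> p = \<Psi> q"
    then show "p = q"
      using inj[of "fst p" "snd p" "snd q"] by (cases p, cases q) (simp add: \<Psi>_def)
  qed
  then have G: "G (\<Psi> p) = p" if "p \<in> U" for p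
    unfolding G_def using that by simp
  have "(G has_derivative (\<lambda>(w, s). (w, (s - \<Theta>' (w, 0)) / \<Theta>' (0, 1)))) (at (\<Psi> (y, g y)))"
  proof (rule has_derivative_inverse_strong[OF assms(1), where f = \<Psi> and x = "(y, g y)"])
    show "G (\<Psi> p) = p" if "p \<in> U" for p by (rule G[OF that])
    show "(y, g y) \<in> U" using sol \<open>y \<in> W\<close> by blast
    show "continuous_on U \<Psi>"
      unfolding \<Psi>_def by (rule continuous_on_Pair[OF continuous_on_fst[OF continuous_on_id] assms(3)])
    show "(\<Psi> has_derivative (\<lambda>p. (fst p, \<Theta>' p))) (at (y, g y))"
      unfolding \<Psi>_def by (rule has_derivative_Pair[OF has_derivative_fst[OF has_derivative_ident] der])
    show "(\<lambda>p. (fst p, \<Theta>' p)) \<circ> (\<lambda>(w, s). (w, (s - \<Theta>' (w, 0)) / \<Theta>' (0, 1))) = id"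
    proof
      fix p :: "'a \<times> real"
      have "\<Theta>' (fst p, (snd p - \<Theta>' (fst p, 0)) / \<Theta>' (0, 1)) = snd p"
        using assms(5) by (subst split) simp
      then show "((\<lambda>p. (fst p, \<Theta>' p)) \<circ> (\<lambda>(w, s). (w, (s - \<Theta>' (w, 0)) / \<Theta>' (0, 1)))) p = id p"
        by (simp add: case_prod_beta)
    qed
  qed
  then have "(G has_derivative (\<lambda>(w, s). (w, (s - \<Theta>' (w, 0)) / \<Theta>' (0, 1)))) (at (y, c))"
    using sol[OF \<open>y \<in> W\<close>] by (simp add: \<Psi>_def)
  note dG = has_derivative_compose[where f = "\<lambda>y. (y, c)" and f' = "\<lambda>w. (w, 0)", OF _ this]
  have "((\<lambda>y. G (y, c)) has_derivative (\<lambda>w. (w, - \<Theta>' (w, 0) / \<Theta>' (0, 1)))) (at y)"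
    by (rule has_derivative_eq_rhs, rule dG)
      (rule has_derivative_Pair[OF has_derivative_ident has_derivative_const], simp)
  then have "((\<lambda>y. snd (G (y, c))) has_derivative (\<lambda>w. - \<Theta>' (w, 0) / \<Theta>' (0, 1))) (at y)"
    by (rule has_derivative_snd[THEN has_derivative_eq_rhs]) simp
  then show ?thesis
  proof (rule has_derivative_transform_within_open[OF _ \<open>open W\<close> \<open>y \<in> W\<close>])
    show "snd (G (y, c)) = g y" if "y \<in> W" for y
      using G[of "(y, g y)"] sol[OF that] by (simp add: \<Psi>_def)
  qed
qed

text \<open>A bootstrap: the derivative of g contains g only through the point (y, g y), so order n
  of g gives order n of its derivative.\<close>

lemma implicit_function_smooth:
  fixes \<Theta> :: "'a::euclidean_space \<times> real \<Rightarrow> real"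
  assumes "open U" "open W" and smooth: "smooth_on U \<Theta>"
    and nz: "\<And>p. p \<in> U \<Longrightarrow> frechet_derivative \<Theta> (at p) (0, 1) \<noteq> 0"
    and inj: "\<And>y s t. (y, s) \<in> U \<Longrightarrow> (y, t) \<in> U \<Longrightarrow> \<Theta> (y, s) = \<Theta> (y, t) \<Longrightarrow> s = t"
    and sol: "\<And>y. y \<in> W \<Longrightarrow> (y, g y) \<in> U \<and> \<Theta> (y, g y) = c"
  shows "smooth_on W g"
  unfolding smooth_on_def
proof
  note Ck = smooth[unfolded smooth_on_def, rule_format]
  have der: "(g has_derivative (\<lambda>w. - frechet_derivative \<Theta> (at (y, g y)) (w, 0) /
      frechet_derivative \<Theta> (at (y, g y)) (0, 1))) (at y)" if "y \<in> W" for y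
  proof (rule implicit_function_derivative[OF assms(1,2) smooth_on_continuous[OF smooth] _ _ inj sol that])
    show "(\<Theta> has_derivative frechet_derivative \<Theta> (at (y, g y))) (at (y, g y))"
      using sol[OF that] by (intro Ck_on_SucD[OF Ck[of "Suc 0"]]) simp
  qed (use sol[OF that] nz in auto)
  fix n show "Ck_on n W g"
  proof (induction n)
    case 0
    show ?case
      using has_derivative_continuous[OF der] by (simp add: continuous_at_imp_continuous_on)
  next
    case (Suc n)
    have "Ck_on n W (\<lambda>y. frechet_derivative \<Theta> (at (y, g y)) v)" for v
    proof (rule Ck_on_compose[OF assms(2) Ck_on_Pair[OF assms(2) Ck_on_ident[OF assms(2)] Suc]])
      show "Ck_on n U (\<lambda>p. frechet_derivative \<Theta> (at p) v)"
        using Ck[of "Suc n"] unfolding Ck_on.simps by blast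
      show "(\<lambda>y. (y, g y)) ` W \<subseteq> U"
        using sol by blast
    qed
    then have "Ck_on n W (\<lambda>y. (-1) * frechet_derivative \<Theta> (at (y, g y)) (w, 0) /
      frechet_derivative \<Theta> (at (y, g y)) (0, 1))" for w
      using sol nz by (intro Ck_on_divide[OF assms(2)] Ck_on_mult[OF assms(2)] Ck_on_const) auto
    then show ?case
      by (intro Ck_on_SucI[OF assms(2) der]) simp_all
  qed
qed

lemma Ck_on_fst: "open U \<Longrightarrow> Ck_on n U f \<Longrightarrow> Ck_on n U (\<lambda>x. fst (f x))"
  by (rule Ck_on_compose_linear[OF _ bounded_linear_fst])

lemma Ck_on_snd: "open U \<Longrightarrow> Ck_on n U f \<Longrightarrow> Ck_on n U (\<lambda>x. snd (f x))"
  by (rule Ck_on_compose_linear[OF _ bounded_linear_snd])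

lemma Ck_on_diff:
  assumes "open U" "Ck_on n U f" "Ck_on n U g"
  shows "Ck_on n U (\<lambda>x. f x - g x)"
  using Ck_on_add[OF assms(1,2) Ck_on_compose_linear[OF assms(1) bounded_linear_minus[OF bounded_linear_ident] assms(3)]]
  by simp

section \<open>Lipschitz functions of a real variable\<close>

lemma has_vector_derivative_difference_quotients:
  assumes "(f has_vector_derivative D) (at t)"
  shows "(\<lambda>n. real (Suc n) *\<^sub>R (f (t + 1 / real (Suc n)) - f t)) \<longlonglongrightarrow> D"
proof -
  have "((\<lambda>h. norm (f (t + h) - f t - h *\<^sub>R D) / norm h) \<longlongrightarrow> 0) (at 0)"
    using assms by (simp add: has_vector_derivative_def has_derivative_at)
  moreover have "filterlim (\<lambda>n. 1 / real (Suc n)) (at 0) sequentially"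
    by (rule filterlim_atI) (use LIMSEQ_inverse_real_of_nat in \<open>simp_all add: inverse_eq_divide\<close>)
  ultimately have "(\<lambda>n. norm (f (t + 1 / real (Suc n)) - f t - (1 / real (Suc n)) *\<^sub>R D)
      / norm (1 / real (Suc n))) \<longlonglongrightarrow> 0"
    by (rule filterlim_compose)
  moreover have "norm (f (t + 1 / real (Suc n)) - f t - (1 / real (Suc n)) *\<^sub>R D) / norm (1 / real (Suc n))
      = norm (real (Suc n) *\<^sub>R (f (t + 1 / real (Suc n)) - f t) - D)" for n
  proof -
    have "real (Suc n) *\<^sub>R (f (t + 1 / real (Suc n)) - f t) - D
        = real (Suc n) *\<^sub>R (f (t + 1 / real (Suc n)) - f t - (1 / real (Suc n)) *\<^sub>R D)"
      by (simp add: scaleR_diff_right del: of_nat_Suc)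
    then show ?thesis by (simp del: of_nat_Suc)
  qed
  ultimately have "(\<lambda>n. norm (real (Suc n) *\<^sub>R (f (t + 1 / real (Suc n)) - f t) - D)) \<longlonglongrightarrow> 0"
    by (simp only:)
  then show ?thesis
    by (rule LIM_zero_cancel[OF tendsto_norm_zero_cancel])
qed

text \<open>Difference quotients are dominated by L and converge to f' almost everywhere, while
  their integrals are difference quotients of an antiderivative of f at b and at a, which tend to f
  b - f a. Nothing is assumed about the measurability of f'; its integrability comes out of
  dominated convergence.\<close>

theorem lipschitz_fundamental_theorem_of_calculus:
  fixes f :: "real \<Rightarrow> 'a::euclidean_space"
  assumes "a \<le> b" "L-lipschitz_on {a..b} f" "negligible N"
    and der: "\<And>t. t \<in> {a..b} - N \<Longrightarrow> (f has_vector_derivative f' t) (at t within {a..b})"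
  shows "(f' has_integral (f b - f a)) {a..b}"
proof -
  \<comment> \<open>Clamping extends f with the same Lipschitz constant, so forward quotients near b
    make sense.\<close>
  define F where "F t = f (max a (min b t))" for t
  have F: "F t = f t" if "t \<in> {a..b}" for t
    using that by (simp add: F_def)
  have lip: "L-lipschitz_on UNIV F"
  proof (rule lipschitz_onI)
    fix s t :: real
    have "dist (F s) (F t) \<le> L * dist (max a (min b s)) (max a (min b t))"
      unfolding F_def using assms(1) by (intro lipschitz_onD[OF assms(2)]) auto
    also have "\<dots> \<le> L * dist s t"
      using lipschitz_on_nonneg[OF assms(2)] by (intro mult_left_mono) (auto simp: dist_real_def)
    finally show "dist (F s) (F t) \<le> L * dist s t" .
  qed (rule lipschitz_on_nonneg[OF assms(2)])
  then have cont: "continuous_on A F" for A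
    by (meson lipschitz_on_continuous_on continuous_on_subset subset_UNIV)
  \<comment> \<open>The margin leaves room for shifts by at most 1 and makes every derivative of
    \<open>\<Phi>\<close> that is used two-sided.\<close>
  obtain \<Phi> where \<Phi>: "\<And>x. x \<in> {a - 1..b + 2} \<Longrightarrow>
      (\<Phi> has_vector_derivative F x) (at x within {a - 1..b + 2})"
    using antiderivative_continuous[OF cont] by blast
  have \<Phi>_at: "(\<Phi> has_vector_derivative F x) (at x)" if "x \<in> {a - 1<..<b + 2}" for x
    using \<Phi>[of x] that by (simp add: at_within_Icc_at)
  define q where "q n t = real (Suc n) *\<^sub>R (F (t + 1 / real (Suc n)) - F t)" for n t
  define I where "I n = real (Suc n) *\<^sub>R (\<Phi> (b + 1 / real (Suc n)) - \<Phi> b)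
    - real (Suc n) *\<^sub>R (\<Phi> (a + 1 / real (Suc n)) - \<Phi> a)" for n
  \<comment> \<open>The endpoints join the exceptional set because the given derivatives are
    one-sided there.\<close>
  have neg: "negligible (N \<union> {a, b})"
    using assms(3) by (simp add: negligible_Un)
  have spike: "(g has_integral y) ({a..b} - (N \<union> {a, b})) \<longleftrightarrow> (g has_integral y) {a..b}"
    for g :: "real \<Rightarrow> 'c::euclidean_space" and y
    by (rule has_integral_spike_set_eq; rule negligible_subset[OF neg]) auto
  have "(q n has_integral I n) {a..b}" for n
  proof -
    let ?h = "1 / real (Suc n)"
    let ?Q = "\<lambda>t. real (Suc n) *\<^sub>R (\<Phi> (t + ?h) - \<Phi> t)"
    have h: "0 < ?h" "?h \<le> 1" by (auto simp: field_simps)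
    have "(q n has_integral ?Q b - ?Q a) {a..b}"
    proof (rule fundamental_theorem_of_calculus[OF assms(1)])
      fix t assume "t \<in> {a..b}"
      then have t: "t \<in> {a - 1<..<b + 2}" "t + ?h \<in> {a - 1<..<b + 2}"
        using h unfolding atLeastAtMost_iff greaterThanLessThan_iff by linarith+
      have "((\<lambda>t. \<Phi> (t + ?h)) has_vector_derivative F (t + ?h)) (at t)"
      proof -
        have "((\<lambda>t. t + ?h) has_vector_derivative 1) (at t)"
          by (auto intro!: derivative_eq_intros)
        from vector_diff_chain_at[OF this \<Phi>_at[OF t(2)]] show ?thesis by (simp add: o_def)
      qed
      then have "(?Q has_vector_derivative q n t) (at t)"
        unfolding q_def using \<Phi>_at[OF t(1)]
        by (intro has_vector_derivative_scaleR[THEN has_vector_derivative_eq_rhs]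
            has_vector_derivative_diff) (auto intro!: derivative_eq_intros)
      then show "(?Q has_vector_derivative q n t) (at t within {a..b})"
        by (rule has_vector_derivative_at_within)
    qed
    then show ?thesis by (simp add: I_def)
  qed
  then have q_int: "(q n has_integral I n) ({a..b} - (N \<union> {a, b}))" for n
    by (simp only: spike)
  have "I \<longlonglongrightarrow> F b - F a"
    unfolding I_def using assms(1)
    by (intro tendsto_diff has_vector_derivative_difference_quotients \<Phi>_at) auto
  then have I: "I \<longlonglongrightarrow> f b - f a"
    using assms(1) by (simp add: F)
  have "(f' has_integral (f b - f a)) ({a..b} - (N \<union> {a, b}))"
  proof (rule has_integral_dominated_convergence[OF q_int _ _ _ I])
    show "(\<lambda>_. L) integrable_on ({a..b} - (N \<union> {a, b}))"
      using integrable_const_ivl unfolding integrable_on_def spike .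
    show "\<forall>t\<in>{a..b} - (N \<union> {a, b}). norm (q n t) \<le> L" for n
    proof
      fix t
      have "norm (F (t + 1 / real (Suc n)) - F t) \<le> L * (1 / real (Suc n))"
        using lipschitz_onD[OF lip, of "t + 1 / real (Suc n)" t]
        by (simp add: dist_norm del: of_nat_Suc)
      then show "norm (q n t) \<le> L"
        by (simp add: q_def pos_le_divide_eq mult.commute del: of_nat_Suc)
    qed
    show "\<forall>t\<in>{a..b} - (N \<union> {a, b}). (\<lambda>n. q n t) \<longlonglongrightarrow> f' t"
    proof
      fix t assume t: "t \<in> {a..b} - (N \<union> {a, b})"
      then have "(f has_vector_derivative f' t) (at t)"
        using der[of t] by (auto simp: at_within_Icc_at)
      then have "(F has_vector_derivative f' t) (at t)"
        using t by (elim has_vector_derivative_transform_within_open[of _ _ _ "{a<..<b}"]) (auto simp: F)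
      then show "(\<lambda>n. q n t) \<longlonglongrightarrow> f' t"
        unfolding q_def by (rule has_vector_derivative_difference_quotients)
    qed
  qed
  then show ?thesis
    by (simp only: spike)
qed

lemma lipschitz_on_bilinear:
  fixes f :: "'a::metric_space \<Rightarrow> 'b::real_normed_vector" and g :: "'a \<Rightarrow> 'c::real_normed_vector"
  assumes "bounded_bilinear p" "A-lipschitz_on X f" "B-lipschitz_on X g" "compact X"
  obtains C where "C-lipschitz_on X (\<lambda>x. p (f x) (g x))"
proof -
  have "bounded (f ` X)" "bounded (g ` X)"
    using assms by (auto intro!: compact_imp_bounded compact_continuous_image lipschitz_on_continuous_on)
  then obtain M N where M: "\<And>x. x \<in> X \<Longrightarrow> norm (f x) \<le> M" and N: "\<And>x. x \<in> X \<Longrightarrow> norm (g x) \<le> N"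
    unfolding bounded_iff by blast
  obtain K where K: "K \<ge> 0" "\<And>a b. norm (p a b) \<le> norm a * norm b * K"
    using bounded_bilinear.nonneg_bounded[OF assms(1)] by blast
  have A: "A \<ge> 0" and B: "B \<ge> 0" using assms lipschitz_on_nonneg by blast+
  have "((\<bar>M\<bar> * B + A * \<bar>N\<bar>) * K)-lipschitz_on X (\<lambda>x. p (f x) (g x))"
  proof (rule lipschitz_onI)
    fix x y assume xy: "x \<in> X" "y \<in> X"
    have "p (f x) (g x) - p (f y) (g y) = p (f x) (g x - g y) + p (f x - f y) (g y)"
      by (simp add: bounded_bilinear.diff_left[OF assms(1)] bounded_bilinear.diff_right[OF assms(1)])
    then have "dist (p (f x) (g x)) (p (f y) (g y)) \<le> norm (p (f x) (g x - g y)) + norm (p (f x - f y) (g y))"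
      unfolding dist_norm using norm_triangle_ineq by simp
    also have "\<dots> \<le> norm (f x) * norm (g x - g y) * K + norm (f x - f y) * norm (g y) * K"
      by (intro add_mono K)
    also have "\<dots> \<le> \<bar>M\<bar> * (B * dist x y) * K + (A * dist x y) * \<bar>N\<bar> * K"
      using lipschitz_onD[OF assms(2) xy] lipschitz_onD[OF assms(3) xy] M[OF xy(1)] N[OF xy(2)] K(1) A B
      by (intro add_mono mult_mono mult_right_mono) (auto simp: dist_norm)
    finally show "dist (p (f x) (g x)) (p (f y) (g y)) \<le> (\<bar>M\<bar> * B + A * \<bar>N\<bar>) * K * dist x y"
      by (simp add: algebra_simps)
  qed (use K A B in simp)
  then show thesis by (rule that)
qed

lemma C1_lipschitz_on:
  fixes f :: "real \<Rightarrow> 'a::real_normed_vector"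
  assumes "\<And>t. t \<in> {a..b} \<Longrightarrow> (f has_vector_derivative f' t) (at t within {a..b})"
    and "continuous_on {a..b} f'"
  obtains L where "L-lipschitz_on {a..b} f"
proof -
  have "bounded (f' ` {a..b})"
    by (intro compact_imp_bounded compact_continuous_image assms compact_Icc)
  then obtain M where M: "\<And>x. x \<in> {a..b} \<Longrightarrow> norm (f' x) \<le> M"
    unfolding bounded_iff by blast
  have "\<bar>M\<bar>-lipschitz_on {a..b} f"
  proof (rule bounded_derivative_imp_lipschitz)
    show "(f has_derivative (\<lambda>h. h *\<^sub>R f' x)) (at x within {a..b})" if "x \<in> {a..b}" for x
      using assms(1)[OF that] by (simp add: has_vector_derivative_def)
    show "onorm (\<lambda>h. h *\<^sub>R f' x) \<le> \<bar>M\<bar>" if "x \<in> {a..b}" for x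
    proof (rule onorm_bound)
      show "norm (h *\<^sub>R f' x) \<le> \<bar>M\<bar> * norm h" for h
        using mult_right_mono[of "norm (f' x)" "\<bar>M\<bar>" "\<bar>h\<bar>"] M[OF that] by (simp add: mult.commute)
    qed simp
  qed auto
  then show thesis by (rule that)
qed

lemma lipschitz_vector_derivative_bound:
  fixes f :: "real \<Rightarrow> 'a::euclidean_space"
  assumes "L-lipschitz_on {a..b} f" "t \<in> {a<..<b}" "(f has_vector_derivative D) (at t)"
  shows "norm D \<le> L"
proof -
  have "(\<lambda>n. t + inverse (real (Suc n))) \<longlonglongrightarrow> t"
    using tendsto_add[OF tendsto_const LIMSEQ_inverse_real_of_nat, of t] by simp
  then have "\<forall>\<^sub>F n in sequentially. t + inverse (real (Suc n)) < b"
    using assms(2) by (intro order_tendstoD) auto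
  then have "\<forall>\<^sub>F n in sequentially. norm (real (Suc n) *\<^sub>R (f (t + 1 / real (Suc n)) - f t)) \<le> L"
  proof eventually_elim
    case (elim n)
    have "t + 1 / real (Suc n) \<in> {a..b}" "t \<in> {a..b}"
      using elim assms(2) by (auto simp: inverse_eq_divide add_increasing2)
    then have "norm (f (t + 1 / real (Suc n)) - f t) \<le> L * (1 / real (Suc n))"
      using lipschitz_onD[OF assms(1), of "t + 1 / real (Suc n)" t]
      by (simp add: dist_norm del: of_nat_Suc)
    then show ?case
      by (simp add: pos_le_divide_eq mult.commute del: of_nat_Suc)
  qed
  then show ?thesis
    by (rule Lim_norm_ubound[OF _ has_vector_derivative_difference_quotients[OF assms(3)], rotated]) simp
qed

text \<open>Ensures that the energy of a competitor is a genuine integral and not the default value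
  of \<open>integral\<close>. The fundamental theorem makes f' integrable, hence measurable, and the
  Lipschitz constant bounds it.\<close>

lemma lipschitz_derivative_norm_square_integrable:
  fixes f :: "real \<Rightarrow> 'a::euclidean_space"
  assumes "a \<le> b" "L-lipschitz_on {a..b} f" "negligible N"
    and der: "\<And>t. t \<in> {a..b} - N \<Longrightarrow> (f has_vector_derivative f' t) (at t within {a..b})"
  shows "(\<lambda>t. (norm (f' t))\<^sup>2) integrable_on {a..b}"
proof -
  have neg: "negligible (N \<union> {a, b})"
    using assms(3) by (simp add: negligible_Un)
  \<comment> \<open>The value 0 on the exceptional set makes the bound by L hold at every
    point.\<close>
  define g where "g t = (if t \<in> N \<union> {a, b} then 0 else f' t)" for t
  have g: "norm (g t) \<le> L" if "t \<in> {a..b}" for t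
  proof (cases "t \<in> N \<union> {a, b}")
    case True
    then show ?thesis
      using lipschitz_on_nonneg[OF assms(2)] by (simp add: g_def)
  next
    case False
    then have "t \<in> {a<..<b}" using that by auto
    then show ?thesis
      using lipschitz_vector_derivative_bound[OF assms(2), of t "f' t"] der[of t] False
      by (simp add: g_def at_within_Icc_at)
  qed
  have "f' integrable_on {a..b}"
    using lipschitz_fundamental_theorem_of_calculus[OF assms] by blast
  then have "g integrable_on {a..b}"
    by (rule integrable_spike[OF _ neg]) (simp add: g_def)
  then have "(\<lambda>t. (norm (g t))\<^sup>2) \<in> borel_measurable (lebesgue_on {a..b})"
    using integrable_imp_measurable by measurable
  then have "(\<lambda>t. (norm (g t))\<^sup>2) absolutely_integrable_on {a..b}"
  proof (rule measurable_bounded_by_integrable_imp_absolutely_integrable)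
    show "(\<lambda>_. L\<^sup>2) integrable_on {a..b}" by (rule integrable_const_ivl)
    show "norm ((norm (g t))\<^sup>2) \<le> L\<^sup>2" if "t \<in> {a..b}" for t
      using power_mono[OF g[OF that], of 2] by simp
  qed simp
  then have "(\<lambda>t. (norm (g t))\<^sup>2) integrable_on {a..b}"
    by (rule absolutely_integrable_on_def[THEN iffD1, THEN conjunct1])
  then show ?thesis
    by (rule integrable_spike[OF _ neg]) (simp add: g_def)
qed

lemma has_vector_derivative_zero_Icc:
  fixes f :: "real \<Rightarrow> 'c::real_normed_vector"
  assumes "\<And>t. t \<in> {a..b} \<Longrightarrow> (f has_vector_derivative 0) (at t within {a..b})" "t \<in> {a..b}"
  shows "f t = f a"
proof -
  obtain c where "\<And>x. x \<in> {a..b} \<Longrightarrow> f x = c"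
    using has_vector_derivative_zero_constant[of "{a..b}" f] assms(1) by auto
  then show ?thesis using assms(2) by simp
qed

text \<open>Identifies the gradients that \<open>hamiltonian_curve\<close> quantifies
  existentially.\<close>

lemma gderiv_unique:
  assumes "GDERIV f x :> D" "GDERIV f x :> E"
  shows "D = E"
proof -
  have "(\<lambda>h. h \<bullet> D) = (\<lambda>h. h \<bullet> E)"
    using assms unfolding gderiv_def by (rule has_derivative_unique)
  then show ?thesis
    by (intro vector_eq_ldot[THEN iffD1]) (simp add: fun_eq_iff)
qed

section \<open>Closure properties of Lipschitz functions\<close>

text \<open>The constant is hidden so that compound expressions can be handled by purely syntactic
  closure rules.\<close>

definition lip :: "real set \<Rightarrow> (real \<Rightarrow> 'a::real_normed_vector) \<Rightarrow> bool" where
  "lip X f \<longleftrightarrow> (\<exists>L. L-lipschitz_on X f)"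

lemma lip_linear:
  assumes "bounded_linear h" "lip X f"
  shows "lip X (\<lambda>t. h (f t))"
proof -
  obtain K where K: "K \<ge> 0" "\<And>x. norm (h x) \<le> norm x * K"
    using bounded_linear.nonneg_bounded[OF assms(1)] by blast
  obtain L where L: "L-lipschitz_on X f"
    using assms(2) unfolding lip_def by blast
  have "(L * K)-lipschitz_on X (\<lambda>t. h (f t))"
  proof (rule lipschitz_onI)
    fix s t assume "s \<in> X" "t \<in> X"
    then have "norm (f s - f t) * K \<le> L * dist s t * K"
      using lipschitz_onD[OF L] K(1) by (intro mult_right_mono) (auto simp: dist_norm)
    then show "dist (h (f s)) (h (f t)) \<le> L * K * dist s t"
      using K(2)[of "f s - f t"] by (simp add: dist_norm linear_diff[OF bounded_linear.linear[OF assms(1)]] mult_ac)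
  qed (use K lipschitz_on_nonneg[OF L] in simp)
  then show ?thesis unfolding lip_def by blast
qed

lemma lip_const: "lip X (\<lambda>t. c)"
  unfolding lip_def using lipschitz_on_constant by blast

lemma lip_add:
  assumes "lip X f" "lip X g"
  shows "lip X (\<lambda>t. f t + g t)"
proof -
  obtain L M where L: "L-lipschitz_on X f" and M: "M-lipschitz_on X g"
    using assms unfolding lip_def by blast
  have "(L + M)-lipschitz_on X (\<lambda>t. f t + g t)"
  proof (rule lipschitz_onI)
    fix s t assume st: "s \<in> X" "t \<in> X"
    show "dist (f s + g s) (f t + g t) \<le> (L + M) * dist s t"
      using dist_triangle_add[of "f s" "g s" "f t" "g t"] lipschitz_onD[OF L st] lipschitz_onD[OF M st]
      by (simp add: algebra_simps)
  qed (use lipschitz_on_nonneg[OF L] lipschitz_on_nonneg[OF M] in simp)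
  then show ?thesis unfolding lip_def by blast
qed

lemma lip_diff: "lip X f \<Longrightarrow> lip X g \<Longrightarrow> lip X (\<lambda>t. f t - g t)"
  using lip_add[OF _ lip_linear[OF bounded_linear_minus[OF bounded_linear_ident]], of X f g] by simp

lemma lip_sum: "(\<And>i. i \<in> I \<Longrightarrow> lip X (f i)) \<Longrightarrow> lip X (\<lambda>t. \<Sum>i\<in>I. f i t)"
  by (induction I rule: infinite_finite_induct) (auto intro!: lip_add lip_const)

lemma lip_bilinear: "bounded_bilinear p \<Longrightarrow> compact X \<Longrightarrow> lip X f \<Longrightarrow> lip X g \<Longrightarrow> lip X (\<lambda>t. p (f t) (g t))"
  unfolding lip_def using lipschitz_on_bilinear by metis

lemma lip_C1:
  assumes "\<And>t. t \<in> {a..b} \<Longrightarrow> (f has_vector_derivative f' t) (at t within {a..b})"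
    and "continuous_on {a..b} f'"
  shows "lip {a..b} f"
  unfolding lip_def using C1_lipschitz_on[OF assms] by blast

lemma AE_lebesgue_on_Icc_iff:
  "(AE t in lebesgue_on {a..b}. P t) \<longleftrightarrow> (\<exists>N. negligible N \<and> (\<forall>t\<in>{a..b} - N. P t))"
  for a b :: real
proof -
  have "(AE t in lebesgue_on {a..b}. P t) \<longleftrightarrow> (AE t in lebesgue. t \<in> {a..b} \<longrightarrow> P t)"
    by (rule AE_restrict_space_iff) simp
  also have "\<dots> \<longleftrightarrow> (\<exists>N. negligible N \<and> (\<forall>t\<in>{a..b} - N. P t))"
  proof -
    have "{t \<in> space lebesgue. \<not> (t \<in> {a..b} \<longrightarrow> P t)} \<subseteq> N \<longleftrightarrow> (\<forall>t\<in>{a..b} - N. P t)" for N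
      by auto
    then show ?thesis
      unfolding eventually_ae_filter negligible_iff_null_sets by blast
  qed
  finally show ?thesis .
qed

lemma integral_norm_square_0_imp_negligible:
  fixes f :: "real \<Rightarrow> 'a::euclidean_space"
  assumes "(\<lambda>t. (norm (f t))\<^sup>2) integrable_on {a..b}" "integral {a..b} (\<lambda>t. (norm (f t))\<^sup>2) \<le> 0"
  obtains N where "negligible N" "\<And>t. t \<in> {a..b} - N \<Longrightarrow> f t = 0"
proof -
  have "(\<lambda>t. (norm (f t))\<^sup>2) absolutely_integrable_on {a..b}"
    by (rule nonnegative_absolutely_integrable_1[OF assms(1)]) simp
  then have int: "integrable (lebesgue_on {a..b}) (\<lambda>t. (norm (f t))\<^sup>2)"
    by (simp add: integrable_restrict_space set_integrable_def)
  have "integral\<^sup>L (lebesgue_on {a..b}) (\<lambda>t. (norm (f t))\<^sup>2) = integral {a..b} (\<lambda>t. (norm (f t))\<^sup>2)"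
    by (rule lebesgue_integral_eq_integral[OF int]) simp
  moreover have "integral {a..b} (\<lambda>t. (norm (f t))\<^sup>2) \<ge> 0"
    by (rule integral_nonneg[OF assms(1)]) simp
  ultimately have "integral\<^sup>L (lebesgue_on {a..b}) (\<lambda>t. (norm (f t))\<^sup>2) = 0"
    using assms(2) by simp
  then have "AE t in lebesgue_on {a..b}. (norm (f t))\<^sup>2 = 0"
    using integral_nonneg_eq_0_iff_AE[OF int] by simp
  then show thesis
    unfolding AE_lebesgue_on_Icc_iff using that by auto
qed

text \<open>For merely continuous f the Cantor function is a counterexample; the Lipschitz bound
  lets the zero derivative be integrated back. This turns equations that hold almost everywhere
  along a competitor into identities.\<close>

lemma lip_derivative_zero:
  fixes f :: "real \<Rightarrow> 'a::euclidean_space"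
  assumes "lip {a..b} f" "negligible N"
    and der: "\<And>t. t \<in> {a..b} - N \<Longrightarrow> (f has_vector_derivative 0) (at t within {a..b})"
    and t: "t \<in> {a..b}"
  shows "f t = f a"
proof -
  obtain L where "L-lipschitz_on {a..b} f"
    using assms(1) unfolding lip_def by blast
  then have L: "L-lipschitz_on {a..t} f"
    by (rule lipschitz_on_subset) (use t in auto)
  have "((\<lambda>_. 0) has_integral (f t - f a)) {a..t}"
  proof (rule lipschitz_fundamental_theorem_of_calculus[OF _ L assms(2)])
    show "a \<le> t" using t by simp
    show "(f has_vector_derivative 0) (at s within {a..t})" if "s \<in> {a..t} - N" for s
      by (rule has_vector_derivative_within_subset[OF der]) (use that t in auto)
  qed
  then show ?thesis
    by (simp add: has_integral_0_eq)
qed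

section \<open>The trigonometric functions of a square root\<close>

text \<open>
  \<open>trig_sqrt k\<close> is the entire function with \<open>\<tau>^k * trig_sqrt k (\<tau>\<^sup>2)\<close> equal to \<open>cos \<tau>\<close>, \<open>sin \<tau>\<close>,
  \<open>1 - cos \<tau>\<close>, \<open>\<tau> - sin \<tau>\<close> for \<open>k = 0, 1, 2, 3\<close>.
\<close>

definition trig_sqrt :: "nat \<Rightarrow> real \<Rightarrow> real" where
  "trig_sqrt k s = (\<Sum>n. (-1) ^ n / fact (2 * n + k) * s ^ n)"

lemma trig_sqrt_summable: "summable (\<lambda>n. (-1) ^ n / fact (2 * n + k) * s ^ n :: real)"
proof (rule summable_comparison_test)
  have "inverse (fact (2 * n + k)) \<le> (inverse (fact n) :: real)" for n
    by (intro le_imp_inverse_le fact_mono) auto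
  then have "inverse (fact (2 * n + k)) * \<bar>s\<bar> ^ n \<le> inverse (fact n) * \<bar>s\<bar> ^ n" for n
    by (intro mult_right_mono) auto
  then show "\<exists>N. \<forall>n\<ge>N. norm ((-1) ^ n / fact (2 * n + k) * s ^ n) \<le> inverse (fact n) * \<bar>s\<bar> ^ n"
    by (simp add: norm_mult norm_divide norm_power divide_inverse abs_mult power_abs)
  show "summable (\<lambda>n. inverse (fact n) * \<bar>s\<bar> ^ n)"
    by (rule summable_exp)
qed

lemma Ck_on_trig_sqrt: "open U \<Longrightarrow> Ck_on n U (trig_sqrt k)"
  unfolding trig_sqrt_def[abs_def] by (rule Ck_on_power_series[OF trig_sqrt_summable])

lemma trig_sqrt_rec: "trig_sqrt k s = 1 / fact k - s * trig_sqrt (k + 2) s"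
proof -
  let ?a = "\<lambda>n. (-1) ^ n / fact (2 * n + k) * s ^ n"
  have "trig_sqrt k s = ?a 0 + (\<Sum>n. ?a (Suc n))"
    unfolding trig_sqrt_def using suminf_split_head[OF trig_sqrt_summable[of k s]] by simp
  also have "(\<Sum>n. ?a (Suc n)) = (\<Sum>n. (- s) * ((-1) ^ n / fact (2 * n + (k + 2)) * s ^ n))"
    by (simp add: algebra_simps)
  also have "\<dots> = - s * trig_sqrt (k + 2) s"
    unfolding trig_sqrt_def by (rule suminf_mult[OF trig_sqrt_summable])
  finally show ?thesis by simp
qed

lemma trig_sqrt_0: "trig_sqrt k 0 = 1 / fact k"
  using trig_sqrt_rec[of k 0] by simp

text \<open>With s = \<tau>^2 this says that \<tau>^(k+1) \<open>trig_sqrt (Suc k) s\<close> has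
  \<tau>-derivative \<tau>^k \<open>trig_sqrt k s\<close>, in a form free of division by s and thus
  valid at s = 0. On coefficients it reads (2n + k + 1) / (2n + k + 1)! = 1 / (2n + k)!.\<close>

lemma trig_sqrt_has_derivative:
  obtains D where "(trig_sqrt (Suc k) has_real_derivative D) (at s)"
    and "real (Suc k) * trig_sqrt (Suc k) s + 2 * s * D = trig_sqrt k s"
proof
  define c :: "nat \<Rightarrow> real" where "c n = (-1) ^ n / fact (2 * n + Suc k)" for n
  define D where "D = (\<Sum>n. diffs c n * s ^ n)"
  have sm: "summable (\<lambda>n. c n * y ^ n)" for y :: real
    unfolding c_def by (rule trig_sqrt_summable)
  have eq: "trig_sqrt (Suc k) = (\<lambda>s. \<Sum>n. c n * s ^ n)"
    by (simp add: trig_sqrt_def c_def fun_eq_iff)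
  show "(trig_sqrt (Suc k) has_real_derivative D) (at s)"
    unfolding eq D_def by (rule termdiffs_strong_converges_everywhere, rule sm)
  have smd: "summable (\<lambda>n. diffs c n * s ^ n)"
    by (rule termdiff_converges_all, rule sm)
  have 1: "(\<lambda>n. real (Suc k) * (c n * s ^ n)) sums (real (Suc k) * trig_sqrt (Suc k) s)"
    unfolding eq by (intro sums_mult summable_sums sm)
  have "(\<lambda>n. 2 * s * (diffs c n * s ^ n)) sums (2 * s * D)"
    unfolding D_def by (intro sums_mult summable_sums smd)
  moreover have "2 * s * (diffs c n * s ^ n) = 2 * real (Suc n) * (c (Suc n) * s ^ Suc n)" for n
    by (simp add: diffs_def)
  ultimately have "(\<lambda>n. 2 * real (Suc n) * (c (Suc n) * s ^ Suc n)) sums (2 * s * D)"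
    by simp
  then have "(\<lambda>n. 2 * real n * (c n * s ^ n)) sums (2 * s * D)"
    using sums_Suc_iff[of "\<lambda>n. 2 * real n * (c n * s ^ n)" "2 * s * D"] by simp
  from sums_add[OF 1 this]
  have "(\<lambda>n. real (Suc k) * (c n * s ^ n) + 2 * real n * (c n * s ^ n)) sums
    (real (Suc k) * trig_sqrt (Suc k) s + 2 * s * D)" .
  moreover have "real (Suc k) * (c n * s ^ n) + 2 * real n * (c n * s ^ n)
      = (-1) ^ n / fact (2 * n + k) * s ^ n" for n
  proof -
    have "(fact (2 * n + Suc k) :: real) = real (2 * n + Suc k) * fact (2 * n + k)"
      by simp
    then have "real (2 * n + Suc k) * c n = (-1) ^ n / fact (2 * n + k)"
      unfolding c_def by (simp only:) (simp add: divide_simps del: of_nat_add of_nat_Suc)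
    then have "real (2 * n + Suc k) * c n * s ^ n = (-1) ^ n / fact (2 * n + k) * s ^ n"
      by (simp only:)
    then show ?thesis by (simp add: algebra_simps)
  qed
  ultimately show "real (Suc k) * trig_sqrt (Suc k) s + 2 * s * D = trig_sqrt k s"
    unfolding trig_sqrt_def using sums_unique by force
qed

text \<open>In the time t, with frequency sqrt c for nonnegative c, each function is a primitive of
  its predecessor; c = 0 needs no separate treatment.\<close>

lemma trig_sqrt_power_has_derivative:
  "((\<lambda>t. t ^ Suc k * trig_sqrt (Suc k) (t\<^sup>2 * c)) has_real_derivative
     t ^ k * trig_sqrt k (t\<^sup>2 * c)) (at t within A)"
proof -
  obtain D where D: "(trig_sqrt (Suc k) has_real_derivative D) (at (t\<^sup>2 * c))"
    and eq: "real (Suc k) * trig_sqrt (Suc k) (t\<^sup>2 * c) + 2 * (t\<^sup>2 * c) * D = trig_sqrt k (t\<^sup>2 * c)"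
    by (rule trig_sqrt_has_derivative)
  have "((\<lambda>t. t\<^sup>2 * c) has_real_derivative 2 * t * c) (at t)"
    by (auto intro!: derivative_eq_intros)
  from DERIV_chain2[OF D this]
  have "((\<lambda>t. trig_sqrt (Suc k) (t\<^sup>2 * c)) has_real_derivative D * (2 * t * c)) (at t)" .
  then have "((\<lambda>t. t ^ Suc k * trig_sqrt (Suc k) (t\<^sup>2 * c)) has_real_derivative
     (real (Suc k) * t ^ k) * trig_sqrt (Suc k) (t\<^sup>2 * c) + D * (2 * t * c) * t ^ Suc k) (at t)"
    by (intro DERIV_mult DERIV_power_Suc[THEN DERIV_cong]) (auto intro!: derivative_eq_intros)
  moreover have "(real (Suc k) * t ^ k) * trig_sqrt (Suc k) (t\<^sup>2 * c) + D * (2 * t * c) * t ^ Suc k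
      = t ^ k * (real (Suc k) * trig_sqrt (Suc k) (t\<^sup>2 * c) + 2 * (t\<^sup>2 * c) * D)"
    by (simp add: algebra_simps power2_eq_square)
  ultimately show ?thesis
    unfolding eq by (auto intro: DERIV_subset)
qed

lemma trig_sqrt_0_square: "trig_sqrt 0 (\<tau>\<^sup>2) = cos \<tau>"
  using sums_unique[OF cos_paired[of \<tau>]] by (simp add: trig_sqrt_def power_mult)

lemma trig_sqrt_1_square: "\<tau> * trig_sqrt 1 (\<tau>\<^sup>2) = sin \<tau>"
proof -
  have "(\<lambda>n. \<tau> * ((-1) ^ n / fact (2 * n + 1) * (\<tau>\<^sup>2) ^ n)) sums (\<tau> * trig_sqrt 1 (\<tau>\<^sup>2))"
    unfolding trig_sqrt_def by (intro sums_mult summable_sums trig_sqrt_summable)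
  moreover have "(\<lambda>n. \<tau> * ((-1) ^ n / fact (2 * n + 1) * (\<tau>\<^sup>2) ^ n)) =
      (\<lambda>n. (-1) ^ n / fact (2 * n + 1) * \<tau> ^ (2 * n + 1))"
    by (simp add: fun_eq_iff flip: power_mult)
  ultimately show ?thesis
    using sums_unique2[OF sin_paired[of \<tau>]] by metis
qed

lemma trig_sqrt_2_square: "\<tau>\<^sup>2 * trig_sqrt 2 (\<tau>\<^sup>2) = 1 - cos \<tau>"
  using trig_sqrt_rec[of 0 "\<tau>\<^sup>2"] unfolding trig_sqrt_0_square add_0 by simp

lemma trig_sqrt_3_square: "\<tau> ^ 3 * trig_sqrt 3 (\<tau>\<^sup>2) = \<tau> - sin \<tau>"
proof -
  have "trig_sqrt 1 (\<tau>\<^sup>2) = 1 - \<tau>\<^sup>2 * trig_sqrt 3 (\<tau>\<^sup>2)"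
  proof -
    have "(1::nat) + 2 = 3" by simp
    from trig_sqrt_rec[of 1 "\<tau>\<^sup>2", unfolded this] show ?thesis by simp
  qed
  then have "\<tau> * trig_sqrt 1 (\<tau>\<^sup>2) = \<tau> * (1 - \<tau>\<^sup>2 * trig_sqrt 3 (\<tau>\<^sup>2))"
    by (simp only:)
  then have "\<tau> * trig_sqrt 1 (\<tau>\<^sup>2) = \<tau> - \<tau> ^ 3 * trig_sqrt 3 (\<tau>\<^sup>2)"
    by (simp add: right_diff_distrib power2_eq_square power3_eq_cube)
  then show ?thesis
    unfolding trig_sqrt_1_square by simp
qed

text \<open>These are sin^2 - cos (1 - cos) = 1 - cos and sin^2 + (1 - cos)^2 = 2 (1 - cos) with a
  factor s removed; at s = 0 the constant terms are compared instead.\<close>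

lemma trig_sqrt_pythagoras:
  assumes "s \<ge> 0"
  shows "(trig_sqrt 1 s)\<^sup>2 - trig_sqrt 0 s * trig_sqrt 2 s = trig_sqrt 2 s"
    and "(trig_sqrt 1 s)\<^sup>2 + s * (trig_sqrt 2 s)\<^sup>2 = 2 * trig_sqrt 2 s"
proof -
  define \<tau> where "\<tau> = sqrt s"
  have s: "s = \<tau>\<^sup>2" using assms by (simp add: \<tau>_def)
  define a b c where "a = trig_sqrt 0 s" and "b = trig_sqrt 1 s" and "c = trig_sqrt 2 s"
  have sc: "s * c = 1 - a" and sb: "s * b\<^sup>2 = 1 - a\<^sup>2"
    using trig_sqrt_0_square[of \<tau>] trig_sqrt_1_square[of \<tau>, symmetric] trig_sqrt_2_square[of \<tau>]
      sin_squared_eq[of \<tau>]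
    by (simp_all add: s a_def b_def c_def power_mult_distrib)
  have "b\<^sup>2 - a * c = c \<and> b\<^sup>2 + s * c\<^sup>2 = 2 * c"
  proof (cases "s = 0")
    case True
    then show ?thesis by (simp add: a_def b_def c_def trig_sqrt_0)
  next
    case False
    have "s * (b\<^sup>2 - a * c) = s * b\<^sup>2 - a * (s * c)"
      by (simp add: algebra_simps)
    also have "\<dots> = s * c"
      unfolding sb sc by (simp add: algebra_simps power2_eq_square)
    finally have "s * (b\<^sup>2 - a * c) = s * c" .
    moreover have "s * (b\<^sup>2 + s * c\<^sup>2) = s * (2 * c)"
    proof -
      have "s * (b\<^sup>2 + s * c\<^sup>2) = s * b\<^sup>2 + (s * c)\<^sup>2"
        by (simp add: algebra_simps power2_eq_square)
      also have "\<dots> = 2 * (s * c)"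
        unfolding sb sc by (simp add: power2_eq_square algebra_simps)
      finally show ?thesis by simp
    qed
    ultimately show ?thesis using False by simp
  qed
  then show "(trig_sqrt 1 s)\<^sup>2 - trig_sqrt 0 s * trig_sqrt 2 s = trig_sqrt 2 s"
    and "(trig_sqrt 1 s)\<^sup>2 + s * (trig_sqrt 2 s)\<^sup>2 = 2 * trig_sqrt 2 s"
    by (simp_all add: a_def b_def c_def)
qed

section \<open>Signs on the first period\<close>

text \<open>1 - cos \<tau> = 2 sin^2 (\<tau> / 2) has no zero strictly between 0 and 2
  \<pi>.\<close>

lemma trig_sqrt_2_pos:
  assumes "0 \<le> s" "s < (2 * pi)\<^sup>2"
  shows "trig_sqrt 2 s > 0"
proof (cases "s = 0")
  case False
  define \<tau> where "\<tau> = sqrt s"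
  have \<tau>: "s = \<tau>\<^sup>2" "0 < \<tau>" "\<tau> < 2 * pi"
    using assms False real_less_lsqrt[of "2 * pi" s] by (simp_all add: \<tau>_def)
  have "sin (\<tau> / 2) > 0"
    using \<tau> by (intro sin_gt_zero) auto
  then have "0 < \<tau>\<^sup>2 * trig_sqrt 2 (\<tau>\<^sup>2)"
    unfolding trig_sqrt_2_square using cos_double_sin[of "\<tau> / 2"] by simp
  then show ?thesis
    using \<tau> by (simp add: zero_less_mult_iff)
qed (simp add: trig_sqrt_0)

lemma sin_minus_mult_cos_pos:
  assumes "0 < x" "x < pi"
  shows "x * cos x < sin x"
proof -
  have "sin 0 - 0 * cos 0 < sin x - x * cos x"
  proof (rule DERIV_pos_imp_increasing_open[OF assms(1)])
    fix y assume y: "0 < y" "y < x"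
    have "((\<lambda>x. sin x - x * cos x) has_real_derivative y * sin y) (at y)"
      by (auto intro!: derivative_eq_intros)
    moreover have "y * sin y > 0"
      using y assms by (intro mult_pos_pos sin_gt_zero) auto
    ultimately show "\<exists>D. ((\<lambda>x. sin x - x * cos x) has_real_derivative D) (at y) \<and> 0 < D"
      by blast
  qed (intro continuous_intros)
  then show ?thesis by simp
qed

text \<open>Up to the factor \<tau>^4 this is the numerator of the derivative of (\<tau> - sin
  \<tau>) / (1 - cos \<tau>). With x = \<tau> / 2 it factors as 4 sin x (sin x - x cos x), and both
  factors are positive for 0 < x < \<pi>.\<close>

lemma trig_sqrt_wronskian_pos:
  assumes "0 \<le> s" "s < (2 * pi)\<^sup>2"
  shows "(trig_sqrt 2 s)\<^sup>2 - trig_sqrt 1 s * trig_sqrt 3 s > 0"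
proof (cases "s = 0")
  case False
  define \<tau> where "\<tau> = sqrt s"
  have \<tau>: "s = \<tau>\<^sup>2" "0 < \<tau>" "\<tau> < 2 * pi"
    using assms False real_less_lsqrt[of "2 * pi" s] by (simp_all add: \<tau>_def)
  define x where "x = \<tau> / 2"
  have x: "0 < x" "x < pi" "\<tau> = 2 * x" using \<tau> by (auto simp: x_def)
  have "\<tau> ^ 4 * ((trig_sqrt 2 s)\<^sup>2 - trig_sqrt 1 s * trig_sqrt 3 s)
      = (\<tau>\<^sup>2 * trig_sqrt 2 (\<tau>\<^sup>2))\<^sup>2 - (\<tau> * trig_sqrt 1 (\<tau>\<^sup>2)) * (\<tau> ^ 3 * trig_sqrt 3 (\<tau>\<^sup>2))"
    unfolding \<tau>(1) by (simp add: algebra_simps power2_eq_square power3_eq_cube power4_eq_xxxx)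
  also have "\<dots> = (1 - cos \<tau>)\<^sup>2 - sin \<tau> * (\<tau> - sin \<tau>)"
    unfolding trig_sqrt_1_square trig_sqrt_2_square trig_sqrt_3_square ..
  also have "\<dots> = 2 - 2 * cos \<tau> - \<tau> * sin \<tau>"
    using sin_squared_eq[of \<tau>] by (simp add: algebra_simps power2_eq_square)
  also have "\<dots> = 4 * sin x * (sin x - x * cos x)"
    unfolding x(3) cos_double_sin sin_double by (simp add: algebra_simps power2_eq_square)
  also have "\<dots> > 0"
    using sin_minus_mult_cos_pos[OF x(1,2)] sin_gt_zero[OF x(1,2)] by simp
  finally show ?thesis
    using \<tau> by (simp add: zero_less_mult_iff)
qed (simp add: trig_sqrt_0 power2_eq_square fact_numeral)

lemma sin_less_self:
  fixes x :: real
  assumes "0 < x"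
  shows "sin x < x"
proof (cases "x < pi")
  case True
  then have "0 < sin (x / 2)" "cos (x / 2) < 1"
    using assms cos_monotone_0_pi[of 0 "x / 2"] by (auto intro: sin_gt_zero)
  then have "sin x < 2 * sin (x / 2)"
    using sin_double[of "x / 2"] by simp
  also have "\<dots> \<le> x"
    using sin_x_le_x[of "x / 2"] assms by simp
  finally show ?thesis .
next
  case False
  then show ?thesis
    using sin_le_one[of x] pi_gt3 by linarith
qed

lemma trig_sqrt_3_pos:
  assumes "0 \<le> s"
  shows "trig_sqrt 3 s > 0"
proof (cases "s = 0")
  case False
  define \<tau> where "\<tau> = sqrt s"
  have \<tau>: "s = \<tau>\<^sup>2" "0 < \<tau>"
    using assms False by (simp_all add: \<tau>_def)
  have "0 < \<tau> ^ 3 * trig_sqrt 3 (\<tau>\<^sup>2)"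
    unfolding trig_sqrt_3_square using sin_less_self[OF \<tau>(2)] by simp
  then show ?thesis
    using \<tau> by (simp add: zero_less_mult_iff)
qed (simp add: trig_sqrt_0)

lemma trig_sqrt_2_at_two_pi: "trig_sqrt 2 ((2 * pi)\<^sup>2) = 0"
  using trig_sqrt_2_square[of "2 * pi"] by simp

lemma trig_sqrt_1_has_derivative:
  "((\<lambda>t. t * trig_sqrt 1 (t\<^sup>2 * c)) has_real_derivative trig_sqrt 0 (t\<^sup>2 * c)) (at t within A)"
  using trig_sqrt_power_has_derivative[of 0 c t A] by simp

lemma trig_sqrt_2_has_derivative:
  "((\<lambda>t. t\<^sup>2 * trig_sqrt 2 (t\<^sup>2 * c)) has_real_derivative t * trig_sqrt 1 (t\<^sup>2 * c)) (at t within A)"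
  using trig_sqrt_power_has_derivative[of 1 c t A] by (simp add: numeral_2_eq_2)

lemma trig_sqrt_0_has_derivative:
  "((\<lambda>t. trig_sqrt 0 (t\<^sup>2 * c)) has_real_derivative - c * (t * trig_sqrt 1 (t\<^sup>2 * c))) (at t within A)"
proof -
  have "trig_sqrt 0 (t\<^sup>2 * c) = 1 - c * (t\<^sup>2 * trig_sqrt 2 (t\<^sup>2 * c))" for t
    using trig_sqrt_rec[of 0 "t\<^sup>2 * c"] unfolding add_0 by simp
  moreover have "((\<lambda>t. 1 - c * (t\<^sup>2 * trig_sqrt 2 (t\<^sup>2 * c))) has_real_derivative
      0 - c * (t * trig_sqrt 1 (t\<^sup>2 * c))) (at t within A)"
    by (intro DERIV_diff DERIV_const DERIV_cmult trig_sqrt_2_has_derivative)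
  ultimately show ?thesis by simp
qed

lemma trig_sqrt_3_has_derivative:
  "((\<lambda>t. t ^ 3 * trig_sqrt 3 (t\<^sup>2 * c)) has_real_derivative t\<^sup>2 * trig_sqrt 2 (t\<^sup>2 * c)) (at t within A)"
  using trig_sqrt_power_has_derivative[of 2 c t A] by (simp add: numeral_2_eq_2 numeral_3_eq_3)

lemma Ck_on_trig_sqrt_compose: "open U \<Longrightarrow> Ck_on n U f \<Longrightarrow> Ck_on n U (\<lambda>x. trig_sqrt k (f x))"
  by (rule Ck_on_compose[OF _ _ Ck_on_trig_sqrt[OF open_UNIV]]) auto

lemmas Ck_on_intros = Ck_on_const Ck_on_ident Ck_on_fst Ck_on_snd Ck_on_add Ck_on_diff Ck_on_mult
  Ck_on_scaleR Ck_on_inner Ck_on_sum Ck_on_power Ck_on_divide Ck_on_Pair Ck_on_trig_sqrt_compose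

text \<open>With \<tau> = \<rho> sqrt c the function is (\<tau> - sin \<tau>) / (4 sqrt c (1 - cos
  \<tau>)) for c > 0, and \<rho> / 12 for c = 0. Its growth in \<rho> makes the scalar equation for
  \<rho> uniquely solvable.\<close>

lemma trig_sqrt_quotient_has_derivative:
  assumes "\<rho> > 0" "0 \<le> c" "\<rho>\<^sup>2 * c < (2 * pi)\<^sup>2"
  obtains D where "D > 0"
    and "((\<lambda>\<rho>. \<rho> * (trig_sqrt 3 (\<rho>\<^sup>2 * c) / (4 * trig_sqrt 2 (\<rho>\<^sup>2 * c)))) has_real_derivative D) (at \<rho>)"
proof
  define a b d where "a = trig_sqrt 1 (\<rho>\<^sup>2 * c)" and "b = trig_sqrt 2 (\<rho>\<^sup>2 * c)" and "d = trig_sqrt 3 (\<rho>\<^sup>2 * c)"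
  have s: "0 \<le> \<rho>\<^sup>2 * c" using assms by simp
  have b: "b > 0" using trig_sqrt_2_pos[OF s assms(3)] by (simp add: b_def)
  have w: "b\<^sup>2 - a * d > 0" using trig_sqrt_wronskian_pos[OF s assms(3)] by (simp add: a_def b_def d_def)
  \<comment> \<open>Expanding the fraction by \<rho>^2 turns numerator and denominator into
    functions whose derivatives belong to the same chain.\<close>
  have "((\<lambda>\<rho>. (\<rho> ^ 3 * trig_sqrt 3 (\<rho>\<^sup>2 * c)) / (4 * (\<rho>\<^sup>2 * trig_sqrt 2 (\<rho>\<^sup>2 * c)))) has_real_derivative
      ((\<rho>\<^sup>2 * b) * (4 * (\<rho>\<^sup>2 * b)) - (\<rho> ^ 3 * d) * (4 * (\<rho> * a))) / ((4 * (\<rho>\<^sup>2 * b)) * (4 * (\<rho>\<^sup>2 * b)))) (at \<rho>)"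
    unfolding a_def b_def d_def
    by (intro DERIV_divide DERIV_cmult trig_sqrt_2_has_derivative trig_sqrt_3_has_derivative)
      (use assms b in \<open>simp add: b_def\<close>)
  moreover have "((\<rho>\<^sup>2 * b) * (4 * (\<rho>\<^sup>2 * b)) - (\<rho> ^ 3 * d) * (4 * (\<rho> * a))) / ((4 * (\<rho>\<^sup>2 * b)) * (4 * (\<rho>\<^sup>2 * b)))
      = (b\<^sup>2 - a * d) / (4 * b\<^sup>2)"
    using assms(1) b by (simp add: divide_simps) (simp add: power2_eq_square power3_eq_cube power4_eq_xxxx algebra_simps)
  moreover have "(\<lambda>\<rho>. (\<rho> ^ 3 * trig_sqrt 3 (\<rho>\<^sup>2 * c)) / (4 * (\<rho>\<^sup>2 * trig_sqrt 2 (\<rho>\<^sup>2 * c))))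
      = (\<lambda>\<rho>. \<rho> * (trig_sqrt 3 (\<rho>\<^sup>2 * c) / (4 * trig_sqrt 2 (\<rho>\<^sup>2 * c))))"
    by (auto simp: fun_eq_iff power2_eq_square power3_eq_cube)
  ultimately show "((\<lambda>\<rho>. \<rho> * (trig_sqrt 3 (\<rho>\<^sup>2 * c) / (4 * trig_sqrt 2 (\<rho>\<^sup>2 * c)))) has_real_derivative
      (b\<^sup>2 - a * d) / (4 * b\<^sup>2)) (at \<rho>)"
    by (simp only:)
  show "(b\<^sup>2 - a * d) / (4 * b\<^sup>2) > 0"
    using w b by simp
qed

lemma continuous_on_trig_sqrt: "continuous_on A f \<Longrightarrow> continuous_on A (\<lambda>x. trig_sqrt k (f x))"
  using continuous_on_compose2[OF Ck_on_continuous[OF Ck_on_trig_sqrt[OF open_UNIV, of 0]]] by blast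

section \<open>Symmetric operators\<close>

text \<open>A maximiser of the Rayleigh quotient on the unit sphere of V. Invariance keeps the
  residual S x - \<mu> x inside V, so it is an admissible variation.\<close>

lemma symmetric_eigenvector_in_subspace:
  fixes S :: "'a::euclidean_space \<Rightarrow> 'a"
  assumes "linear S" and sym: "\<And>X Y. S X \<bullet> Y = X \<bullet> S Y"
    and V: "subspace V" "\<And>x. x \<in> V \<Longrightarrow> S x \<in> V" and "y \<in> V" "y \<noteq> 0"
  obtains x where "x \<in> V" "norm x = 1" "S x = (S x \<bullet> x) *\<^sub>R x"
proof -
  let ?K = "V \<inter> sphere 0 1"
  have "compact ?K"
    using closed_subspace[OF V(1)] by (simp add: closed_Int_compact)
  moreover have "(1 / norm y) *\<^sub>R y \<in> ?K"
    using assms by (auto intro: subspace_scale)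
  moreover have "continuous_on ?K (\<lambda>x. S x \<bullet> x)"
    by (intro continuous_intros linear_continuous_on) (simp add: assms(1) linear_conv_bounded_linear[symmetric])
  ultimately obtain x where x: "x \<in> ?K" and max: "\<And>y. y \<in> ?K \<Longrightarrow> S y \<bullet> y \<le> S x \<bullet> x"
    using continuous_attains_sup[of ?K] by blast
  define \<mu> where "\<mu> = S x \<bullet> x"
  have q: "S y \<bullet> y \<le> \<mu> * (y \<bullet> y)" if "y \<in> V" for y
  proof (cases "y = 0")
    case False
    have "(1 / norm y) *\<^sub>R y \<in> ?K"
      using that False V(1) by (auto intro: subspace_scale)
    from max[OF this] have "S y \<bullet> y / (norm y)\<^sup>2 \<le> \<mu>"
      by (simp add: linear_scale[OF assms(1)] \<mu>_def power2_eq_square)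
    then show ?thesis
      using False by (simp add: divide_le_eq dot_square_norm)
  qed (use linear_0[OF assms(1)] in simp)
  have xx: "x \<bullet> x = 1"
    using x by (simp add: dot_square_norm)
  define d where "d = S x - \<mu> *\<^sub>R x"
  have d: "d \<in> V"
    unfolding d_def using V x by (auto intro: subspace_diff subspace_scale)
  text \<open>The quadratic form of \<open>\<mu> - S\<close> is nonnegative on \<open>V\<close> and vanishes at \<open>x\<close>; hence so does
    its derivative at \<open>x\<close> in the direction \<open>d\<close>.\<close>
  have small: "2 * t * (d \<bullet> d) \<le> t\<^sup>2 * (\<mu> * (d \<bullet> d) - S d \<bullet> d)" for t
  proof -
    have "S (x + t *\<^sub>R d) \<bullet> (x + t *\<^sub>R d) \<le> \<mu> * ((x + t *\<^sub>R d) \<bullet> (x + t *\<^sub>R d))"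
      by (rule q) (use V x d in \<open>auto intro: subspace_add subspace_scale\<close>)
    moreover have "S d \<bullet> x = S x \<bullet> d" "d \<bullet> x = x \<bullet> d"
      using sym[of d x] by (simp_all add: inner_commute)
    ultimately have "\<mu> + 2 * t * (S x \<bullet> d) + t\<^sup>2 * (S d \<bullet> d)
        \<le> \<mu> * (1 + 2 * t * (x \<bullet> d) + t\<^sup>2 * (d \<bullet> d))"
      using xx by (simp add: linear_add[OF assms(1)] linear_scale[OF assms(1)] inner_add_left
          inner_add_right \<mu>_def[symmetric] power2_eq_square algebra_simps)
    moreover have "S x \<bullet> d = d \<bullet> d + \<mu> * (x \<bullet> d)"
      using inner_diff_left[of "S x" "\<mu> *\<^sub>R x" d] by (simp flip: d_def)
    ultimately show ?thesis
      by (simp add: algebra_simps)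
  qed
  have "d \<bullet> d \<le> 0"
  proof (rule ccontr)
    assume "\<not> d \<bullet> d \<le> 0"
    then have pos: "d \<bullet> d > 0" by (simp only: not_le)
    \<comment> \<open>Any positive bound for the second-order coefficient works; adding 1 ensures
      positivity. For t = (d \<bullet> d) / M the linear term outweighs the quadratic one.\<close>
    define M where "M = \<bar>\<mu> * (d \<bullet> d) - S d \<bullet> d\<bar> + 1"
    have M: "M > 0" "\<mu> * (d \<bullet> d) - S d \<bullet> d \<le> M" by (simp_all add: M_def)
    define t where "t = (d \<bullet> d) / M"
    have t: "t > 0" "t * M = d \<bullet> d" using pos M by (simp_all add: t_def)
    have small: "2 * t * (d \<bullet> d) \<le> t\<^sup>2 * M"
      using small[of t] mult_left_mono[OF M(2), of "t\<^sup>2"] by simp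
    also have "\<dots> = t * (d \<bullet> d)"
      using t by (simp add: power2_eq_square)
    finally show False using t pos by simp
  qed
  then have "d = 0"
    using inner_ge_zero[of d] by (metis antisym inner_eq_zero_iff)
  then have "S x = \<mu> *\<^sub>R x"
    by (simp add: d_def)
  then show thesis
    using that[of x] x by (simp add: \<mu>_def)
qed

text \<open>An orthonormal set of eigenvectors of maximal size must span: by symmetry its orthogonal
  complement is invariant and would otherwise contain one more unit eigenvector.\<close>

lemma symmetric_orthonormal_eigenbasis:
  fixes S :: "'a::euclidean_space \<Rightarrow> 'a"
  assumes "linear S" and sym: "\<And>X Y. S X \<bullet> Y = X \<bullet> S Y"
  obtains B where "finite B" "pairwise orthogonal B" "\<And>b. b \<in> B \<Longrightarrow> norm b = 1"
    "span B = UNIV" "\<And>b. b \<in> B \<Longrightarrow> S b = (S b \<bullet> b) *\<^sub>R b"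
proof -
  define P where "P B \<longleftrightarrow> pairwise orthogonal B \<and> (\<forall>b\<in>B. norm b = 1 \<and> S b = (S b \<bullet> b) *\<^sub>R b)"
    for B
  have ind: "finite B \<and> card B \<le> DIM('a)" if "P B" for B
  proof -
    have "0 \<notin> B" using that unfolding P_def by force
    then have "independent B"
      using that pairwise_orthogonal_independent unfolding P_def by blast
    then show ?thesis by (rule independent_bound)
  qed
  have "P {}" by (simp add: P_def)
  then obtain B where B: "P B" and max: "\<And>B'. P B' \<Longrightarrow> card B' \<le> card B"
    using ex_has_greatest_nat[of P "{}" card "DIM('a) + 1"] ind
    by (metis Suc_eq_plus1 less_Suc_eq_le)
  have "span B = UNIV"
  proof (rule ccontr)
    assume "span B \<noteq> UNIV"
    then obtain y where y: "y \<noteq> 0" "\<And>z. z \<in> span B \<Longrightarrow> orthogonal y z"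
      using orthogonal_to_subspace_exists_gen[of B UNIV] by (metis UNIV_I psubsetI span_UNIV subset_UNIV)
    let ?V = "{x. \<forall>b\<in>B. x \<bullet> b = 0}"
    have "subspace ?V"
      unfolding subspace_def by (auto simp: inner_add_left)
    moreover have "S x \<in> ?V" if "x \<in> ?V" for x
    proof -
      have "S x \<bullet> b = 0" if "b \<in> B" for b
      proof -
        have "S x \<bullet> b = x \<bullet> ((S b \<bullet> b) *\<^sub>R b)"
          using sym[of x b] B that unfolding P_def by metis
        then show ?thesis
          using that \<open>x \<in> ?V\<close> by simp
      qed
      then show ?thesis by simp
    qed
    moreover have "y \<in> ?V"
      using y(2) by (auto simp: orthogonal_def span_base)
    ultimately obtain x where x: "x \<in> ?V" "norm x = 1" "S x = (S x \<bullet> x) *\<^sub>R x"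
      using symmetric_eigenvector_in_subspace[OF assms(1) sym, of ?V y] y(1) by blast
    have "x \<notin> B"
      using x by auto
    moreover have "P (insert x B)"
      using B x unfolding P_def by (auto simp: pairwise_insert orthogonal_def inner_commute)
    ultimately show False
      using max[of "insert x B"] ind[OF B] by simp
  qed
  then show thesis
    using that[of B] B ind[OF B] unfolding P_def by blast
qed

section \<open>Functions of the structure operator\<close>

text \<open>The eigenbasis is a parameter, so that functions of \<open>S\<close> act coordinatewise;
  \<open>symmetric_orthonormal_eigenbasis\<close> supplies it.\<close>

locale H_type_basis =
  fixes br :: "'a::euclidean_space \<Rightarrow> 'a \<Rightarrow> 'b::euclidean_space" and S :: "'a \<Rightarrow> 'a" and B :: "'a set"
  assumes H_type: "generalized_H_type br S"
    and B_finite: "finite B" and B_orthogonal: "pairwise orthogonal B"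
    and B_norm: "\<And>b. b \<in> B \<Longrightarrow> norm b = 1" and B_span: "span B = UNIV"
    and B_eigen: "\<And>b. b \<in> B \<Longrightarrow> S b = (S b \<bullet> b) *\<^sub>R b"
begin

text \<open>For b in \<open>B\<close> this is the eigenvalue of \<open>S\<close> at b.\<close>

definition sg :: "'a \<Rightarrow> real" where "sg b = S b \<bullet> b"

text \<open>\<open>fS f\<close> is the operator usually written \<open>f(S)\<close>.\<close>

definition fS :: "(real \<Rightarrow> real) \<Rightarrow> 'a \<Rightarrow> 'a" where
  "fS f x = (\<Sum>b\<in>B. (f (sg b) * (x \<bullet> b)) *\<^sub>R b)"

lemma br_bilinear: "bilinear br" and br_step2: "step2_bracket br"
  and S_linear: "linear S" and S_symmetric: "S X \<bullet> Y = X \<bullet> S Y" and S_nonzero: "S \<noteq> (\<lambda>_. 0)"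
  and S_nonneg: "0 \<le> S X \<bullet> X"
  and J_polarized: "J br V (J br W X) + J br W (J br V X) = - (2 * (V \<bullet> W)) *\<^sub>R S (S X)"
  using H_type by (auto simp: generalized_H_type_def step2_bracket_def)

lemma sg_nonneg: "0 \<le> sg b"
  by (simp add: sg_def S_nonneg)

lemma B_inner: "b \<in> B \<Longrightarrow> c \<in> B \<Longrightarrow> b \<bullet> c = (if b = c then 1 else 0)"
  using B_norm[of b] B_orthogonal by (auto simp: pairwise_def orthogonal_def norm_eq_1)

lemma B_expand: "(\<Sum>b\<in>B. (x \<bullet> b) *\<^sub>R b) = x"
  using orthonormal_basis_expand[OF B_orthogonal B_norm _ B_finite] B_span by blast

lemma B_eqI: "(\<And>b. b \<in> B \<Longrightarrow> x \<bullet> b = y \<bullet> b) \<Longrightarrow> x = y"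
  by (subst B_expand[of x, symmetric], subst B_expand[of y, symmetric]) simp

lemma sum_B_inner: "b \<in> B \<Longrightarrow> (\<Sum>c\<in>B. f c *\<^sub>R c) \<bullet> b = f b"
  by (simp add: inner_sum_left B_inner if_distrib[of "\<lambda>x. f _ * x"] B_finite cong: if_cong)

lemma fS_inner: "b \<in> B \<Longrightarrow> fS f x \<bullet> b = f (sg b) * (x \<bullet> b)"
  unfolding fS_def by (rule sum_B_inner)

lemma inner_B: "x \<bullet> y = (\<Sum>b\<in>B. (x \<bullet> b) * (y \<bullet> b))"
proof -
  have "(\<Sum>b\<in>B. (x \<bullet> b) *\<^sub>R b) \<bullet> y = (\<Sum>b\<in>B. (x \<bullet> b) * (b \<bullet> y))"
    by (simp add: inner_sum_left)
  then show ?thesis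
    unfolding B_expand by (simp add: inner_commute)
qed

lemma inner_fS: "x \<bullet> fS f y = (\<Sum>b\<in>B. f (sg b) * ((x \<bullet> b) * (y \<bullet> b)))"
  unfolding inner_B[of x "fS f y"] by (intro sum.cong) (simp_all add: fS_inner)

lemma fS_symmetric: "fS f x \<bullet> y = x \<bullet> fS f y"
  unfolding inner_commute[of "fS f x" y] inner_fS by (simp add: mult.commute)

lemma fS_linear: "linear (fS f)"
  by (rule linearI) (simp_all add: fS_def inner_add_left algebra_simps sum.distrib scaleR_sum_right)

lemmas fS_simps = linear_add[OF fS_linear] linear_diff[OF fS_linear] linear_scale[OF fS_linear]
  linear_neg[OF fS_linear] linear_0[OF fS_linear]

lemma fS_compose: "fS f (fS g x) = fS (\<lambda>s. f s * g s) x"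
  by (rule B_eqI) (simp add: fS_inner)

lemma fS_one: "fS (\<lambda>_. 1) x = x"
  by (rule B_eqI) (simp add: fS_inner)

lemma fS_add: "fS (\<lambda>s. f s + g s) x = fS f x + fS g x"
  by (rule B_eqI) (simp add: fS_inner inner_add_left algebra_simps)

lemma fS_diff: "fS (\<lambda>s. f s - g s) x = fS f x - fS g x"
  by (rule B_eqI) (simp add: fS_inner inner_diff_left algebra_simps)

lemma fS_scale: "fS (\<lambda>s. c * f s) x = c *\<^sub>R fS f x"
  by (rule B_eqI) (simp add: fS_inner algebra_simps)

lemma fS_cong: "(\<And>b. b \<in> B \<Longrightarrow> f (sg b) = g (sg b)) \<Longrightarrow> fS f x = fS g x"
  unfolding fS_def by (intro sum.cong) auto

lemma S_inner: "b \<in> B \<Longrightarrow> S x \<bullet> b = sg b * (x \<bullet> b)"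
  using S_symmetric[of x b] B_eigen[of b] by (metis inner_scaleR_right sg_def)

lemma S_S: "S (S x) = fS (\<lambda>s. s\<^sup>2) x"
  by (rule B_eqI) (simp add: fS_inner S_inner power2_eq_square)

lemma J_inner: "X \<bullet> J br V Y = V \<bullet> br X Y"
  by (rule inner_J[OF br_bilinear])

lemma br_skew: "br X Y = - br Y X"
  by (rule step2_bracket_skew[OF br_step2])

lemma J_skew: "J br V X \<bullet> Y = - (X \<bullet> J br V Y)"
  using J_inner[of Y V X] J_inner[of X V Y] br_skew[of X Y] by (simp add: inner_commute)

lemma J_bilinear: "bilinear (J br)"
proof -
  have "J br (V + W) X = J br V X + J br W X" "J br (c *\<^sub>R V) X = c *\<^sub>R J br V X" for V W X c
    by (rule vector_eq_rdot[THEN iffD1]; simp add: J_inner inner_add_right inner_add_left inner_commute[of _ "br _ _"] inner_commute[of "J _ _ _"])+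
  moreover have "J br V (X + Y) = J br V X + J br V Y" "J br V (c *\<^sub>R X) = c *\<^sub>R J br V X" for V X Y c
    by (rule vector_eq_rdot[THEN iffD1]; simp add: J_inner inner_add_right inner_add_left inner_commute[of "J _ _ _"]
        bilinear_radd[OF br_bilinear] bilinear_rmul[OF br_bilinear])+
  ultimately show ?thesis
    unfolding bilinear_def by (intro conjI allI linearI)
qed

lemma J_linear: "linear (J br V)"
  using J_bilinear by (simp add: bilinear_def)

lemmas J_simps = linear_add[OF J_linear] linear_diff[OF J_linear] linear_scale[OF J_linear]
  linear_neg[OF J_linear] linear_0[OF J_linear]

lemma J_self: "X \<bullet> J br V X = 0"
  using J_skew[of V X X] by (simp add: inner_commute)

lemma J_square: "J br V (J br V X) = - ((norm V)\<^sup>2) *\<^sub>R fS (\<lambda>s. s\<^sup>2) X"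
proof -
  have "2 *\<^sub>R J br V (J br V X) = 2 *\<^sub>R (- ((norm V)\<^sup>2) *\<^sub>R fS (\<lambda>s. s\<^sup>2) X)"
    using J_polarized[of V V X] by (simp add: S_S power2_norm_eq_inner flip: scaleR_2)
  then show ?thesis by (simp only: scaleR_cancel_left) simp
qed

text \<open>J_V commutes with its own square -|V|^2 S^2, hence with S^2 if V \<noteq> 0. Squaring is
  injective on the nonnegative eigenvalues of S, so S^2 separates the eigenspaces of S and J_V
  preserves them.\<close>

lemma J_eigen: "b \<in> B \<Longrightarrow> c \<in> B \<Longrightarrow> sg b \<noteq> sg c \<Longrightarrow> J br V b \<bullet> c = 0"
proof (cases "V = 0")
  case True
  then show ?thesis
    using J_inner[of c 0 b] by (simp add: inner_commute)
next
  case False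
  assume b: "b \<in> B" and c: "c \<in> B" and ne: "sg b \<noteq> sg c"
  have "- ((norm V)\<^sup>2) *\<^sub>R fS (\<lambda>s. s\<^sup>2) (J br V b) = - ((norm V)\<^sup>2) *\<^sub>R J br V (fS (\<lambda>s. s\<^sup>2) b)"
    using arg_cong[OF J_square[of V b], of "J br V"] J_square[of V "J br V b"] by (simp add: J_simps)
  then have "fS (\<lambda>s. s\<^sup>2) (J br V b) = J br V (fS (\<lambda>s. s\<^sup>2) b)"
    using False by simp
  moreover have "fS (\<lambda>s. s\<^sup>2) b = (sg b)\<^sup>2 *\<^sub>R b"
    by (rule B_eqI) (auto simp: fS_inner b B_inner)
  ultimately have "(sg c)\<^sup>2 * (J br V b \<bullet> c) = (sg b)\<^sup>2 * (J br V b \<bullet> c)"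
    using fS_inner[OF c, of "\<lambda>s. s\<^sup>2" "J br V b", symmetric] by (simp only: J_simps inner_scaleR_left)
  moreover have "(sg c)\<^sup>2 \<noteq> (sg b)\<^sup>2"
    using ne sg_nonneg[of b] sg_nonneg[of c] by (simp add: power2_eq_iff_nonneg)
  ultimately show ?thesis by simp
qed

text \<open>J_V connects only basis vectors with equal eigenvalue, so f (sg b) may be replaced by f
  (sg c) in every nonzero term.\<close>

lemma J_fS: "J br V (fS f X) = fS f (J br V X)"
proof (rule B_eqI)
  fix c assume c: "c \<in> B"
  have "J br V (fS f X) \<bullet> c = (\<Sum>b\<in>B. f (sg b) * (X \<bullet> b) * (J br V b \<bullet> c))"
    unfolding fS_def by (simp add: linear_sum[OF J_linear] J_simps inner_sum_left)
  also have "\<dots> = (\<Sum>b\<in>B. f (sg c) * ((X \<bullet> b) * (J br V b \<bullet> c)))"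
  proof (rule sum.cong[OF refl])
    fix b assume "b \<in> B"
    then show "f (sg b) * (X \<bullet> b) * (J br V b \<bullet> c) = f (sg c) * ((X \<bullet> b) * (J br V b \<bullet> c))"
      by (cases "sg b = sg c") (simp_all add: J_eigen c)
  qed
  also have "\<dots> = f (sg c) * (J br V (\<Sum>b\<in>B. (X \<bullet> b) *\<^sub>R b) \<bullet> c)"
    by (simp add: linear_sum[OF J_linear] J_simps inner_sum_left sum_distrib_left)
  finally show "J br V (fS f X) \<bullet> c = fS f (J br V X) \<bullet> c"
    using c by (simp add: B_expand fS_inner)
qed

text \<open>A skew and a symmetric operator that commute have a skew product. This removes the mixed
  terms from the quadratic expressions below.\<close>

lemma J_fS_self: "X \<bullet> J br V (fS f X) = 0"
proof -
  have "X \<bullet> J br V (fS f X) = fS f X \<bullet> J br V X"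
    by (simp add: J_fS fS_symmetric)
  also have "\<dots> = - (X \<bullet> J br V (fS f X))"
    using J_skew[of V "fS f X" X] by (simp add: inner_commute)
  finally show ?thesis by simp
qed

lemma J_fS_self': "X \<bullet> fS f (J br V X) = 0"
  using J_fS_self by (simp add: J_fS)

text \<open>Skewness and commutation with functions of S allow J_V and J_W in either order; the
  average is the symmetrised product, which the H-type relation turns into a multiple of S^2. The
  factor V \<bullet> W is the reason why geodesics move vertically along v only.\<close>

lemma J_J_fS: "J br W X \<bullet> J br V (fS f X) = (V \<bullet> W) * (X \<bullet> fS (\<lambda>s. s\<^sup>2 * f s) X)"
proof -
  have "J br W X \<bullet> J br V (fS f X) = - (X \<bullet> J br W (J br V (fS f X)))"
    by (rule J_skew)
  moreover have "J br W X \<bullet> J br V (fS f X) = - (X \<bullet> J br V (J br W (fS f X)))"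
    using J_skew[of V "J br W X" "fS f X"] J_skew[of W "fS f X" X] J_skew[of V X "J br W (fS f X)"]
    by (simp add: J_fS fS_symmetric inner_commute)
  ultimately have "2 * (J br W X \<bullet> J br V (fS f X))
      = - (X \<bullet> (J br V (J br W (fS f X)) + J br W (J br V (fS f X))))"
    by (simp add: inner_add_right)
  also have "\<dots> = 2 * (V \<bullet> W) * (X \<bullet> fS (\<lambda>s. s\<^sup>2 * f s) X)"
    unfolding J_polarized S_S fS_compose by simp
  finally show ?thesis by simp
qed

lemma J_norm_square: "J br V X \<bullet> J br V (fS f X) = (norm V)\<^sup>2 * (X \<bullet> fS (\<lambda>s. s\<^sup>2 * f s) X)"
  by (simp add: J_J_fS power2_norm_eq_inner)

lemma fS_has_vector_derivative:
  assumes "\<And>b. b \<in> B \<Longrightarrow> ((\<lambda>t. f t (sg b)) has_real_derivative f' (sg b)) (at t within A)"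
  shows "((\<lambda>t. fS (f t) x) has_vector_derivative fS f' x) (at t within A)"
  unfolding fS_def
proof (rule has_vector_derivative_sum)
  fix b assume "b \<in> B"
  have "((\<lambda>t. f t (sg b) * (x \<bullet> b)) has_real_derivative f' (sg b) * (x \<bullet> b)) (at t within A)"
    by (rule DERIV_cmult_right[OF assms[OF \<open>b \<in> B\<close>]])
  then show "((\<lambda>t. (f t (sg b) * (x \<bullet> b)) *\<^sub>R b) has_vector_derivative (f' (sg b) * (x \<bullet> b)) *\<^sub>R b) (at t within A)"
    using has_vector_derivative_scaleR[OF _ has_vector_derivative_const, of "\<lambda>t. f t (sg b) * (x \<bullet> b)"]
    by fastforce
qed

section \<open>The Hamiltonian flow\<close>

text \<open>
  The geodesic with initial covector \<open>\<xi> = (u, v)\<close> is \<open>t \<mapsto> (gx \<xi> t, gz \<xi> t)\<close>; its horizontal velocity \<open>gh \<xi>\<close>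
  solves \<open>h' = - J_v h\<close>, so \<open>gh \<xi> t\<close> is the series of \<open>exp (- t J_v) u\<close> split into even and odd powers.
\<close>

definition gx :: "'a \<times> 'b \<Rightarrow> real \<Rightarrow> 'a" where
  "gx \<xi> t = fS (\<lambda>s. t * trig_sqrt 1 (t\<^sup>2 * (norm (snd \<xi>) * s)\<^sup>2)) (fst \<xi>)
     - fS (\<lambda>s. t\<^sup>2 * trig_sqrt 2 (t\<^sup>2 * (norm (snd \<xi>) * s)\<^sup>2)) (J br (snd \<xi>) (fst \<xi>))"

definition gh :: "'a \<times> 'b \<Rightarrow> real \<Rightarrow> 'a" where
  "gh \<xi> t = fS (\<lambda>s. trig_sqrt 0 (t\<^sup>2 * (norm (snd \<xi>) * s)\<^sup>2)) (fst \<xi>)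
     - fS (\<lambda>s. t * trig_sqrt 1 (t\<^sup>2 * (norm (snd \<xi>) * s)\<^sup>2)) (J br (snd \<xi>) (fst \<xi>))"

text \<open>The vertical velocity has a coefficient of type 1 - cos along v; the index 3 is its
  primitive.\<close>

definition gz :: "'a \<times> 'b \<Rightarrow> real \<Rightarrow> 'b" where
  "gz \<xi> t = (1/2 * (fst \<xi> \<bullet> fS (\<lambda>s. s\<^sup>2 * (t ^ 3 * trig_sqrt 3 (t\<^sup>2 * (norm (snd \<xi>) * s)\<^sup>2))) (fst \<xi>)))
     *\<^sub>R snd \<xi>"

lemma g_0: "gx \<xi> 0 = 0" "gh \<xi> 0 = fst \<xi>" "gz \<xi> 0 = 0"
  using fS_scale[of 0] fS_one by (simp_all add: gx_def gh_def gz_def trig_sqrt_0)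

lemma gx_derivative: "(gx \<xi> has_vector_derivative gh \<xi> t) (at t within A)"
  unfolding gx_def[abs_def] gh_def
  by (intro has_vector_derivative_diff fS_has_vector_derivative trig_sqrt_1_has_derivative
      trig_sqrt_2_has_derivative)

lemma gh_derivative: "(gh \<xi> has_vector_derivative - J br (snd \<xi>) (gh \<xi> t)) (at t within A)"
proof -
  let ?c = "\<lambda>s. (norm (snd \<xi>) * s)\<^sup>2"
  have "(gh \<xi> has_vector_derivative
      fS (\<lambda>s. - ?c s * (t * trig_sqrt 1 (t\<^sup>2 * ?c s))) (fst \<xi>)
      - fS (\<lambda>s. trig_sqrt 0 (t\<^sup>2 * ?c s)) (J br (snd \<xi>) (fst \<xi>))) (at t within A)"
    unfolding gh_def[abs_def]
    by (intro has_vector_derivative_diff fS_has_vector_derivative trig_sqrt_1_has_derivative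
        trig_sqrt_0_has_derivative)
  moreover have "fS (\<lambda>s. - ?c s * (t * trig_sqrt 1 (t\<^sup>2 * ?c s))) (fst \<xi>)
      = J br (snd \<xi>) (fS (\<lambda>s. t * trig_sqrt 1 (t\<^sup>2 * ?c s)) (J br (snd \<xi>) (fst \<xi>)))"
    unfolding J_fS J_square fS_simps fS_compose fS_scale[symmetric]
    by (intro fS_cong) (simp add: power_mult_distrib)
  ultimately show ?thesis
    by (simp add: gh_def J_simps J_fS)
qed

text \<open>The letters a, b, p stand for the sin, 1 - cos and cos coefficients of position and
  velocity. The two terms that pair a vector with J_w f(S) of itself vanish by skewness, and the
  mixed ones reduce to \<open>J_J_fS\<close>.\<close>

lemma geodesic_bracket:
  "(fS a u - fS b (J br v u)) \<bullet> J br w (fS p u - fS a (J br v u))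
    = (v \<bullet> w) * (u \<bullet> fS (\<lambda>s. s\<^sup>2 * (a s * a s - p s * b s)) u)"
proof -
  have 1: "fS a u \<bullet> J br w (fS p u) = 0" and 2: "fS b (J br v u) \<bullet> J br w (fS a (J br v u)) = 0"
    by (simp_all add: J_fS fS_symmetric fS_compose J_fS_self')
  have "fS a u \<bullet> J br w (fS a (J br v u)) = - (J br w u \<bullet> J br v (fS (\<lambda>s. a s * a s) u))"
    using J_skew[of w u "fS (\<lambda>s. a s * a s) (J br v u)"] by (simp add: J_fS fS_symmetric fS_compose)
  then have 3: "fS a u \<bullet> J br w (fS a (J br v u)) = - ((v \<bullet> w) * (u \<bullet> fS (\<lambda>s. s\<^sup>2 * (a s * a s)) u))"
    unfolding J_J_fS .
  have "fS b (J br v u) \<bullet> J br w (fS p u) = J br w u \<bullet> J br v (fS (\<lambda>s. p s * b s) u)"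
    by (simp only: J_fS fS_symmetric[of p, symmetric] fS_compose inner_commute[of "J br w u"])
  then have 4: "fS b (J br v u) \<bullet> J br w (fS p u) = (v \<bullet> w) * (u \<bullet> fS (\<lambda>s. s\<^sup>2 * (p s * b s)) u)"
    unfolding J_J_fS .
  have "fS (\<lambda>s. s\<^sup>2 * (a s * a s - p s * b s)) u = fS (\<lambda>s. s\<^sup>2 * (a s * a s)) u - fS (\<lambda>s. s\<^sup>2 * (p s * b s)) u"
    by (simp add: right_diff_distrib fS_diff)
  then show ?thesis
    using 1 2 3 4 by (simp add: inner_diff_left inner_diff_right J_simps right_diff_distrib)
qed

lemma gz_derivative: "(gz \<xi> has_vector_derivative - (1/2) *\<^sub>R br (gh \<xi> t) (gx \<xi> t)) (at t within A)"
proof -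
  let ?c = "\<lambda>s. (norm (snd \<xi>) * s)\<^sup>2"
  let ?q = "fst \<xi> \<bullet> fS (\<lambda>s. s\<^sup>2 * (t\<^sup>2 * trig_sqrt 2 (t\<^sup>2 * ?c s))) (fst \<xi>)"
  have "((\<lambda>t. fS (\<lambda>s. s\<^sup>2 * (t ^ 3 * trig_sqrt 3 (t\<^sup>2 * ?c s))) (fst \<xi>)) has_vector_derivative
      fS (\<lambda>s. s\<^sup>2 * (t\<^sup>2 * trig_sqrt 2 (t\<^sup>2 * ?c s))) (fst \<xi>)) (at t within A)"
    by (intro fS_has_vector_derivative DERIV_cmult trig_sqrt_3_has_derivative)
  then have "((\<lambda>t. 1/2 * (fst \<xi> \<bullet> fS (\<lambda>s. s\<^sup>2 * (t ^ 3 * trig_sqrt 3 (t\<^sup>2 * ?c s))) (fst \<xi>)))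
      has_vector_derivative 1/2 * ?q) (at t within A)"
    by (intro has_vector_derivative_mult_right
        bounded_linear.has_vector_derivative[OF bounded_linear_inner_right])
  then have "((\<lambda>t. 1/2 * (fst \<xi> \<bullet> fS (\<lambda>s. s\<^sup>2 * (t ^ 3 * trig_sqrt 3 (t\<^sup>2 * ?c s))) (fst \<xi>)))
      has_real_derivative 1/2 * ?q) (at t within A)"
    by (simp only: has_real_derivative_iff_has_vector_derivative)
  from has_vector_derivative_scaleR[OF this has_vector_derivative_const[of "snd \<xi>"]]
  have "(gz \<xi> has_vector_derivative (1/2 * ?q) *\<^sub>R snd \<xi>) (at t within A)"
    unfolding gz_def[abs_def] by simp
  moreover have "(1/2 * ?q) *\<^sub>R snd \<xi> = - (1/2) *\<^sub>R br (gh \<xi> t) (gx \<xi> t)"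
  \<comment> \<open>Testing against arbitrary w uses the H-type relation for the pair v, w and not
    only for v.\<close>
  proof (rule vector_eq_rdot[THEN iffD1], rule allI)
    fix w
    let ?a = "\<lambda>s. t * trig_sqrt 1 (t\<^sup>2 * ?c s)"
    have "br (gh \<xi> t) (gx \<xi> t) \<bullet> w = - (gx \<xi> t \<bullet> J br w (gh \<xi> t))"
      using J_inner[of "gx \<xi> t" w "gh \<xi> t"] br_skew[of "gx \<xi> t" "gh \<xi> t"] by (simp add: inner_commute)
    also have "gx \<xi> t \<bullet> J br w (gh \<xi> t) = (snd \<xi> \<bullet> w) * (fst \<xi> \<bullet> fS (\<lambda>s. s\<^sup>2 * (?a s * ?a s
        - trig_sqrt 0 (t\<^sup>2 * ?c s) * (t\<^sup>2 * trig_sqrt 2 (t\<^sup>2 * ?c s)))) (fst \<xi>))"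
      unfolding gx_def gh_def by (rule geodesic_bracket)
    also have "(\<lambda>s. s\<^sup>2 * (?a s * ?a s - trig_sqrt 0 (t\<^sup>2 * ?c s) * (t\<^sup>2 * trig_sqrt 2 (t\<^sup>2 * ?c s))))
        = (\<lambda>s. s\<^sup>2 * (t\<^sup>2 * trig_sqrt 2 (t\<^sup>2 * ?c s)))"
    proof
      fix s
      have "?a s * ?a s - trig_sqrt 0 (t\<^sup>2 * ?c s) * (t\<^sup>2 * trig_sqrt 2 (t\<^sup>2 * ?c s))
          = t\<^sup>2 * ((trig_sqrt 1 (t\<^sup>2 * ?c s))\<^sup>2 - trig_sqrt 0 (t\<^sup>2 * ?c s) * trig_sqrt 2 (t\<^sup>2 * ?c s))"
        by (simp add: power2_eq_square algebra_simps)
      also have "\<dots> = t\<^sup>2 * trig_sqrt 2 (t\<^sup>2 * ?c s)"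
        by (subst trig_sqrt_pythagoras(1)) simp_all
      finally show "s\<^sup>2 * (?a s * ?a s - trig_sqrt 0 (t\<^sup>2 * ?c s) * (t\<^sup>2 * trig_sqrt 2 (t\<^sup>2 * ?c s)))
          = s\<^sup>2 * (t\<^sup>2 * trig_sqrt 2 (t\<^sup>2 * ?c s))"
        by (simp only:)
    qed
    finally show "(1/2 * ?q) *\<^sub>R snd \<xi> \<bullet> w = - (1/2) *\<^sub>R br (gh \<xi> t) (gx \<xi> t) \<bullet> w"
      by simp
  qed
  ultimately show ?thesis by simp
qed

text \<open>A first integral of the flow, constant by h' = - J_v h and x' = h. It later eliminates x
  from the calibration.\<close>

lemma gh_eq: "gh \<xi> t + J br (snd \<xi>) (gx \<xi> t) = fst \<xi>"
proof -
  have J: "bounded_linear (J br (snd \<xi>))"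
    using J_linear linear_conv_bounded_linear by blast
  have "((\<lambda>t. gh \<xi> t + J br (snd \<xi>) (gx \<xi> t)) has_vector_derivative
      - J br (snd \<xi>) (gh \<xi> t) + J br (snd \<xi>) (gh \<xi> t)) (at t within UNIV)" for t
    by (intro has_vector_derivative_add gh_derivative bounded_linear.has_vector_derivative[OF J] gx_derivative)
  then obtain c where c: "\<And>t. gh \<xi> t + J br (snd \<xi>) (gx \<xi> t) = c"
    using has_vector_derivative_zero_constant[of UNIV "\<lambda>t. gh \<xi> t + J br (snd \<xi>) (gx \<xi> t)"] by auto
  from c[of 0] c[of t] show ?thesis by (simp add: g_0 J_simps)
qed

lemma gh_norm: "norm (gh \<xi> t) = norm (fst \<xi>)"
proof -
  have "((\<lambda>t. gh \<xi> t \<bullet> gh \<xi> t) has_vector_derivative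
      gh \<xi> t \<bullet> (- J br (snd \<xi>) (gh \<xi> t)) + (- J br (snd \<xi>) (gh \<xi> t)) \<bullet> gh \<xi> t) (at t within UNIV)" for t
    by (intro bounded_bilinear.has_vector_derivative[OF bounded_bilinear_inner] gh_derivative)
  then obtain c where c: "\<And>t. gh \<xi> t \<bullet> gh \<xi> t = c"
    using has_vector_derivative_zero_constant[of UNIV "\<lambda>t. gh \<xi> t \<bullet> gh \<xi> t"]
    by (auto simp: J_self inner_commute[of "J _ _ _"])
  from c[of 0] c[of t] show ?thesis by (simp add: g_0 norm_eq_sqrt_inner)
qed

section \<open>Hamilton's equations and their unique solution\<close>

lemma hamiltonian_eq: "hamiltonian br p \<eta> = 1/2 * (norm (fst \<eta> - (1/2) *\<^sub>R J br (snd \<eta>) (fst p)))\<^sup>2"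
proof -
  have "\<eta> \<bullet> horizontal_field br w p = (fst \<eta> - (1/2) *\<^sub>R J br (snd \<eta>) (fst p)) \<bullet> w" for w
    using J_inner[of w "snd \<eta>" "fst p"]
    by (simp add: horizontal_field_def inner_prod_def inner_diff_right inner_commute)
  then show ?thesis
    unfolding hamiltonian_def power2_norm_eq_inner euclidean_inner[of "fst \<eta> - (1/2) *\<^sub>R J br (snd \<eta>) (fst p)"
        "fst \<eta> - (1/2) *\<^sub>R J br (snd \<eta>) (fst p)"]
    by (simp only: power2_eq_square)
qed

lemma hamiltonian_gradients:
  defines "h p \<eta> \<equiv> fst \<eta> - (1/2) *\<^sub>R J br (snd \<eta>) (fst p)"
  shows "GDERIV (\<lambda>q. hamiltonian br q \<eta>) p :> ((1/2) *\<^sub>R J br (snd \<eta>) (h p \<eta>), 0)"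
    and "GDERIV (\<lambda>\<eta>. hamiltonian br p \<eta>) \<eta> :> (h p \<eta>, - (1/2) *\<^sub>R br (h p \<eta>) (fst p))"
proof -
  have eq: "hamiltonian br p \<eta> = 1/2 * (norm (h p \<eta>))\<^sup>2" for p \<eta>
    by (simp add: hamiltonian_eq h_def)
  have J1: "bounded_linear (J br v)" for v
    using J_linear linear_conv_bounded_linear by blast
  have J2: "bounded_linear (\<lambda>v. J br v x)" for x
    using J_bilinear by (simp add: bilinear_def linear_conv_bounded_linear)
  have sq: "((\<lambda>x. 1/2 * (norm (f x))\<^sup>2) has_derivative (\<lambda>d. f x \<bullet> f' d)) (at x)"
    if "(f has_derivative f') (at x)" for f :: "'a \<times> 'b \<Rightarrow> 'a" and f' x
    unfolding power2_norm_eq_inner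
    using has_derivative_mult_right[OF has_derivative_inner[OF that that], of "1/2"]
    by (simp add: inner_commute)
  have "((\<lambda>q. h q \<eta>) has_derivative (\<lambda>d. - (1/2) *\<^sub>R J br (snd \<eta>) (fst d))) (at p)"
    unfolding h_def
    by (auto intro!: derivative_eq_intros bounded_linear.has_derivative[OF J1])
  from sq[OF this] show "GDERIV (\<lambda>q. hamiltonian br q \<eta>) p :> ((1/2) *\<^sub>R J br (snd \<eta>) (h p \<eta>), 0)"
    unfolding gderiv_def eq
  proof (rule has_derivative_eq_rhs, intro ext)
    fix d :: "'a \<times> 'b"
    obtain a b where "d = (a, b)" by fastforce
    then show "h p \<eta> \<bullet> (- (1/2) *\<^sub>R J br (snd \<eta>) (fst d)) = d \<bullet> ((1/2) *\<^sub>R J br (snd \<eta>) (h p \<eta>), 0)"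
      using J_skew[of "snd \<eta>" "h p \<eta>" a] by (simp add: inner_commute[of a])
  qed
  have "((\<lambda>\<eta>. h p \<eta>) has_derivative (\<lambda>d. fst d - (1/2) *\<^sub>R J br (snd d) (fst p))) (at \<eta>)"
    unfolding h_def
    by (auto intro!: derivative_eq_intros bounded_linear.has_derivative[OF J2])
  from sq[OF this] show "GDERIV (\<lambda>\<eta>. hamiltonian br p \<eta>) \<eta> :> (h p \<eta>, - (1/2) *\<^sub>R br (h p \<eta>) (fst p))"
    unfolding gderiv_def eq
  proof (rule has_derivative_eq_rhs, intro ext)
    fix d :: "'a \<times> 'b"
    obtain a b where "d = (a, b)" by fastforce
    then show "h p \<eta> \<bullet> (fst d - (1/2) *\<^sub>R J br (snd d) (fst p)) = d \<bullet> (h p \<eta>, - (1/2) *\<^sub>R br (h p \<eta>) (fst p))"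
      by (simp add: inner_diff_right J_inner inner_commute[of a])
  qed
qed

text \<open>Uniqueness of gradients collapses the existential definition to a differential equation;
  h is the horizontal velocity.\<close>

lemma hamiltonian_curve_iff:
  "hamiltonian_curve br p \<eta> \<longleftrightarrow> (\<forall>t\<in>{0..1}.
     let h = fst (\<eta> t) - (1/2) *\<^sub>R J br (snd (\<eta> t)) (fst (p t)) in
     (p has_vector_derivative (h, - (1/2) *\<^sub>R br h (fst (p t)))) (at t within {0..1}) \<and>
     (\<eta> has_vector_derivative (- (1/2) *\<^sub>R J br (snd (\<eta> t)) h, 0)) (at t within {0..1}))"
  unfolding hamiltonian_curve_def Let_def
proof (rule ball_cong[OF refl])
  fix t :: real
  let ?h = "fst (\<eta> t) - (1/2) *\<^sub>R J br (snd (\<eta> t)) (fst (p t))"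
  let ?P = "\<lambda>Hp H\<xi>. (p has_vector_derivative H\<xi>) (at t within {0..1}) \<and>
    (\<eta> has_vector_derivative - Hp) (at t within {0..1})"
  let ?Hp = "((1/2) *\<^sub>R J br (snd (\<eta> t)) ?h, 0) :: 'a \<times> 'b" and ?H\<xi> = "(?h, - (1/2) *\<^sub>R br ?h (fst (p t)))"
  have 1: "GDERIV (\<lambda>q. hamiltonian br q (\<eta> t)) (p t) :> Hp \<longleftrightarrow> Hp = ?Hp" for Hp
    using hamiltonian_gradients(1)[of "\<eta> t" "p t"] gderiv_unique by blast
  have 2: "GDERIV (\<lambda>\<eta>. hamiltonian br (p t) \<eta>) (\<eta> t) :> H\<xi> \<longleftrightarrow> H\<xi> = ?H\<xi>" for H\<xi>
    using hamiltonian_gradients(2)[of "p t" "\<eta> t"] gderiv_unique by blast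
  have 3: "- ?Hp = (- (1/2) *\<^sub>R J br (snd (\<eta> t)) ?h, 0)"
    by simp
  have "(\<exists>Hp H\<xi>. GDERIV (\<lambda>q. hamiltonian br q (\<eta> t)) (p t) :> Hp \<and>
      GDERIV (\<lambda>\<eta>. hamiltonian br (p t) \<eta>) (\<eta> t) :> H\<xi> \<and> ?P Hp H\<xi>) \<longleftrightarrow> ?P ?Hp ?H\<xi>"
    unfolding 1 2 by blast
  then show "(\<exists>Hp H\<xi>. GDERIV (\<lambda>q. hamiltonian br q (\<eta> t)) (p t) :> Hp \<and>
      GDERIV (\<lambda>\<eta>. hamiltonian br (p t) \<eta>) (\<eta> t) :> H\<xi> \<and> ?P Hp H\<xi>) \<longleftrightarrow>
      (p has_vector_derivative ?H\<xi>) (at t within {0..1}) \<and>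
      (\<eta> has_vector_derivative (- (1/2) *\<^sub>R J br (snd (\<eta> t)) ?h, 0)) (at t within {0..1})"
    unfolding 3 .
qed

lemma geodesic_hamiltonian_curve:
  "hamiltonian_curve br (\<lambda>t. (gx \<xi> t, gz \<xi> t)) (\<lambda>t. (gh \<xi> t + (1/2) *\<^sub>R J br (snd \<xi>) (gx \<xi> t), snd \<xi>))"
proof -
  have J: "bounded_linear (J br (snd \<xi>))"
    using J_linear linear_conv_bounded_linear by blast
  have "((\<lambda>t. gh \<xi> t + (1/2) *\<^sub>R J br (snd \<xi>) (gx \<xi> t)) has_vector_derivative
      - J br (snd \<xi>) (gh \<xi> t) + (1/2) *\<^sub>R J br (snd \<xi>) (gh \<xi> t)) (at t within {0..1})" for t
    by (intro has_vector_derivative_add gh_derivative bounded_linear.has_vector_derivative[OF J]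
        bounded_linear.has_vector_derivative[OF bounded_linear_scaleR_right] gx_derivative)
  moreover have "- J br (snd \<xi>) (gh \<xi> t) + (1/2) *\<^sub>R J br (snd \<xi>) (gh \<xi> t)
      = - (1/2) *\<^sub>R J br (snd \<xi>) (gh \<xi> t)" for t
    using scaleR_half_double[of "J br (snd \<xi>) (gh \<xi> t)"] by (simp add: scaleR_add_right algebra_simps)
  ultimately show ?thesis
    unfolding hamiltonian_curve_iff Let_def
    using gz_derivative[of \<xi>, simplified] by (auto intro!: has_vector_derivative_Pair gx_derivative)
qed

text \<open>Justifies the definite description in \<open>sr_exp\<close>. The vertical covector is
  constant, so h solves the linear equation h' = - J_v h; the difference of two solutions has
  constant norm because J_v is skew. The position follows by integrating twice: first x, then
  z.\<close>

lemma hamiltonian_curve_unique: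
  assumes "hamiltonian_curve br p \<eta>" "p 0 = 0" "\<eta> 0 = \<xi>" "t \<in> {0..1}"
  shows "p t = (gx \<xi> t, gz \<xi> t)"
proof -
  let ?I = "{0..1::real}"
  have J: "bounded_linear (J br v)" for v
    using J_linear linear_conv_bounded_linear by blast
  define h where "h t = fst (\<eta> t) - (1/2) *\<^sub>R J br (snd (\<eta> t)) (fst (p t))" for t
  have p: "(p has_vector_derivative (h t, - (1/2) *\<^sub>R br (h t) (fst (p t)))) (at t within ?I)"
    and \<eta>: "(\<eta> has_vector_derivative (- (1/2) *\<^sub>R J br (snd (\<eta> t)) (h t), 0)) (at t within ?I)"
    if "t \<in> ?I" for t
    using assms(1) that unfolding hamiltonian_curve_iff h_def Let_def by auto
  note fst_deriv = bounded_linear.has_vector_derivative[OF bounded_linear_fst]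
    and snd_deriv = bounded_linear.has_vector_derivative[OF bounded_linear_snd]
  have v: "snd (\<eta> t) = snd \<xi>" if "t \<in> ?I" for t
    using has_vector_derivative_zero_Icc[of 0 1 "\<lambda>t. snd (\<eta> t)" t] snd_deriv[OF \<eta>] that assms(3) by simp
  have h': "((\<lambda>t. fst (\<eta> t) - (1/2) *\<^sub>R J br (snd \<xi>) (fst (p t))) has_vector_derivative
      - (1/2) *\<^sub>R J br (snd \<xi>) (h t) - (1/2) *\<^sub>R J br (snd \<xi>) (h t)) (at t within ?I)"
    if "t \<in> ?I" for t
    using fst_deriv[OF p[OF that]] fst_deriv[OF \<eta>[OF that]] v[OF that]
    by (intro has_vector_derivative_diff bounded_linear.has_vector_derivative[OF J]
        bounded_linear.has_vector_derivative[OF bounded_linear_scaleR_right]) simp_all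
  have h: "(h has_vector_derivative - J br (snd \<xi>) (h t)) (at t within ?I)" if "t \<in> ?I" for t
  proof (rule has_vector_derivative_transform[OF that])
    show "h s = fst (\<eta> s) - (1/2) *\<^sub>R J br (snd \<xi>) (fst (p s))" if "s \<in> ?I" for s
      by (simp add: h_def v[OF that])
    have "- (1/2) *\<^sub>R J br (snd \<xi>) (h t) - (1/2) *\<^sub>R J br (snd \<xi>) (h t) = - J br (snd \<xi>) (h t)"
      by (simp only: scaleR_diff_left[symmetric]) simp
    then show "((\<lambda>t. fst (\<eta> t) - (1/2) *\<^sub>R J br (snd \<xi>) (fst (p t))) has_vector_derivative
        - J br (snd \<xi>) (h t)) (at t within ?I)"
      using h'[OF that] by (simp only:)
  qed
  define d where "d t = h t - gh \<xi> t" for t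
  have d: "(d has_vector_derivative - J br (snd \<xi>) (d t)) (at t within ?I)" if "t \<in> ?I" for t
    using has_vector_derivative_diff[OF h[OF that] gh_derivative] by (simp add: d_def[abs_def] J_simps)
  have "d t = 0" if "t \<in> ?I" for t
  proof -
    have "((\<lambda>t. d t \<bullet> d t) has_vector_derivative 0) (at t within ?I)" if "t \<in> ?I" for t
      using bounded_bilinear.has_vector_derivative[OF bounded_bilinear_inner d[OF that] d[OF that]]
      by (simp add: J_self inner_commute[of "J _ _ _"])
    then have "d t \<bullet> d t = d 0 \<bullet> d 0"
      using that by (intro has_vector_derivative_zero_Icc[of 0 1 "\<lambda>t. d t \<bullet> d t"]) auto
    moreover have "d 0 = 0"
      using assms(2,3) by (simp add: d_def h_def g_0 J_simps)
    ultimately show ?thesis by simp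
  qed
  then have hg: "h t = gh \<xi> t" if "t \<in> ?I" for t
    using that by (simp add: d_def)
  have "((\<lambda>t. fst (p t) - gx \<xi> t) has_vector_derivative 0) (at t within ?I)" if "t \<in> ?I" for t
    using has_vector_derivative_diff[OF fst_deriv[OF p[OF that]] gx_derivative[of \<xi> t]] hg[OF that] by simp
  then have x: "fst (p t) = gx \<xi> t" if "t \<in> ?I" for t
    using has_vector_derivative_zero_Icc[of 0 1 "\<lambda>t. fst (p t) - gx \<xi> t" t] that assms(2) by (simp add: g_0)
  have "((\<lambda>t. snd (p t) - gz \<xi> t) has_vector_derivative 0) (at t within ?I)" if "t \<in> ?I" for t
    using has_vector_derivative_diff[OF snd_deriv[OF p[OF that]] gz_derivative[of \<xi> t]] hg[OF that] x[OF that]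
    by simp
  then have "snd (p t) = gz \<xi> t"
    using has_vector_derivative_zero_Icc[of 0 1 "\<lambda>t. snd (p t) - gz \<xi> t" t] assms(2,4) by (simp add: g_0)
  then show ?thesis
    using x[OF assms(4)] by (simp add: prod_eq_iff)
qed

lemma sr_exp_eq: "sr_exp br \<xi> = (gx \<xi> 1, gz \<xi> 1)"
  unfolding sr_exp_def
proof (rule the_equality)
  show "\<exists>p \<eta>. hamiltonian_curve br p \<eta> \<and> p 0 = 0 \<and> \<eta> 0 = \<xi> \<and> (gx \<xi> 1, gz \<xi> 1) = p 1"
    by (rule exI, rule exI, rule conjI, rule geodesic_hamiltonian_curve[of \<xi>])
      (simp add: g_0 J_simps zero_prod_def)
next
  fix q assume "\<exists>p \<eta>. hamiltonian_curve br p \<eta> \<and> p 0 = 0 \<and> \<eta> 0 = \<xi> \<and> q = p 1"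
  then show "q = (gx \<xi> 1, gz \<xi> 1)"
    using hamiltonian_curve_unique[of _ _ \<xi> 1] by auto
qed

text \<open>J_v u and |v|^2 scale with t^2 while u and v scale with t, which are exactly the powers
  of t in the closed formulas.\<close>

lemma sr_exp_scaleR: "sr_exp br (t *\<^sub>R \<xi>) = (gx \<xi> t, gz \<xi> t)"
proof -
  have J: "J br (t *\<^sub>R v) (t *\<^sub>R u) = t\<^sup>2 *\<^sub>R J br v u" for u v
    using bilinear_lmul[OF J_bilinear] by (simp add: J_simps power2_eq_square)
  have n: "(norm (t *\<^sub>R v) * s)\<^sup>2 = t\<^sup>2 * (norm v * s)\<^sup>2" for v :: 'b and s
    by (simp add: power_mult_distrib)
  have "gx (t *\<^sub>R \<xi>) 1 = gx \<xi> t"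
    unfolding gx_def snd_scaleR fst_scaleR J n
    by (rule B_eqI) (simp add: fS_inner inner_diff_left)
  moreover have "gz (t *\<^sub>R \<xi>) 1 = gz \<xi> t"
    unfolding gz_def snd_scaleR fst_scaleR n inner_fS scaleR_scaleR mult.assoc sum_distrib_right
    by (rule arg_cong[where f = "\<lambda>c. c *\<^sub>R snd \<xi>"], rule arg_cong[where f = "\<lambda>c. 1/2 * c"], rule sum.cong)
      (simp_all add: power3_eq_cube)
  ultimately show ?thesis by (simp add: sr_exp_eq)
qed

section \<open>The image of the exponential map\<close>

abbreviation "\<alpha> \<equiv> largest_eigenvalue S"

definition dom :: "('a \<times> 'b) set" where
  "dom = {(u, v). norm v < 2 * pi / \<alpha> \<and> S u \<noteq> 0}"

lemma S_eq_0_iff: "S u = 0 \<longleftrightarrow> (\<forall>b\<in>B. sg b * (u \<bullet> b) = 0)"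
  using S_inner B_eqI[of "S u" 0] by (metis inner_zero_left)

lemma S_eq_fS: "S u = fS (\<lambda>s. s) u"
  by (rule B_eqI) (simp add: fS_inner S_inner)

lemma eigenvalues_eq: "eigenvalues S = sg ` B"
proof (intro equalityI subsetI)
  fix \<mu> assume "\<mu> \<in> eigenvalues S"
  then obtain X where X: "X \<noteq> 0" "S X = \<mu> *\<^sub>R X"
    unfolding eigenvalues_def by blast
  then obtain b where b: "b \<in> B" "X \<bullet> b \<noteq> 0"
    using B_eqI[of X 0] by auto
  then have "sg b = \<mu>"
    using S_inner[of b X] X(2) by simp
  then show "\<mu> \<in> sg ` B" using b by blast
next
  fix \<mu> assume "\<mu> \<in> sg ` B"
  then obtain b where "b \<in> B" "\<mu> = sg b" by blast
  then have "b \<noteq> 0" "S b = \<mu> *\<^sub>R b"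
    using B_norm[of b] B_eigen[of b] by (auto simp: sg_def)
  then show "\<mu> \<in> eigenvalues S"
    unfolding eigenvalues_def by blast
qed

lemma ex_sg_pos: "\<exists>b\<in>B. sg b > 0"
proof (rule ccontr)
  assume "\<not> ?thesis"
  then have "sg b = 0" if "b \<in> B" for b
    using that sg_nonneg[of b] by force
  then have "S = (\<lambda>_. 0)"
    by (simp add: fun_eq_iff S_eq_0_iff)
  then show False using S_nonzero by blast
qed

lemma sg_le: "b \<in> B \<Longrightarrow> sg b \<le> \<alpha>"
  unfolding largest_eigenvalue_def eigenvalues_eq using B_finite by simp

lemma \<alpha>_pos: "\<alpha> > 0"
  using ex_sg_pos sg_le by fastforce

lemma ex_sg_max: "\<exists>b\<in>B. sg b = \<alpha>"
proof -
  have "\<alpha> \<in> sg ` B"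
    unfolding largest_eigenvalue_def eigenvalues_eq using B_finite ex_sg_pos by (intro Max_in) auto
  then show ?thesis by auto
qed

text \<open>\<open>fS\<close> sees only the eigenvalues of S, so bounding by the largest one puts
  every argument |v| s into the first period.\<close>

lemma arg_bound:
  assumes "0 \<le> r" "r < 2 * pi / \<alpha>" "b \<in> B"
  shows "(r * sg b)\<^sup>2 < (2 * pi)\<^sup>2"
proof -
  have "r * sg b \<le> r * \<alpha>"
    using assms sg_le by (intro mult_left_mono)
  also have "\<dots> < 2 * pi"
    using assms \<alpha>_pos by (simp add: pos_less_divide_eq)
  finally show ?thesis
    using assms sg_nonneg by (intro power_strict_mono) auto
qed

text \<open>
  \<open>gx (u, v) 1\<close> is \<open>exp (- J_v / 2)\<close> composed with the operator \<open>sin \<tau> / \<tau>\<close> at \<open>\<tau> = |v| S / 2\<close>; its inverse is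
  therefore \<open>\<tau> cot \<tau> + J_v / 2\<close>.
\<close>

definition k_inv :: "real \<Rightarrow> real \<Rightarrow> real" where
  "k_inv r s = trig_sqrt 1 ((r * s)\<^sup>2) / (2 * trig_sqrt 2 ((r * s)\<^sup>2))"

definition u_inv :: "'a \<Rightarrow> 'b \<Rightarrow> 'a" where
  "u_inv x v = fS (k_inv (norm v)) x + (1/2) *\<^sub>R J br v x"

text \<open>All operators involved commute, so both orders of composition have the same coefficients
  and one computation yields a left and a right inverse.\<close>

lemma fS_J_products:
  shows "fS k (fS a u - fS b (J br v u)) + (1/2) *\<^sub>R J br v (fS a u - fS b (J br v u))
    = fS (\<lambda>s. k s * a s + 1/2 * ((norm v * s)\<^sup>2 * b s)) u + fS (\<lambda>s. 1/2 * a s - k s * b s) (J br v u)"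
   and "fS a (fS k u + (1/2) *\<^sub>R J br v u) - fS b (J br v (fS k u + (1/2) *\<^sub>R J br v u))
    = fS (\<lambda>s. k s * a s + 1/2 * ((norm v * s)\<^sup>2 * b s)) u + fS (\<lambda>s. 1/2 * a s - k s * b s) (J br v u)"
  by (rule B_eqI; simp add: fS_inner J_simps J_fS J_square inner_add_left inner_diff_left power_mult_distrib algebra_simps)+

text \<open>As k = a / (2 b), the second coefficient a / 2 - k b cancels, and the first is (a^2 +
  (|v| s)^2 b^2) / (2 b) = 1 by the Pythagorean identity.\<close>

lemma fS_inverse_coefficients:
  assumes "norm v < 2 * pi / \<alpha>"
  defines "a \<equiv> \<lambda>s. trig_sqrt 1 ((norm v * s)\<^sup>2)" and "b \<equiv> \<lambda>s. trig_sqrt 2 ((norm v * s)\<^sup>2)"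
  shows "fS (\<lambda>s. k_inv (norm v) s * a s + 1/2 * ((norm v * s)\<^sup>2 * b s)) x
    + fS (\<lambda>s. 1/2 * a s - k_inv (norm v) s * b s) y = x"
proof -
  have "fS (\<lambda>s. k_inv (norm v) s * a s + 1/2 * ((norm v * s)\<^sup>2 * b s)) x = fS (\<lambda>s. 1) x"
  proof (rule fS_cong)
    fix c assume "c \<in> B"
    have pos: "b (sg c) > 0"
      unfolding b_def using arg_bound[OF _ assms(1) \<open>c \<in> B\<close>] by (intro trig_sqrt_2_pos) auto
    have "(a (sg c))\<^sup>2 + (norm v * sg c)\<^sup>2 * (b (sg c))\<^sup>2 = 2 * b (sg c)"
      unfolding a_def b_def by (rule trig_sqrt_pythagoras(2)) simp
    moreover have "a' / (2 * b') * a' + 1/2 * (q * b') = (a'\<^sup>2 + q * b'\<^sup>2) / (2 * b')"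
      if "b' > 0" for a' b' q :: real
      using that by (simp add: field_simps power2_eq_square)
    moreover have "k_inv (norm v) (sg c) = a (sg c) / (2 * b (sg c))"
      by (simp add: k_inv_def a_def b_def)
    ultimately show "k_inv (norm v) (sg c) * a (sg c) + 1/2 * ((norm v * sg c)\<^sup>2 * b (sg c)) = 1"
      using pos by simp
  qed
  moreover have "fS (\<lambda>s. 1/2 * a s - k_inv (norm v) s * b s) y = fS (\<lambda>s. 0 * 1) y"
  proof (rule fS_cong)
    fix c assume "c \<in> B"
    have "b (sg c) > 0"
      unfolding b_def using arg_bound[OF _ assms(1) \<open>c \<in> B\<close>] by (intro trig_sqrt_2_pos) auto
    moreover have "k_inv (norm v) (sg c) = a (sg c) / (2 * b (sg c))"
      by (simp add: k_inv_def a_def b_def)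
    ultimately show "1/2 * a (sg c) - k_inv (norm v) (sg c) * b (sg c) = 0 * 1"
      by simp
  qed
  ultimately show ?thesis
    unfolding fS_scale fS_one by simp
qed

lemma gx_1: "gx (u, v) 1 = fS (\<lambda>s. trig_sqrt 1 ((norm v * s)\<^sup>2)) u - fS (\<lambda>s. trig_sqrt 2 ((norm v * s)\<^sup>2)) (J br v u)"
  by (simp add: gx_def)

lemma gz_1: "gz (u, v) 1 = (1/2 * (u \<bullet> fS (\<lambda>s. s\<^sup>2 * trig_sqrt 3 ((norm v * s)\<^sup>2)) u)) *\<^sub>R v"
  by (simp add: gz_def)

lemma u_inv_gx: "norm v < 2 * pi / \<alpha> \<Longrightarrow> u_inv (gx (u, v) 1) v = u"
  unfolding u_inv_def gx_1 fS_J_products(1) by (rule fS_inverse_coefficients)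

lemma gx_u_inv: "norm v < 2 * pi / \<alpha> \<Longrightarrow> gx (u_inv x v, v) 1 = x"
  unfolding u_inv_def gx_1 fS_J_products(2) by (rule fS_inverse_coefficients)

text \<open>S commutes with every operator in the two formulas. This exchanges the condition S u
  \<noteq> 0 on covectors for S x \<noteq> 0 on points.\<close>

lemma S_gx_eq_0: "S u = 0 \<Longrightarrow> S (gx (u, v) 1) = 0" and S_u_inv_eq_0: "S x = 0 \<Longrightarrow> S (u_inv x v) = 0"
proof -
  have 1: "S (fS f x) = fS f (S x)" for f x
    by (rule B_eqI) (simp only: fS_inner S_inner mult.left_commute)
  have 2: "S (J br v x) = J br v (S x)" for x
    by (simp only: S_eq_fS J_fS)
  show "S (gx (u, v) 1) = 0" if "S u = 0"
    by (simp only: gx_1 linear_diff[OF S_linear] 1 2 that fS_simps J_simps diff_zero)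
  show "S (u_inv x v) = 0" if "S x = 0"
    by (simp only: u_inv_def linear_add[OF S_linear] linear_scale[OF S_linear] 1 2 that fS_simps J_simps
        scaleR_zero_right add_0)
qed

section \<open>The scalar equation for the vertical covector\<close>

text \<open>Mixed terms vanish by skewness, the others combine through sin^2 + (1 - cos)^2 = 2 (1 -
  cos). Quadratic forms in the unknown u become forms in the known x; the denominators of
  \<open>\<Theta>\<close> arise here.\<close>

lemma gx_quadratic: "gx (u, v) 1 \<bullet> fS f (gx (u, v) 1) = u \<bullet> fS (\<lambda>s. f s * (2 * trig_sqrt 2 ((norm v * s)\<^sup>2))) u"
proof -
  define a b where "a = (\<lambda>s. trig_sqrt 1 ((norm v * s)\<^sup>2))" and "b = (\<lambda>s. trig_sqrt 2 ((norm v * s)\<^sup>2))"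
  let ?w = "J br v u"
  have 1: "fS a u \<bullet> fS f (fS a u) = u \<bullet> fS (\<lambda>s. a s * (f s * a s)) u"
    by (simp add: fS_symmetric fS_compose)
  have 2: "fS a u \<bullet> fS f (fS b ?w) = 0"
    by (simp add: fS_symmetric fS_compose J_fS_self')
  have 3: "fS b ?w \<bullet> fS f (fS a u) = 0"
    using J_fS_self'[of u "\<lambda>s. b s * (f s * a s)" v]
    by (simp add: fS_symmetric fS_compose inner_commute[of ?w])
  have "fS b ?w \<bullet> fS f (fS b ?w) = ?w \<bullet> J br v (fS (\<lambda>s. b s * (f s * b s)) u)"
    by (simp add: fS_symmetric fS_compose J_fS)
  then have 4: "fS b ?w \<bullet> fS f (fS b ?w) = u \<bullet> fS (\<lambda>s. (norm v)\<^sup>2 * (s\<^sup>2 * (b s * (f s * b s)))) u"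
    unfolding J_norm_square fS_scale by simp
  have "gx (u, v) 1 \<bullet> fS f (gx (u, v) 1)
      = u \<bullet> fS (\<lambda>s. a s * (f s * a s) + (norm v)\<^sup>2 * (s\<^sup>2 * (b s * (f s * b s)))) u"
    unfolding gx_1 a_def[symmetric] b_def[symmetric]
    by (simp add: fS_simps inner_diff_left inner_diff_right 1 2 3 4 fS_add inner_add_right)
  also have "(\<lambda>s. a s * (f s * a s) + (norm v)\<^sup>2 * (s\<^sup>2 * (b s * (f s * b s))))
      = (\<lambda>s. f s * ((a s)\<^sup>2 + (norm v * s)\<^sup>2 * (b s)\<^sup>2))"
    by (simp add: fun_eq_iff power2_eq_square algebra_simps)
  also have "\<dots> = (\<lambda>s. f s * (2 * b s))"
    unfolding a_def b_def by (subst trig_sqrt_pythagoras(2)) simp_all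
  finally show ?thesis by (simp add: b_def)
qed

text \<open>For \<open>(x, z)\<close> in the image, \<open>v = \<rho> *\<^sub>R z\<close> where \<open>\<rho>\<close> is the solution of \<open>\<Theta> ((x, z), \<rho>) = 1\<close>.\<close>

definition \<Theta> :: "('a \<times> 'b) \<times> real \<Rightarrow> real" where
  "\<Theta> p = (\<Sum>b\<in>B. ((fst (fst p) \<bullet> b) * (fst (fst p) \<bullet> b) * (sg b)\<^sup>2) *
     (snd p * (trig_sqrt 3 ((snd p)\<^sup>2 * ((snd (fst p) \<bullet> snd (fst p)) * (sg b)\<^sup>2)) /
        (4 * trig_sqrt 2 ((snd p)\<^sup>2 * ((snd (fst p) \<bullet> snd (fst p)) * (sg b)\<^sup>2))))))"

definition \<Theta>_dom :: "(('a \<times> 'b) \<times> real) set" where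
  "\<Theta>_dom = {p. 0 < snd p \<and> snd p * norm (snd (fst p)) < 2 * pi / \<alpha> \<and> S (fst (fst p)) \<noteq> 0}"

text \<open>Writing \<open>z \<bullet> z\<close> instead of a norm keeps \<open>\<Theta>\<close>
  smooth at z = 0.\<close>

lemma arg_eq: "\<rho>\<^sup>2 * ((z \<bullet> z) * s\<^sup>2) = (norm (\<rho> *\<^sub>R z) * s)\<^sup>2" for z :: 'b
  by (simp add: power_mult_distrib dot_square_norm)

lemma \<Theta>_eq: "\<Theta> ((x, z), \<rho>) = \<rho> / 2 * (x \<bullet> fS (\<lambda>s. s\<^sup>2 * (trig_sqrt 3 ((norm (\<rho> *\<^sub>R z) * s)\<^sup>2)
    / (2 * trig_sqrt 2 ((norm (\<rho> *\<^sub>R z) * s)\<^sup>2)))) x)"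
  unfolding \<Theta>_def fst_conv snd_conv arg_eq inner_fS sum_distrib_left by (intro sum.cong) simp_all

text \<open>\<open>gx_quadratic\<close> is applied to the operator function in
  \<open>\<Theta>_eq\<close>, whose denominator cancels the factor 2 (1 - cos). For z \<noteq> 0,
  reaching height z thus means \<Theta> = 1.\<close>

lemma \<Theta>_gz:
  assumes "norm v < 2 * pi / \<alpha>" "v = \<rho> *\<^sub>R z"
  shows "gz (u, v) 1 = (\<Theta> ((gx (u, v) 1, z), \<rho>)) *\<^sub>R z"
proof -
  have "u \<bullet> fS (\<lambda>s. s\<^sup>2 * trig_sqrt 3 ((norm v * s)\<^sup>2)) u = u \<bullet> fS (\<lambda>s. s\<^sup>2 * (trig_sqrt 3 ((norm v * s)\<^sup>2)
    / (2 * trig_sqrt 2 ((norm v * s)\<^sup>2))) * (2 * trig_sqrt 2 ((norm v * s)\<^sup>2))) u"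
  proof (intro arg_cong[where f = "\<lambda>y. u \<bullet> y"] fS_cong)
    fix b assume "b \<in> B"
    then have "trig_sqrt 2 ((norm v * sg b)\<^sup>2) > 0"
      using arg_bound[OF _ assms(1)] by (intro trig_sqrt_2_pos) auto
    then show "(sg b)\<^sup>2 * trig_sqrt 3 ((norm v * sg b)\<^sup>2) = (sg b)\<^sup>2 * (trig_sqrt 3 ((norm v * sg b)\<^sup>2)
        / (2 * trig_sqrt 2 ((norm v * sg b)\<^sup>2))) * (2 * trig_sqrt 2 ((norm v * sg b)\<^sup>2))"
      by simp
  qed
  then show ?thesis
    unfolding \<Theta>_eq assms(2)[symmetric] gx_quadratic gz_1 by (simp add: assms(2))
qed

lemma \<Theta>_dom_cases:
  assumes "((x, z), \<rho>) \<in> \<Theta>_dom" "b \<in> B"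
  shows "\<rho> > 0" "0 \<le> (z \<bullet> z) * (sg b)\<^sup>2" "\<rho>\<^sup>2 * ((z \<bullet> z) * (sg b)\<^sup>2) < (2 * pi)\<^sup>2"
proof -
  show "\<rho> > 0" "0 \<le> (z \<bullet> z) * (sg b)\<^sup>2"
    using assms by (auto simp: \<Theta>_dom_def)
  show "\<rho>\<^sup>2 * ((z \<bullet> z) * (sg b)\<^sup>2) < (2 * pi)\<^sup>2"
    unfolding arg_eq using assms by (intro arg_bound) (auto simp: \<Theta>_dom_def)
qed

text \<open>All weights are nonnegative and all quotients increase; S x \<noteq> 0 provides one
  basis vector with positive weight.\<close>

lemma \<Theta>_has_positive_derivative:
  assumes "((x, z), \<rho>) \<in> \<Theta>_dom"
  obtains d where "d > 0" "((\<lambda>\<rho>. \<Theta> ((x, z), \<rho>)) has_real_derivative d) (at \<rho>)"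
proof -
  let ?q = "\<lambda>b \<rho>. \<rho> * (trig_sqrt 3 (\<rho>\<^sup>2 * ((z \<bullet> z) * (sg b)\<^sup>2)) /
    (4 * trig_sqrt 2 (\<rho>\<^sup>2 * ((z \<bullet> z) * (sg b)\<^sup>2))))"
  have "\<forall>b\<in>B. \<exists>D. D > 0 \<and> (?q b has_real_derivative D) (at \<rho>)"
  proof
    fix b assume "b \<in> B"
    from trig_sqrt_quotient_has_derivative[OF \<Theta>_dom_cases[OF assms this]]
    show "\<exists>D. D > 0 \<and> (?q b has_real_derivative D) (at \<rho>)" by blast
  qed
  from bchoice[OF this] obtain D where D: "\<And>b. b \<in> B \<Longrightarrow> D b > 0"
    "\<And>b. b \<in> B \<Longrightarrow> (?q b has_real_derivative D b) (at \<rho>)"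
    by blast
  show thesis
  proof
    show "((\<lambda>\<rho>. \<Theta> ((x, z), \<rho>)) has_real_derivative (\<Sum>b\<in>B. ((x \<bullet> b) * (x \<bullet> b) * (sg b)\<^sup>2) * D b)) (at \<rho>)"
      unfolding \<Theta>_def fst_conv snd_conv by (intro DERIV_sum DERIV_cmult D)
    obtain b where b: "b \<in> B" "sg b * (x \<bullet> b) \<noteq> 0"
      using assms by (auto simp: \<Theta>_dom_def S_eq_0_iff)
    have "0 < ((x \<bullet> b) * (x \<bullet> b) * (sg b)\<^sup>2) * D b"
      using b D(1)[OF b(1)] by (auto simp: zero_less_mult_iff power2_eq_square)
    then show "0 < (\<Sum>b\<in>B. ((x \<bullet> b) * (x \<bullet> b) * (sg b)\<^sup>2) * D b)"
      using D(1) by (intro sum_pos2[OF B_finite b(1)]) (auto simp: less_imp_le)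
  qed
qed

text \<open>For fixed y, everything between two admissible values of \<rho> is admissible, so the
  positive derivative gives strict monotonicity.\<close>

lemma \<Theta>_inj:
  assumes "(y, s) \<in> \<Theta>_dom" "(y, t) \<in> \<Theta>_dom" "\<Theta> (y, s) = \<Theta> (y, t)"
  shows "s = t"
proof -
  obtain x z where y: "y = (x, z)" by fastforce
  have *: "\<Theta> (y, a) < \<Theta> (y, b)" if "(y, a) \<in> \<Theta>_dom" "(y, b) \<in> \<Theta>_dom" "a < b" for a b
    unfolding y
  proof (rule DERIV_pos_imp_increasing[OF that(3)])
    fix \<rho> assume \<rho>: "a \<le> \<rho>" "\<rho> \<le> b"
    have "\<rho> * norm z \<le> b * norm z"
      using \<rho> by (intro mult_right_mono) auto
    then have "((x, z), \<rho>) \<in> \<Theta>_dom"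
      using that \<rho> by (auto simp: \<Theta>_dom_def y)
    then show "\<exists>d. ((\<lambda>\<rho>. \<Theta> ((x, z), \<rho>)) has_real_derivative d) (at \<rho>) \<and> 0 < d"
      using \<Theta>_has_positive_derivative by blast
  qed
  then show ?thesis
    using assms by (metis less_irrefl linorder_neqE_linordered_idom)
qed

text \<open>The endpoint has z = \<kappa> v, where S u \<noteq> 0 makes \<kappa> positive; the
  solution is \<rho> = 1 / \<kappa>.\<close>

lemma exp_solution:
  assumes "(u, v) \<in> dom" "sr_exp br (u, v) = (x, z)"
  shows "\<exists>\<rho>. ((x, z), \<rho>) \<in> \<Theta>_dom \<and> \<Theta> ((x, z), \<rho>) = 1 \<and> v = \<rho> *\<^sub>R z \<and> u = u_inv x v"
proof -
  have v: "norm v < 2 * pi / \<alpha>" and Su: "S u \<noteq> 0"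
    using assms(1) by (auto simp: dom_def)
  have x: "x = gx (u, v) 1" and z: "z = gz (u, v) 1"
    using assms(2) by (auto simp: sr_exp_eq)
  have u: "u = u_inv x v"
    using u_inv_gx[OF v] x by simp
  then have Sx: "S x \<noteq> 0"
    using Su S_u_inv_eq_0 by metis
  define \<kappa> where "\<kappa> = 1/2 * (u \<bullet> fS (\<lambda>s. s\<^sup>2 * trig_sqrt 3 ((norm v * s)\<^sup>2)) u)"
  have z\<kappa>: "z = \<kappa> *\<^sub>R v"
    unfolding z gz_1 \<kappa>_def ..
  obtain b where b: "b \<in> B" "sg b * (u \<bullet> b) \<noteq> 0"
    using Su by (auto simp: S_eq_0_iff)
  have ts: "trig_sqrt 3 ((norm v * s)\<^sup>2) > 0" for s
    by (rule trig_sqrt_3_pos) simp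
  have "0 < (\<Sum>b\<in>B. (sg b)\<^sup>2 * trig_sqrt 3 ((norm v * sg b)\<^sup>2) * ((u \<bullet> b) * (u \<bullet> b)))"
  proof (rule sum_pos2[OF B_finite b(1)])
    show "0 < (sg b)\<^sup>2 * trig_sqrt 3 ((norm v * sg b)\<^sup>2) * ((u \<bullet> b) * (u \<bullet> b))"
      using b(2) ts[of "sg b"] by (auto simp: zero_less_mult_iff)
    show "0 \<le> (sg c)\<^sup>2 * trig_sqrt 3 ((norm v * sg c)\<^sup>2) * ((u \<bullet> c) * (u \<bullet> c))" for c
      using ts[of "sg c"] by simp
  qed
  then have \<kappa>: "\<kappa> > 0"
    by (simp add: \<kappa>_def inner_fS)
  define \<rho> where "\<rho> = 1 / \<kappa>"
  have \<rho>: "\<rho> > 0" "v = \<rho> *\<^sub>R z"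
    using \<kappa> by (simp_all add: \<rho>_def z\<kappa>)
  have "((x, z), \<rho>) \<in> \<Theta>_dom"
    using v \<rho> Sx by (auto simp: \<Theta>_dom_def)
  moreover have "\<Theta> ((x, z), \<rho>) = 1"
  proof -
    have "\<kappa> = \<Theta> ((x, z), \<rho>) * \<kappa>"
    \<comment> \<open>For z = 0 comparing multiples of z says nothing, so the equation is evaluated
      at v = 0; 1/6 is \<open>trig_sqrt 3 0\<close>.\<close>
    proof (cases "z = 0")
      case True
      then have "v = 0" using \<rho> by simp
      define Q where "Q = u \<bullet> fS (\<lambda>s. s\<^sup>2 * (1/6)) u"
      have "\<Theta> ((x, z), \<rho>) = \<rho> / 2 * Q"
        unfolding Q_def \<Theta>_eq \<rho>(2)[symmetric] x gx_quadratic using \<open>v = 0\<close> by (simp add: trig_sqrt_0 fact_numeral)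
      moreover have "\<kappa> = 1/2 * Q"
        unfolding \<kappa>_def Q_def using \<open>v = 0\<close> by (simp add: trig_sqrt_0 fact_numeral)
      ultimately have "\<Theta> ((x, z), \<rho>) = \<rho> * \<kappa>" by (simp only:)
      moreover have "\<rho> * \<kappa> = 1" using \<kappa> by (simp add: \<rho>_def)
      ultimately show ?thesis by (simp only: mult_1)
    next
      case False
      have "z = \<Theta> ((x, z), \<rho>) *\<^sub>R z"
        by (rule \<Theta>_gz[OF v \<rho>(2), of u, folded x z])
      then have "\<Theta> ((x, z), \<rho>) *\<^sub>R z = 1 *\<^sub>R z"
        unfolding scaleR_one by (rule sym)
      then have "\<Theta> ((x, z), \<rho>) = 1"
        using False unfolding scaleR_cancel_right by blast
      then show ?thesis by (simp only: mult_1)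
    qed
    then show ?thesis using \<kappa> by simp
  qed
  ultimately show ?thesis using \<rho> u by blast
qed

lemma exp_of_solution:
  assumes "((x, z), \<rho>) \<in> \<Theta>_dom" "\<Theta> ((x, z), \<rho>) = 1"
  shows "(u_inv x (\<rho> *\<^sub>R z), \<rho> *\<^sub>R z) \<in> dom" "sr_exp br (u_inv x (\<rho> *\<^sub>R z), \<rho> *\<^sub>R z) = (x, z)"
proof -
  define v where "v = \<rho> *\<^sub>R z"
  have v: "norm v < 2 * pi / \<alpha>" and Sx: "S x \<noteq> 0"
    using assms(1) by (auto simp: \<Theta>_dom_def v_def)
  have x: "gx (u_inv x v, v) 1 = x"
    by (rule gx_u_inv[OF v])
  then have "S (u_inv x v) \<noteq> 0"
    using Sx S_gx_eq_0 by metis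
  then show "(u_inv x (\<rho> *\<^sub>R z), \<rho> *\<^sub>R z) \<in> dom"
    using v by (simp add: dom_def v_def)
  have "gz (u_inv x v, v) 1 = z"
    using \<Theta>_gz[OF v v_def, of "u_inv x v"] unfolding x assms(2) scaleR_one .
  then show "sr_exp br (u_inv x (\<rho> *\<^sub>R z), \<rho> *\<^sub>R z) = (x, z)"
    using x by (simp add: sr_exp_eq v_def)
qed

lemma exp_inj: "inj_on (sr_exp br) dom"
proof (rule inj_onI)
  fix \<xi> \<eta> assume *: "\<xi> \<in> dom" "\<eta> \<in> dom" "sr_exp br \<xi> = sr_exp br \<eta>"
  obtain u v u' v' x z where eq: "\<xi> = (u, v)" "\<eta> = (u', v')" "sr_exp br \<xi> = (x, z)"
    by (metis surj_pair)
  obtain \<rho> where \<rho>: "((x, z), \<rho>) \<in> \<Theta>_dom" "\<Theta> ((x, z), \<rho>) = 1" "v = \<rho> *\<^sub>R z" "u = u_inv x v"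
    using exp_solution[of u v x z] * eq by auto
  obtain \<rho>' where \<rho>': "((x, z), \<rho>') \<in> \<Theta>_dom" "\<Theta> ((x, z), \<rho>') = 1" "v' = \<rho>' *\<^sub>R z" "u' = u_inv x v'"
    using exp_solution[of u' v' x z] * eq by auto
  have "\<rho> = \<rho>'"
    using \<Theta>_inj[OF \<rho>(1) \<rho>'(1)] \<rho>(2) \<rho>'(2) by simp
  then show "\<xi> = \<eta>"
    using \<rho> \<rho>' eq by simp
qed

section \<open>Smoothness of the exponential map and of its inverse\<close>

lemma S_continuous:
  fixes f :: "'c::euclidean_space \<Rightarrow> 'a"
  shows "continuous_on A f \<Longrightarrow> continuous_on A (\<lambda>x. S (f x))"
  using linear_continuous_on_compose[OF _ S_linear] .

lemma open_dom: "open dom"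
proof -
  have "open {p :: 'a \<times> 'b. norm (snd p) < 2 * pi / \<alpha> \<and> S (fst p) \<noteq> 0}"
    by (intro open_Collect_conj open_Collect_less open_Collect_neq S_continuous continuous_on_norm
        continuous_on_fst continuous_on_snd continuous_on_id continuous_on_const)
  moreover have "dom = {p. norm (snd p) < 2 * pi / \<alpha> \<and> S (fst p) \<noteq> 0}"
    by (auto simp: dom_def)
  ultimately show ?thesis by simp
qed

lemma open_\<Theta>_dom: "open \<Theta>_dom"
  unfolding \<Theta>_dom_def
  by (intro open_Collect_conj open_Collect_less open_Collect_neq S_continuous continuous_on_norm
      continuous_on_mult continuous_on_fst continuous_on_snd continuous_on_id continuous_on_const)

lemma J_bounded_bilinear: "bounded_bilinear (J br)"
  using J_bilinear bilinear_conv_bounded_bilinear by blast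

lemma sr_exp_smooth: "smooth_on UNIV (sr_exp br)"
proof -
  have eq: "(norm v * s)\<^sup>2 = (v \<bullet> v) * s\<^sup>2" for v :: 'b and s
    by (simp add: power_mult_distrib dot_square_norm)
  have "sr_exp br = (\<lambda>\<xi>. ((\<Sum>b\<in>B. (trig_sqrt 1 ((snd \<xi> \<bullet> snd \<xi>) * (sg b)\<^sup>2) * (fst \<xi> \<bullet> b)) *\<^sub>R b)
      - (\<Sum>b\<in>B. (trig_sqrt 2 ((snd \<xi> \<bullet> snd \<xi>) * (sg b)\<^sup>2) * (J br (snd \<xi>) (fst \<xi>) \<bullet> b)) *\<^sub>R b),
      (1/2 * (\<Sum>b\<in>B. ((sg b)\<^sup>2 * trig_sqrt 3 ((snd \<xi> \<bullet> snd \<xi>) * (sg b)\<^sup>2)) * ((fst \<xi> \<bullet> b) * (fst \<xi> \<bullet> b)))) *\<^sub>R snd \<xi>))"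
  proof
    fix \<xi> :: "'a \<times> 'b"
    obtain u v where "\<xi> = (u, v)" by fastforce
    then show "sr_exp br \<xi> = ((\<Sum>b\<in>B. (trig_sqrt 1 ((snd \<xi> \<bullet> snd \<xi>) * (sg b)\<^sup>2) * (fst \<xi> \<bullet> b)) *\<^sub>R b)
      - (\<Sum>b\<in>B. (trig_sqrt 2 ((snd \<xi> \<bullet> snd \<xi>) * (sg b)\<^sup>2) * (J br (snd \<xi>) (fst \<xi>) \<bullet> b)) *\<^sub>R b),
      (1/2 * (\<Sum>b\<in>B. ((sg b)\<^sup>2 * trig_sqrt 3 ((snd \<xi> \<bullet> snd \<xi>) * (sg b)\<^sup>2)) * ((fst \<xi> \<bullet> b) * (fst \<xi> \<bullet> b)))) *\<^sub>R snd \<xi>)"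
      by (simp only: sr_exp_eq gx_1 gz_1 inner_fS eq fst_conv snd_conv) (simp only: fS_def)
  qed
  then show ?thesis
    unfolding smooth_on_def
    by (simp only:) (intro allI Ck_on_intros Ck_on_bilinear[OF _ J_bounded_bilinear] open_UNIV)
qed

text \<open>Invariance of domain: source and target are the same Euclidean space, so continuity and
  injectivity suffice.\<close>

lemma open_image: "open (sr_exp br ` dom)"
  using invariance_of_domain[OF continuous_on_subset[OF smooth_on_continuous[OF sr_exp_smooth]] open_dom exp_inj]
  by blast

lemma \<Theta>_smooth: "smooth_on \<Theta>_dom \<Theta>"
  unfolding smooth_on_def \<Theta>_def[abs_def]
proof (intro allI Ck_on_intros open_\<Theta>_dom)
  fix b p assume "b \<in> B" "p \<in> \<Theta>_dom"
  then show "4 * trig_sqrt 2 ((snd p)\<^sup>2 * ((snd (fst p) \<bullet> snd (fst p)) * (sg b)\<^sup>2)) \<noteq> 0"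
    using \<Theta>_dom_cases[of "fst (fst p)" "snd (fst p)" "snd p" b] trig_sqrt_2_pos[of "(snd p)\<^sup>2 * ((snd (fst p) \<bullet> snd (fst p)) * (sg b)\<^sup>2)"]
    by simp
qed

text \<open>Passes from the one-variable derivative in \<rho> to the total derivative that the
  implicit function theorem asks for.\<close>

lemma \<Theta>_frechet:
  assumes "p \<in> \<Theta>_dom"
  shows "frechet_derivative \<Theta> (at p) (0, 1) \<noteq> 0"
proof -
  obtain x z \<rho> where p: "p = ((x, z), \<rho>)" by (metis surj_pair)
  have "(\<Theta> has_derivative frechet_derivative \<Theta> (at p)) (at p)"
    using Ck_on_SucD[of 0 \<Theta>_dom \<Theta> p] \<Theta>_smooth assms unfolding smooth_on_def by blast
  from has_derivative_compose[OF has_derivative_Pair[OF has_derivative_const has_derivative_ident] this[unfolded p]]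
  have 1: "((\<lambda>\<rho>. \<Theta> ((x, z), \<rho>)) has_derivative (\<lambda>h. frechet_derivative \<Theta> (at p) (0, h))) (at \<rho>)"
    unfolding p .
  obtain d where d: "d > 0" "((\<lambda>\<rho>. \<Theta> ((x, z), \<rho>)) has_real_derivative d) (at \<rho>)"
    using \<Theta>_has_positive_derivative assms p by blast
  have "(\<lambda>h. frechet_derivative \<Theta> (at p) (0, h)) = (*) d"
    using has_derivative_unique[OF 1] d(2) by (simp add: has_field_derivative_def)
  from fun_cong[OF this, of 1] show ?thesis
    using d(1) by simp
qed

lemma inverse_smooth: "smooth_on (sr_exp br ` dom) (inv_into dom (sr_exp br))"
proof -
  let ?V = "sr_exp br ` dom"
  \<comment> \<open>The choice is harmless, since \<open>\<Theta>_inj\<close> makes the solution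
    unique.\<close>
  define g where "g y = (SOME \<rho>. (y, \<rho>) \<in> \<Theta>_dom \<and> \<Theta> (y, \<rho>) = 1)" for y
  have g: "(y, g y) \<in> \<Theta>_dom \<and> \<Theta> (y, g y) = 1" if y: "y \<in> ?V" for y
  proof -
    obtain \<xi> where \<xi>: "\<xi> \<in> dom" "sr_exp br \<xi> = y"
      using y by blast
    then have "\<exists>\<rho>. (y, \<rho>) \<in> \<Theta>_dom \<and> \<Theta> (y, \<rho>) = 1"
      using exp_solution[of "fst \<xi>" "snd \<xi>" "fst y" "snd y"] by auto
    then show ?thesis
      unfolding g_def by (rule someI_ex)
  qed
  have "smooth_on ?V g"
    by (rule implicit_function_smooth[OF open_\<Theta>_dom open_image \<Theta>_smooth \<Theta>_frechet \<Theta>_inj g])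
  then have Ck: "Ck_on n ?V g" for n
    by (simp add: smooth_on_def)
  define G where "G = (\<lambda>y. ((\<Sum>b\<in>B. (trig_sqrt 1 ((g y)\<^sup>2 * ((snd y \<bullet> snd y) * (sg b)\<^sup>2)) /
      (2 * trig_sqrt 2 ((g y)\<^sup>2 * ((snd y \<bullet> snd y) * (sg b)\<^sup>2))) * (fst y \<bullet> b)) *\<^sub>R b)
      + (1/2) *\<^sub>R J br (g y *\<^sub>R snd y) (fst y), g y *\<^sub>R snd y))"
  have "Ck_on n ?V G" for n
    unfolding G_def
  proof (intro Ck_on_intros Ck_on_bilinear[OF _ J_bounded_bilinear] open_image Ck)
    fix b y assume "b \<in> B" "y \<in> ?V"
    then show "2 * trig_sqrt 2 ((g y)\<^sup>2 * ((snd y \<bullet> snd y) * (sg b)\<^sup>2)) \<noteq> 0"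
      using \<Theta>_dom_cases[of "fst y" "snd y" "g y" b] g[of y] trig_sqrt_2_pos[of "(g y)\<^sup>2 * ((snd y \<bullet> snd y) * (sg b)\<^sup>2)"]
      by simp
  qed
  moreover have "inv_into dom (sr_exp br) y = G y" if "y \<in> ?V" for y
  proof -
    obtain x z where y: "y = (x, z)" by fastforce
    have "G y = (u_inv x (g y *\<^sub>R z), g y *\<^sub>R z)"
      unfolding G_def u_inv_def fS_def k_inv_def y fst_conv snd_conv arg_eq ..
    moreover have "(u_inv x (g y *\<^sub>R z), g y *\<^sub>R z) \<in> dom" "sr_exp br (u_inv x (g y *\<^sub>R z), g y *\<^sub>R z) = y"
      using exp_of_solution[of x z "g y"] g[OF that] y by auto
    ultimately show ?thesis
      using inv_into_f_f[OF exp_inj] by metis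
  qed
  ultimately show ?thesis
    unfolding smooth_on_def using Ck_on_cong[OF open_image] by blast
qed

lemma exp_diffeomorphism: "smooth_diffeomorphism dom (sr_exp br ` dom) (sr_exp br)"
  using open_dom open_image exp_inj sr_exp_smooth inverse_smooth Ck_on_subset
  unfolding smooth_diffeomorphism_def bij_betw_def smooth_on_def by blast

text \<open>The summands of \<Theta> are nonnegative, so it is enough that the one of b reaches 1.
  For z \<noteq> 0 its denominator tends to 0 as \<rho> |z| approaches 2 \<pi> / \<alpha>, because b
  belongs to the top eigenvalue.\<close>

lemma image_contains:
  assumes "b \<in> B" "sg b = \<alpha>" "x \<bullet> b \<noteq> 0"
  shows "(x, z) \<in> sr_exp br ` dom"
proof -
  define A where "A = (x \<bullet> b) * (x \<bullet> b) * (sg b)\<^sup>2"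
  have A: "A > 0"
    using assms \<alpha>_pos by (auto simp: A_def zero_less_mult_iff)
  have Sx: "S x \<noteq> 0"
  proof -
    have "sg b * (x \<bullet> b) \<noteq> 0"
      using assms \<alpha>_pos by simp
    then show ?thesis
      unfolding S_eq_0_iff using assms(1) by blast
  qed
  define c where "c = (z \<bullet> z) * (sg b)\<^sup>2"
  \<comment> \<open>Positivity of \<open>\<phi>\<close> says that the summand of b exceeds 1, but
    with the denominator cleared, so that it can be evaluated at the pole itself.\<close>
  define \<phi> where "\<phi> \<rho> = A * (\<rho> * trig_sqrt 3 (\<rho>\<^sup>2 * c)) - 4 * trig_sqrt 2 (\<rho>\<^sup>2 * c)" for \<rho>
  have cont: "continuous_on X \<phi>" for X
    unfolding \<phi>_def by (intro continuous_intros continuous_on_trig_sqrt)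
  obtain \<rho>2 where \<rho>2: "\<rho>2 > 0" "\<rho>2 * norm z < 2 * pi / \<alpha>" "\<phi> \<rho>2 > 0"
  proof (cases "z = 0")
    case True
    \<comment> \<open>At z = 0 the summand is A \<rho> / 12, so any \<rho> beyond 12 / A
      serves.\<close>
    have "\<phi> (13 / A) > 0"
      using A True by (simp add: \<phi>_def c_def trig_sqrt_0 fact_numeral)
    then show thesis
      using that[of "13 / A"] A True \<alpha>_pos by simp
  next
    case False
    define r where "r = 2 * pi / (\<alpha> * norm z)"
    have r: "r > 0" "r * norm z = 2 * pi / \<alpha>"
      using False \<alpha>_pos by (simp_all add: r_def)
    have "r\<^sup>2 * c = (2 * pi)\<^sup>2"
      using False \<alpha>_pos by (simp add: c_def assms(2) r_def power_mult_distrib power_divide dot_square_norm)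
    then have "\<phi> r > 0"
      using A r trig_sqrt_3_pos[of "(2 * pi)\<^sup>2"] trig_sqrt_2_at_two_pi by (simp add: \<phi>_def)
    moreover have "isCont \<phi> r"
      using cont[of UNIV] by (simp add: continuous_on_eq_continuous_at)
    ultimately obtain d where d: "d > 0" "\<And>t. dist t r < d \<Longrightarrow> dist (\<phi> t) (\<phi> r) < \<phi> r"
      unfolding continuous_at_eps_delta by blast
    \<comment> \<open>A step to the left of the pole, short enough to keep both
      \<open>\<phi> t\<close> and t positive.\<close>
    define t where "t = r - min (d / 2) (r / 2)"
    have t: "0 < t" "t < r" "dist t r < d"
      using d(1) r(1) by (auto simp: t_def dist_real_def min_def)
    have "\<phi> t > 0"
      using d(2)[OF t(3)] by (auto simp: dist_real_def abs_less_iff)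
    moreover have "t * norm z < 2 * pi / \<alpha>"
      using t(2) False by (simp flip: r(2))
    ultimately show thesis
      using that t by blast
  qed
  have in_dom: "((x, z), \<rho>) \<in> \<Theta>_dom" if "0 < \<rho>" "\<rho> \<le> \<rho>2" for \<rho>
  proof -
    have "\<rho> * norm z \<le> \<rho>2 * norm z"
      using that by (intro mult_right_mono) auto
    then show ?thesis
      using that \<rho>2 Sx by (auto simp: \<Theta>_dom_def)
  qed
  \<comment> \<open>The value \<rho> = 0 lies outside \<open>\<Theta>_dom\<close> but starts the
    intermediate value argument, so continuity must reach it.\<close>
  have ts2: "trig_sqrt 2 (\<rho>\<^sup>2 * ((z \<bullet> z) * (sg b)\<^sup>2)) > 0" if "0 \<le> \<rho>" "\<rho> \<le> \<rho>2" "b \<in> B" for \<rho> b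
    using \<Theta>_dom_cases[OF in_dom that(3), of \<rho>] that trig_sqrt_2_pos
    by (cases "\<rho> = 0") (auto simp: trig_sqrt_0)
  let ?f = "\<lambda>\<rho>. \<Theta> ((x, z), \<rho>)"
  have "1 \<le> ?f \<rho>2"
  proof -
    have "1 \<le> A * (\<rho>2 * (trig_sqrt 3 (\<rho>2\<^sup>2 * c) / (4 * trig_sqrt 2 (\<rho>2\<^sup>2 * c))))"
      using \<rho>2 ts2[of \<rho>2 b] assms(1) by (simp add: \<phi>_def c_def pos_le_divide_eq)
    also have "\<dots> \<le> ?f \<rho>2"
      unfolding \<Theta>_def fst_conv snd_conv A_def c_def
    proof (rule member_le_sum[OF assms(1) _ B_finite])
      fix b' assume b': "b' \<in> B - {b}"
      have "trig_sqrt 3 (\<rho>2\<^sup>2 * (z \<bullet> z * (sg b')\<^sup>2)) > 0"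
        by (rule trig_sqrt_3_pos) simp
      then show "0 \<le> x \<bullet> b' * (x \<bullet> b') * (sg b')\<^sup>2 * (\<rho>2 * (trig_sqrt 3 (\<rho>2\<^sup>2 * (z \<bullet> z * (sg b')\<^sup>2))
          / (4 * trig_sqrt 2 (\<rho>2\<^sup>2 * (z \<bullet> z * (sg b')\<^sup>2)))))"
        using ts2[of \<rho>2 b'] \<rho>2(1) b' by simp
    qed
    finally show ?thesis .
  qed
  moreover have "?f 0 = 0"
    by (simp add: \<Theta>_def)
  moreover have "continuous_on {0..\<rho>2} ?f"
    unfolding \<Theta>_def fst_conv snd_conv
    by (intro continuous_intros continuous_on_trig_sqrt) (use ts2 in force)
  ultimately obtain \<rho> where \<rho>: "0 \<le> \<rho>" "\<rho> \<le> \<rho>2" "?f \<rho> = 1"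
    using IVT'[of ?f 0 1 \<rho>2] \<rho>2(1) by auto
  then have "\<rho> > 0"
    using \<open>?f 0 = 0\<close> by (cases "\<rho> = 0") auto
  then show ?thesis
    using exp_of_solution[OF in_dom \<rho>(3)] \<rho> by (metis image_eqI)
qed

text \<open>\<open>negligible\<close> refers to the completed measure; openness of the image makes
  the complement Borel, hence null for \<open>lborel\<close>.\<close>

lemma complement_null: "UNIV - sr_exp br ` dom \<in> null_sets lborel"
proof -
  obtain b where b: "b \<in> B" "sg b = \<alpha>"
    using ex_sg_max by blast
  have "UNIV - sr_exp br ` dom \<subseteq> {p. (b, 0) \<bullet> p = 0}"
  proof
    fix p assume "p \<in> UNIV - sr_exp br ` dom"
    then have "fst p \<bullet> b = 0"
      using image_contains[OF b, of "fst p" "snd p"] by auto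
    then show "p \<in> {p. (b, 0) \<bullet> p = 0}"
      by (simp add: inner_prod_def inner_commute)
  qed
  moreover have "negligible {p :: 'a \<times> 'b. (b, 0) \<bullet> p = 0}"
    using B_norm[OF b(1)] by (intro negligible_hyperplane) (auto simp: zero_prod_def)
  ultimately have "negligible (UNIV - sr_exp br ` dom)"
    by (rule negligible_subset[rotated])
  moreover have "UNIV - sr_exp br ` dom \<in> sets borel"
    using open_image by (auto intro: borel_closed)
  ultimately show ?thesis
    by (auto simp: negligible_iff_null_sets null_sets_def)
qed

section \<open>Minimality\<close>

lemma bounded_bilinear_br: "bounded_bilinear br"
  using br_bilinear bilinear_conv_bounded_bilinear by blast

lemma J_bounded_linear: "bounded_linear (J br v)"
  using J_linear linear_conv_bounded_linear by blast

lemma geodesic_lip: "lip {a..b} (gx \<xi>)" "lip {a..b} (gh \<xi>)" "lip {a..b} (gz \<xi>)"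
proof -
  have x: "continuous_on {a..b} (gx \<xi>)" and h: "continuous_on {a..b} (gh \<xi>)"
    by (rule continuous_on_vector_derivative, rule gx_derivative)
      (rule continuous_on_vector_derivative, rule gh_derivative)
  show "lip {a..b} (gx \<xi>)"
    by (rule lip_C1[OF gx_derivative h])
  show "lip {a..b} (gh \<xi>)"
    by (rule lip_C1[OF gh_derivative])
      (intro continuous_on_minus bounded_linear.continuous_on[OF J_bounded_linear] h)
  show "lip {a..b} (gz \<xi>)"
    by (rule lip_C1[OF gz_derivative])
      (intro continuous_on_scaleR continuous_on_const bounded_bilinear.continuous_on[OF bounded_bilinear_br] x h)
qed

lemma geodesic_derivative:
  "((\<lambda>t. (gx \<xi> t, gz \<xi> t)) has_vector_derivative horizontal_field br (gh \<xi> t) (gx \<xi> t, gz \<xi> t)) (at t within A)"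
  unfolding horizontal_field_def fst_conv
  by (rule has_vector_derivative_Pair[OF gx_derivative gz_derivative])

lemma geodesic_horizontal: "horizontal_curve br (\<lambda>t. (gx \<xi> t, gz \<xi> t))"
proof -
  have "lip {0..1} (\<lambda>t. (gx \<xi> t, 0) + (0, gz \<xi> t))"
    using lip_linear[OF bounded_linear_Pair[OF bounded_linear_ident bounded_linear_zero] geodesic_lip(1)]
      lip_linear[OF bounded_linear_Pair[OF bounded_linear_zero bounded_linear_ident] geodesic_lip(3)]
    by (rule lip_add)
  then have "\<exists>L. L-lipschitz_on {0..1} (\<lambda>t. (gx \<xi> t, gz \<xi> t))"
    by (simp add: lip_def)
  then show ?thesis
    unfolding horizontal_curve_def distribution_eq[OF br_bilinear]
    using geodesic_derivative by blast
qed

lemma geodesic_energy: "energy (\<lambda>t. (gx \<xi> t, gz \<xi> t)) = 1/2 * (norm (fst \<xi>))\<^sup>2"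
proof -
  have "vector_derivative (\<lambda>t. (gx \<xi> t, gz \<xi> t)) (at t within {0..1}) = horizontal_field br (gh \<xi> t) (gx \<xi> t, gz \<xi> t)"
    if "t \<in> {0..1}" for t
    by (rule vector_derivative_within_closed_interval[OF _ that geodesic_derivative]) simp
  then have "integral {0..1} (\<lambda>t. (norm (fst (vector_derivative (\<lambda>t. (gx \<xi> t, gz \<xi> t)) (at t within {0..1}))))\<^sup>2)
      = integral {0..1} (\<lambda>t::real. (norm (fst \<xi>))\<^sup>2)"
    by (intro integral_cong) (simp add: horizontal_field_def gh_norm)
  then show ?thesis by (simp add: energy_def)
qed

lemma fS_product_derivative:
  assumes "\<And>b. b \<in> B \<Longrightarrow> ((\<lambda>t. f t (sg b)) has_real_derivative f' (sg b)) (at t within A)"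
    and "(\<phi> has_vector_derivative \<phi>') (at t within A)"
  shows "((\<lambda>t. fS (f t) (\<phi> t)) has_vector_derivative fS f' (\<phi> t) + fS (f t) \<phi>') (at t within A)"
proof -
  have "((\<lambda>t. \<Sum>b\<in>B. (f t (sg b) * (\<phi> t \<bullet> b)) *\<^sub>R b) has_vector_derivative
      (\<Sum>b\<in>B. (f' (sg b) * (\<phi> t \<bullet> b) + f t (sg b) * (\<phi>' \<bullet> b)) *\<^sub>R b)) (at t within A)"
  proof (rule has_vector_derivative_sum)
    fix b assume "b \<in> B"
    have "((\<lambda>t. \<phi> t \<bullet> b) has_vector_derivative \<phi>' \<bullet> b) (at t within A)"
      by (rule bounded_linear.has_vector_derivative[OF bounded_linear_inner_left assms(2)])
    then have "((\<lambda>t. \<phi> t \<bullet> b) has_real_derivative \<phi>' \<bullet> b) (at t within A)"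
      by (simp only: has_real_derivative_iff_has_vector_derivative)
    from DERIV_mult[OF assms(1)[OF \<open>b \<in> B\<close>] this]
    have "((\<lambda>t. f t (sg b) * (\<phi> t \<bullet> b)) has_real_derivative
        f' (sg b) * (\<phi> t \<bullet> b) + f t (sg b) * (\<phi>' \<bullet> b)) (at t within A)"
      by (simp add: mult.commute)
    from has_vector_derivative_scaleR[OF this has_vector_derivative_const]
    show "((\<lambda>t. (f t (sg b) * (\<phi> t \<bullet> b)) *\<^sub>R b) has_vector_derivative
        (f' (sg b) * (\<phi> t \<bullet> b) + f t (sg b) * (\<phi>' \<bullet> b)) *\<^sub>R b) (at t within A)"
      by simp
  qed
  then show ?thesis
    by (simp only: fS_def scaleR_add_left sum.distrib)
qed

lemma fS_lip:
  assumes "\<And>b. b \<in> B \<Longrightarrow> lip X (\<lambda>t. f t (sg b))" "lip X \<phi>" "compact X"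
  shows "lip X (\<lambda>t. fS (f t) (\<phi> t))"
  unfolding fS_def
  by (intro lip_sum lip_bilinear[OF bounded_bilinear_scaleR assms(3)] lip_const
      lip_bilinear[OF bounded_bilinear_mult assms(3)] assms lip_linear[OF bounded_linear_inner_left])

text \<open>The Riccati field: with \<open>w\<close> the velocity of a competitor and \<open>\<phi>\<close> its deviation from the geodesic,
  the energy density equals an exact derivative plus half the square of
  \<open>\<phi>' + (1/2) *\<^sub>R J br v \<phi> + fS (\<tau> r t) \<phi>\<close>. The tangent is centred at the midpoint of the interval, so that
  it stays finite precisely as long as \<open>norm v * sg b < 2 * pi\<close>.\<close>

definition \<tau> :: "real \<Rightarrow> real \<Rightarrow> real \<Rightarrow> real" where
  "\<tau> r t s = (r * s / 2) * tan (r * s / 2 * (t - 1/2))"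

text \<open>An integrating factor: \<open>\<tau>\<close> is its logarithmic derivative, so
  multiplication by it removes the tangent term in the equality case.\<close>

definition csec :: "real \<Rightarrow> real \<Rightarrow> real \<Rightarrow> real" where
  "csec r t s = inverse (cos (r * s / 2 * (t - 1/2)))"

text \<open>The argument is |v| s / 2 < \<pi> times a distance of at most 1/2 from the
  midpoint.\<close>

lemma cos_arg_pos:
  assumes "0 \<le> r" "r < 2 * pi / \<alpha>" "b \<in> B" "t \<in> {0..1}"
  shows "cos (r * sg b / 2 * (t - 1/2)) > 0"
proof -
  have "r * sg b \<le> r * \<alpha>"
    using assms sg_le by (intro mult_left_mono)
  also have "\<dots> < 2 * pi"
    using assms \<alpha>_pos by (simp add: pos_less_divide_eq)
  finally have 1: "0 \<le> r * sg b / 2" "r * sg b / 2 < pi"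
    using assms sg_nonneg by auto
  have "\<bar>t - 1/2\<bar> \<le> 1/2"
    using assms(4) unfolding abs_le_iff by auto
  then have "\<bar>r * sg b / 2 * (t - 1/2)\<bar> \<le> r * sg b / 2 * (1/2)"
    unfolding abs_mult using 1 by (intro mult_mono) auto
  then show ?thesis
    using 1 by (intro cos_gt_zero_pi) (auto simp: abs_le_iff)
qed

text \<open>The Riccati equation on one eigenspace, from tan' = 1 + tan^2.\<close>

lemma \<tau>_derivative:
  assumes "0 \<le> r" "r < 2 * pi / \<alpha>" "b \<in> B" "t \<in> {0..1}"
  shows "((\<lambda>t. \<tau> r t (sg b)) has_real_derivative (r * sg b / 2)\<^sup>2 + (\<tau> r t (sg b))\<^sup>2) (at t within A)"
proof -
  let ?\<omega> = "r * sg b / 2"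
  have c: "cos (?\<omega> * (t - 1/2)) \<noteq> 0"
    using cos_arg_pos[OF assms] by simp
  have "((\<lambda>t. ?\<omega> * (t - 1/2)) has_real_derivative ?\<omega>) (at t)"
    by (auto intro!: derivative_eq_intros)
  from DERIV_cmult[OF DERIV_chain2[OF DERIV_tan[OF c] this], of ?\<omega>]
  have "((\<lambda>t. \<tau> r t (sg b)) has_real_derivative ?\<omega> * (inverse ((cos (?\<omega> * (t - 1/2)))\<^sup>2) * ?\<omega>)) (at t)"
    unfolding \<tau>_def .
  moreover have "?\<omega> * (inverse ((cos (?\<omega> * (t - 1/2)))\<^sup>2) * ?\<omega>) = ?\<omega>\<^sup>2 + (\<tau> r t (sg b))\<^sup>2"
  proof -
    define T where "T = tan (?\<omega> * (t - 1/2))"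
    have "inverse ((cos (?\<omega> * (t - 1/2)))\<^sup>2) = 1 + T\<^sup>2"
      using tan_sec[OF c] by (simp only: T_def power_inverse)
    then show ?thesis
      unfolding \<tau>_def T_def[symmetric] by (simp only:) (simp add: power2_eq_square algebra_simps)
  qed
  ultimately show ?thesis
    by (metis has_field_derivative_at_within)
qed

lemma csec_derivative:
  assumes "0 \<le> r" "r < 2 * pi / \<alpha>" "b \<in> B" "t \<in> {0..1}"
  shows "((\<lambda>t. csec r t (sg b)) has_real_derivative \<tau> r t (sg b) * csec r t (sg b)) (at t within A)"
proof -
  let ?\<omega> = "r * sg b / 2"
  have c: "cos (?\<omega> * (t - 1/2)) \<noteq> 0"
    using cos_arg_pos[OF assms] by simp
  have "((\<lambda>t. ?\<omega> * (t - 1/2)) has_real_derivative ?\<omega>) (at t)"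
    by (auto intro!: derivative_eq_intros)
  from DERIV_chain2[OF DERIV_cos this]
  have "((\<lambda>t. cos (?\<omega> * (t - 1/2))) has_real_derivative - sin (?\<omega> * (t - 1/2)) * ?\<omega>) (at t)" .
  from DERIV_inverse_fun[OF this c]
  have "((\<lambda>t. csec r t (sg b)) has_real_derivative \<tau> r t (sg b) * csec r t (sg b)) (at t)"
    unfolding csec_def \<tau>_def by (rule DERIV_cong) (simp add: tan_def inverse_eq_divide mult_ac)
  then show ?thesis
    by (rule has_field_derivative_at_within)
qed

lemma \<tau>_csec_lip:
  assumes "0 \<le> r" "r < 2 * pi / \<alpha>" "b \<in> B"
  shows "lip {0..1} (\<lambda>t. \<tau> r t (sg b))" "lip {0..1} (\<lambda>t. csec r t (sg b))"
proof -
  have c1: "continuous_on {0..1} (\<lambda>t. \<tau> r t (sg b))" and c2: "continuous_on {0..1} (\<lambda>t. csec r t (sg b))"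
    by (rule DERIV_continuous_on, rule \<tau>_derivative[OF assms], assumption)
      (rule DERIV_continuous_on, rule csec_derivative[OF assms], assumption)
  show "lip {0..1} (\<lambda>t. \<tau> r t (sg b))"
    by (rule lip_C1[OF \<tau>_derivative[OF assms, unfolded has_real_derivative_iff_has_vector_derivative]])
      (assumption, intro continuous_intros c1)
  show "lip {0..1} (\<lambda>t. csec r t (sg b))"
    by (rule lip_C1[OF csec_derivative[OF assms, unfolded has_real_derivative_iff_has_vector_derivative]])
      (assumption, intro continuous_intros c1 c2)
qed

text \<open>The left side is the derivative of the function integrated in
  \<open>competitor_energy\<close>; p and \<phi> are the deviations of velocity and position. The
  term (h + u) \<bullet> \<phi> is chosen so that, by h + J_v x = u, all linear terms add up to h
  \<bullet> p, the linear part of |h + p|^2 / 2. The rest is quadratic, and the Riccati equation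
  completes the square.\<close>

lemma calibration_identity:
  assumes u: "h + J br v x = u" and hu: "norm h = norm u"
    and T': "\<And>b. b \<in> B \<Longrightarrow> T' (sg b) = (norm v * sg b / 2)\<^sup>2 + (T (sg b))\<^sup>2"
    and \<psi>: "\<psi> = p + (1/2) *\<^sub>R J br v \<phi> + fS T \<phi>"
  shows "v \<bullet> (- (1/2) *\<^sub>R br (h + p) (x + \<phi>) - (- (1/2) *\<^sub>R br h x))
     + 1/2 * ((h + u) \<bullet> p + (- J br v h) \<bullet> \<phi>)
     - 1/2 * (\<phi> \<bullet> (fS T' \<phi> + fS T p) + p \<bullet> fS T \<phi>) + 1/2 * (norm u)\<^sup>2
     = 1/2 * (norm (h + p))\<^sup>2 - 1/2 * (norm \<psi>)\<^sup>2"
proof -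
  have vbr: "v \<bullet> br a c = a \<bullet> J br v c" for a c
    by (simp add: J_inner)
  have 1: "(h + p) \<bullet> J br v (x + \<phi>) - h \<bullet> J br v x
      = h \<bullet> J br v \<phi> + p \<bullet> (u - h) + p \<bullet> J br v \<phi>"
    using u by (simp add: J_simps inner_add_left inner_add_right algebra_simps flip: u)
  have 2: "(- J br v h) \<bullet> \<phi> = h \<bullet> J br v \<phi>"
    using J_skew[of v h \<phi>] by simp
  have 3: "\<phi> \<bullet> fS T p = p \<bullet> fS T \<phi>"
    by (metis fS_symmetric inner_commute)
  \<comment> \<open>The Riccati equation makes T' supply exactly the squares of the two \<phi>-terms
    of \<psi>.\<close>
  have 4: "\<phi> \<bullet> fS T' \<phi> = 1/4 * (J br v \<phi> \<bullet> J br v \<phi>) + fS T \<phi> \<bullet> fS T \<phi>"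
  proof -
    have "fS T' \<phi> = ((norm v)\<^sup>2 / 4) *\<^sub>R fS (\<lambda>s. s\<^sup>2) \<phi> + fS (\<lambda>s. T s * T s) \<phi>"
      unfolding fS_scale[symmetric] fS_add[symmetric] by (rule fS_cong) (simp add: T' power2_eq_square)
    moreover have "J br v \<phi> \<bullet> J br v \<phi> = (norm v)\<^sup>2 * (\<phi> \<bullet> fS (\<lambda>s. s\<^sup>2) \<phi>)"
      using J_norm_square[of v \<phi> "\<lambda>_. 1"] by (simp add: fS_one)
    moreover have "fS T \<phi> \<bullet> fS T \<phi> = \<phi> \<bullet> fS (\<lambda>s. T s * T s) \<phi>"
      by (simp add: fS_symmetric fS_compose)
    ultimately show ?thesis
      by (simp add: inner_add_right)
  qed
  \<comment> \<open>The one product in the square of \<psi> without a counterpart on the left; J_v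
    f(S) being skew removes it.\<close>
  have 5: "J br v \<phi> \<bullet> fS T \<phi> = 0"
    using J_fS_self'[of \<phi> T v] by (metis fS_symmetric inner_commute)
  have \<psi>2: "(norm \<psi>)\<^sup>2 = p \<bullet> p + 1/4 * (J br v \<phi> \<bullet> J br v \<phi>) + fS T \<phi> \<bullet> fS T \<phi>
      + p \<bullet> J br v \<phi> + 2 * (p \<bullet> fS T \<phi>)"
  proof -
    have "J br v \<phi> \<bullet> p = p \<bullet> J br v \<phi>" "fS T \<phi> \<bullet> p = p \<bullet> fS T \<phi>" "fS T \<phi> \<bullet> J br v \<phi> = 0"
      using 5 by (simp_all add: inner_commute)
    then show ?thesis
      unfolding \<psi> power2_norm_eq_inner inner_add_left inner_add_right inner_scaleR_left inner_scaleR_right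
      using 5 by (simp add: field_simps)
  qed
  have hp: "(norm (h + p))\<^sup>2 = (norm u)\<^sup>2 + 2 * (h \<bullet> p) + p \<bullet> p"
    unfolding power2_norm_eq_inner using hu
    by (simp add: inner_add_left inner_add_right inner_commute[of p h] norm_eq)
  have c: "p \<bullet> h = h \<bullet> p" "p \<bullet> u = u \<bullet> p"
    by (simp_all add: inner_commute)
  have 6: "v \<bullet> (- (1/2) *\<^sub>R br (h + p) (x + \<phi>) - (- (1/2) *\<^sub>R br h x))
      = - (1/2) * (h \<bullet> J br v \<phi> + (u \<bullet> p - h \<bullet> p) + p \<bullet> J br v \<phi>)"
    unfolding c[symmetric] inner_diff_right[symmetric, of p] 1[symmetric]
    by (simp only: inner_diff_right inner_scaleR_right vbr right_diff_distrib)
  show ?thesis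
    unfolding 6 2 \<psi>2 hp inner_add_left inner_add_right[of \<phi>] 3 4 by (simp add: field_simps)
qed

text \<open>Integrating the calibration identity shows that the excess energy is half the integral
  of |\<psi>|^2. In the equality case \<psi> = 0 is a linear differential equation for \<phi> with
  zero initial value, valid almost everywhere.\<close>

lemma competitor_energy:
  assumes v: "norm v < 2 * pi / \<alpha>" and hor: "horizontal_curve br \<eta>"
    and start: "\<eta> 0 = 0" and stop: "\<eta> 1 = (gx (u, v) 1, gz (u, v) 1)"
  shows "1/2 * (norm u)\<^sup>2 \<le> energy \<eta>"
    and "energy \<eta> \<le> 1/2 * (norm u)\<^sup>2 \<Longrightarrow> t \<in> {0..1} \<Longrightarrow> \<eta> t = (gx (u, v) t, gz (u, v) t)"
proof -
  let ?I = "{0..1::real}" and ?\<xi> = "(u, v)"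
  have lip_\<eta>: "lip ?I \<eta>"
    using hor unfolding horizontal_curve_def lip_def by blast
  obtain N where N: "negligible N"
    and N_der: "\<And>t. t \<in> ?I - N \<Longrightarrow> \<exists>V\<in>distribution br (\<eta> t). (\<eta> has_vector_derivative V) (at t within ?I)"
    using hor unfolding horizontal_curve_def AE_lebesgue_on_Icc_iff by blast
  \<comment> \<open>The expression inside \<open>energy\<close>; its values on the null set
    \<open>N\<close> are arbitrary.\<close>
  define w where "w t = fst (vector_derivative \<eta> (at t within ?I))" for t
  define y \<zeta> where "y t = fst (\<eta> t)" and "\<zeta> t = snd (\<eta> t)" for t
  have der: "(\<eta> has_vector_derivative (w t, - (1/2) *\<^sub>R br (w t) (y t))) (at t within ?I)"
    if t: "t \<in> ?I - N" for t
  proof -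
    obtain a where a: "(\<eta> has_vector_derivative horizontal_field br a (\<eta> t)) (at t within ?I)"
      using N_der[OF t] unfolding distribution_eq[OF br_bilinear] by blast
    have "vector_derivative \<eta> (at t within ?I) = horizontal_field br a (\<eta> t)"
      by (rule vector_derivative_within_closed_interval[OF _ _ a]) (use t in auto)
    then have "w t = a"
      by (simp add: w_def horizontal_field_def)
    then show ?thesis
      using a by (simp add: horizontal_field_def y_def)
  qed
  have dy: "(y has_vector_derivative w t) (at t within ?I)"
    and d\<zeta>: "(\<zeta> has_vector_derivative - (1/2) *\<^sub>R br (w t) (y t)) (at t within ?I)" if "t \<in> ?I - N" for t
    using bounded_linear.has_vector_derivative[OF bounded_linear_fst der[OF that]]
      bounded_linear.has_vector_derivative[OF bounded_linear_snd der[OF that]]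
    by (simp_all add: y_def[abs_def] \<zeta>_def[abs_def])
  have lip_y: "lip ?I y" and lip_\<zeta>: "lip ?I \<zeta>"
    unfolding y_def[abs_def] \<zeta>_def[abs_def]
    by (rule lip_linear[OF bounded_linear_fst lip_\<eta>], rule lip_linear[OF bounded_linear_snd lip_\<eta>])
  define \<phi> p where "\<phi> t = y t - gx ?\<xi> t" and "p t = w t - gh ?\<xi> t" for t
  have d\<phi>: "(\<phi> has_vector_derivative p t) (at t within ?I)" if "t \<in> ?I - N" for t
    unfolding \<phi>_def[abs_def] p_def by (rule has_vector_derivative_diff[OF dy[OF that] gx_derivative])
  have lip_\<phi>: "lip ?I \<phi>"
    unfolding \<phi>_def[abs_def] by (rule lip_diff[OF lip_y geodesic_lip(1)])
  have \<phi>_ends: "\<phi> 0 = 0" "\<phi> 1 = 0" and \<zeta>_ends: "\<zeta> 0 = 0" "\<zeta> 1 = gz ?\<xi> 1"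
    using start stop by (simp_all add: \<phi>_def y_def \<zeta>_def g_0)
  define T where "T = \<tau> (norm v)"
  define T' where "T' t s = (norm v * s / 2)\<^sup>2 + (T t s)\<^sup>2" for t s
  have dT: "((\<lambda>t. T t (sg b)) has_real_derivative T' t (sg b)) (at t within ?I)"
    if "b \<in> B" "t \<in> ?I" for b t
    unfolding T_def T'_def by (rule \<tau>_derivative[OF norm_ge_zero v that])
  have dT\<phi>: "((\<lambda>t. fS (T t) (\<phi> t)) has_vector_derivative fS (T' t) (\<phi> t) + fS (T t) (p t)) (at t within ?I)"
    if "t \<in> ?I - N" for t
    using that by (intro fS_product_derivative dT d\<phi>) auto
  have lip_T\<phi>: "lip ?I (\<lambda>t. fS (T t) (\<phi> t))"
    unfolding T_def by (rule fS_lip, rule \<tau>_csec_lip(1)[OF norm_ge_zero v], assumption, rule lip_\<phi>, rule compact_Icc)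
  define \<psi> where "\<psi> t = p t + (1/2) *\<^sub>R J br v (\<phi> t) + fS (T t) (\<phi> t)" for t
  \<comment> \<open>The deviations vanish at both ends, so f 1 - f 0 is the contribution of the last
    term alone, the energy of the geodesic.\<close>
  define f where "f t = v \<bullet> (\<zeta> t - gz ?\<xi> t) + 1/2 * ((gh ?\<xi> t + u) \<bullet> \<phi> t)
    - 1/2 * (\<phi> t \<bullet> fS (T t) (\<phi> t)) + t *\<^sub>R (1/2 * (norm u)\<^sup>2)" for t
  have df: "(f has_vector_derivative 1/2 * (norm (w t))\<^sup>2 - 1/2 * (norm (\<psi> t))\<^sup>2) (at t within ?I)"
    if t: "t \<in> ?I - N" for t
  proof -
    have 1: "((\<lambda>t. v \<bullet> (\<zeta> t - gz ?\<xi> t)) has_vector_derivative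
        v \<bullet> (- (1/2) *\<^sub>R br (w t) (y t) - (- (1/2) *\<^sub>R br (gh ?\<xi> t) (gx ?\<xi> t)))) (at t within ?I)"
      by (rule bounded_linear.has_vector_derivative[OF bounded_linear_inner_right
            has_vector_derivative_diff[OF d\<zeta>[OF t] gz_derivative]])
    have "((\<lambda>t. gh ?\<xi> t + u) has_vector_derivative - J br v (gh ?\<xi> t)) (at t within ?I)"
      using has_vector_derivative_add[OF gh_derivative[of ?\<xi>] has_vector_derivative_const[of u]] by simp
    from bounded_bilinear.has_vector_derivative[OF bounded_bilinear_inner this d\<phi>[OF t]]
    have 2: "((\<lambda>t. 1/2 * ((gh ?\<xi> t + u) \<bullet> \<phi> t)) has_vector_derivative
        1/2 * ((gh ?\<xi> t + u) \<bullet> p t + (- J br v (gh ?\<xi> t)) \<bullet> \<phi> t)) (at t within ?I)"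
      by (rule has_vector_derivative_mult_right)
    from bounded_bilinear.has_vector_derivative[OF bounded_bilinear_inner d\<phi>[OF t] dT\<phi>[OF t]]
    have 3: "((\<lambda>t. 1/2 * (\<phi> t \<bullet> fS (T t) (\<phi> t))) has_vector_derivative
        1/2 * (\<phi> t \<bullet> (fS (T' t) (\<phi> t) + fS (T t) (p t)) + p t \<bullet> fS (T t) (\<phi> t))) (at t within ?I)"
      by (rule has_vector_derivative_mult_right)
    have 4: "((\<lambda>t. t *\<^sub>R (1/2 * (norm u)\<^sup>2)) has_vector_derivative 1/2 * (norm u)\<^sup>2) (at t within ?I)"
      by (auto intro!: derivative_eq_intros)
    have 5: "gh ?\<xi> t + p t = w t" "gx ?\<xi> t + \<phi> t = y t"
      by (simp_all add: p_def \<phi>_def)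
    have "v \<bullet> (- (1/2) *\<^sub>R br (gh ?\<xi> t + p t) (gx ?\<xi> t + \<phi> t) - (- (1/2) *\<^sub>R br (gh ?\<xi> t) (gx ?\<xi> t)))
      + 1/2 * ((gh ?\<xi> t + u) \<bullet> p t + (- J br v (gh ?\<xi> t)) \<bullet> \<phi> t)
      - 1/2 * (\<phi> t \<bullet> (fS (T' t) (\<phi> t) + fS (T t) (p t)) + p t \<bullet> fS (T t) (\<phi> t)) + 1/2 * (norm u)\<^sup>2
      = 1/2 * (norm (gh ?\<xi> t + p t))\<^sup>2 - 1/2 * (norm (\<psi> t))\<^sup>2"
      by (rule calibration_identity) (use gh_eq[of ?\<xi> t] gh_norm[of ?\<xi> t] in \<open>simp_all add: T'_def \<psi>_def\<close>)
    from this[unfolded 5] show ?thesis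
      using has_vector_derivative_add[OF has_vector_derivative_diff[OF has_vector_derivative_add[OF 1 2] 3] 4]
      unfolding f_def[abs_def] by (simp only:)
  qed
  have "lip ?I (\<lambda>t::real. t)"
    unfolding lip_def using lipschitz_on_id by blast
  then have "lip ?I f"
    unfolding f_def[abs_def]
    by (intro lip_add lip_diff lip_const geodesic_lip lip_\<zeta> lip_\<phi> lip_T\<phi> compact_Icc
        lip_linear[OF bounded_linear_inner_right] lip_linear[OF bounded_linear_mult_right]
        lip_linear[OF bounded_linear_scaleR_left] lip_bilinear[OF bounded_bilinear_inner])
  then obtain L where "L-lipschitz_on ?I f"
    unfolding lip_def by blast
  from lipschitz_fundamental_theorem_of_calculus[OF _ this N df]
  have int: "((\<lambda>t. 1/2 * (norm (w t))\<^sup>2 - 1/2 * (norm (\<psi> t))\<^sup>2) has_integral 1/2 * (norm u)\<^sup>2) ?I"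
    by (simp add: f_def \<phi>_ends \<zeta>_ends g_0)
  obtain L' where "L'-lipschitz_on ?I y"
    using lip_y unfolding lip_def by blast
  from lipschitz_derivative_norm_square_integrable[OF _ this N dy]
  have int_w: "(\<lambda>t. (norm (w t))\<^sup>2) integrable_on ?I"
    by simp
  \<comment> \<open>Integrability of |\<psi>|^2 is read off from the two integrals already known,
    not from its formula.\<close>
  have "(\<lambda>t. (norm (w t))\<^sup>2 - 2 * (1/2 * (norm (w t))\<^sup>2 - 1/2 * (norm (\<psi> t))\<^sup>2)) integrable_on ?I"
    by (rule integrable_diff[OF int_w integrable_on_mult_right[OF has_integral_integrable[OF int]]])
  then have int_\<psi>: "(\<lambda>t. (norm (\<psi> t))\<^sup>2) integrable_on ?I"
    by (simp add: algebra_simps)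
  have "((\<lambda>t. 1/2 * (norm (w t))\<^sup>2 - 1/2 * (norm (\<psi> t))\<^sup>2) has_integral
      1/2 * integral ?I (\<lambda>t. (norm (w t))\<^sup>2) - 1/2 * integral ?I (\<lambda>t. (norm (\<psi> t))\<^sup>2)) ?I"
    by (intro has_integral_diff has_integral_mult_right integrable_integral int_w int_\<psi>)
  from has_integral_unique[OF this int]
  have energy: "energy \<eta> = 1/2 * (norm u)\<^sup>2 + 1/2 * integral ?I (\<lambda>t. (norm (\<psi> t))\<^sup>2)"
    unfolding energy_def w_def[symmetric] by simp
  have "0 \<le> integral ?I (\<lambda>t. (norm (\<psi> t))\<^sup>2)"
    by (rule integral_nonneg[OF int_\<psi>]) simp
  then show "1/2 * (norm u)\<^sup>2 \<le> energy \<eta>"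
    unfolding energy by simp
  assume le: "energy \<eta> \<le> 1/2 * (norm u)\<^sup>2" and t: "t \<in> ?I"
  have "integral ?I (\<lambda>t. (norm (\<psi> t))\<^sup>2) \<le> 0"
    using le unfolding energy by simp
  then obtain N' where N': "negligible N'" "\<And>t. t \<in> ?I - N' \<Longrightarrow> \<psi> t = 0"
    using integral_norm_square_0_imp_negligible[OF int_\<psi>] by blast
  have neg: "negligible (N \<union> N')"
    using N N'(1) by (simp add: negligible_Un)
  define C where "C = csec (norm v)"
  \<comment> \<open>Dividing by the cosine turns the linear equation \<open>\<psi> = 0\<close> into a rotation, which preserves the norm.\<close>
  define \<theta> where "\<theta> t = fS (C t) (\<phi> t)" for t
  have d\<theta>: "(\<theta> has_vector_derivative - (1/2) *\<^sub>R J br v (\<theta> t)) (at t within ?I)" if t: "t \<in> ?I - (N \<union> N')" for t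
  proof -
    have "(\<theta> has_vector_derivative fS (\<lambda>s. T t s * C t s) (\<phi> t) + fS (C t) (p t)) (at t within ?I)"
      unfolding \<theta>_def[abs_def] C_def T_def
      using t by (intro fS_product_derivative csec_derivative[OF norm_ge_zero v] d\<phi>) auto
    moreover have "p t = - ((1/2) *\<^sub>R J br v (\<phi> t)) - fS (T t) (\<phi> t)"
      using N'(2)[of t] t unfolding \<psi>_def by (simp add: algebra_simps eq_neg_iff_add_eq_0)
    then have "fS (\<lambda>s. T t s * C t s) (\<phi> t) + fS (C t) (p t) = - (1/2) *\<^sub>R J br v (\<theta> t)"
      by (simp add: \<theta>_def fS_simps fS_compose J_fS mult.commute)
    ultimately show ?thesis by simp
  qed
  have lip_\<theta>: "lip ?I \<theta>"
    unfolding \<theta>_def[abs_def] C_def by (rule fS_lip, rule \<tau>_csec_lip(2)[OF norm_ge_zero v], assumption, rule lip_\<phi>, rule compact_Icc)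
  have \<phi>0: "\<phi> t = 0" if t: "t \<in> ?I" for t
  proof -
    have "(\<lambda>t. \<theta> t \<bullet> \<theta> t) t = (\<lambda>t. \<theta> t \<bullet> \<theta> t) 0"
    proof (rule lip_derivative_zero[OF _ neg _ t])
      show "lip ?I (\<lambda>t. \<theta> t \<bullet> \<theta> t)"
        by (rule lip_bilinear[OF bounded_bilinear_inner _ lip_\<theta> lip_\<theta>]) simp
      show "((\<lambda>t. \<theta> t \<bullet> \<theta> t) has_vector_derivative 0) (at s within ?I)" if "s \<in> ?I - (N \<union> N')" for s
        using bounded_bilinear.has_vector_derivative[OF bounded_bilinear_inner d\<theta>[OF that] d\<theta>[OF that]]
        by (simp add: J_self inner_commute[of "J _ _ _"])
    qed
    then have \<theta>0: "\<theta> t = 0"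
      by (simp add: \<theta>_def \<phi>_ends fS_simps)
    show ?thesis
    proof (rule B_eqI)
      fix b assume b: "b \<in> B"
      have "C t (sg b) \<noteq> 0"
        using cos_arg_pos[OF norm_ge_zero v b t] by (simp add: C_def csec_def)
      moreover have "C t (sg b) * (\<phi> t \<bullet> b) = 0"
        using fS_inner[OF b, of "C t" "\<phi> t"] \<theta>0 by (simp add: \<theta>_def)
      ultimately show "\<phi> t \<bullet> b = 0 \<bullet> b" by simp
    qed
  qed
  \<comment> \<open>With \<phi> = 0 the horizontal velocities agree almost everywhere, and
    horizontality makes them determine the vertical ones.\<close>
  have "(\<lambda>t. \<zeta> t - gz ?\<xi> t) t = (\<lambda>t. \<zeta> t - gz ?\<xi> t) 0"
  proof (rule lip_derivative_zero[OF _ neg _ t])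
    show "lip ?I (\<lambda>t. \<zeta> t - gz ?\<xi> t)"
      by (rule lip_diff[OF lip_\<zeta> geodesic_lip(3)])
    show "((\<lambda>t. \<zeta> t - gz ?\<xi> t) has_vector_derivative 0) (at s within ?I)" if s: "s \<in> ?I - (N \<union> N')" for s
    proof -
      have "p s = 0"
        using N'(2)[of s] \<phi>0[of s] s by (simp add: \<psi>_def J_simps fS_simps)
      then have "w s = gh ?\<xi> s" "y s = gx ?\<xi> s"
        using \<phi>0[of s] s by (simp_all add: p_def \<phi>_def)
      then show ?thesis
        using has_vector_derivative_diff[OF d\<zeta> gz_derivative[of ?\<xi> s]] s by simp
    qed
  qed
  then have "\<zeta> t = gz ?\<xi> t"
    by (simp add: \<zeta>_ends g_0)
  moreover have "y t = gx ?\<xi> t"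
    using \<phi>0[OF t] by (simp add: \<phi>_def)
  ultimately show "\<eta> t = (gx ?\<xi> t, gz ?\<xi> t)"
    by (simp add: y_def \<zeta>_def prod_eq_iff)
qed

lemma geodesic_unique_minimizing:
  assumes "\<xi> \<in> dom"
  shows "unique_minimizing_geodesic br (\<lambda>t. sr_exp br (t *\<^sub>R \<xi>))"
proof -
  obtain u v where \<xi>: "\<xi> = (u, v)" and v: "norm v < 2 * pi / \<alpha>"
    using assms by (auto simp: dom_def)
  have energy: "energy (\<lambda>t. (gx \<xi> t, gz \<xi> t)) = 1/2 * (norm u)\<^sup>2"
    unfolding geodesic_energy \<xi> by simp
  have start: "\<eta> 0 = 0" if "\<eta> 0 = (gx \<xi> 0, gz \<xi> 0)" for \<eta> :: "real \<Rightarrow> 'a \<times> 'b"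
    using that by (simp add: g_0 zero_prod_def)
  have "energy (\<lambda>t. (gx \<xi> t, gz \<xi> t)) \<le> energy \<eta>"
    if "horizontal_curve br \<eta>" "\<eta> 0 = (gx \<xi> 0, gz \<xi> 0)" "\<eta> 1 = (gx \<xi> 1, gz \<xi> 1)" for \<eta>
    unfolding energy using competitor_energy(1)[of v \<eta> u, OF v that(1) start[of \<eta>, OF that(2)]] that(3) \<xi> by simp
  then have min: "minimizing_geodesic br (\<lambda>t. (gx \<xi> t, gz \<xi> t))"
    unfolding minimizing_geodesic_def using geodesic_horizontal by blast
  moreover have "\<eta> t = (gx \<xi> t, gz \<xi> t)"
    if \<eta>: "minimizing_geodesic br \<eta>" "\<eta> 0 = (gx \<xi> 0, gz \<xi> 0)" "\<eta> 1 = (gx \<xi> 1, gz \<xi> 1)" and t: "t \<in> {0..1}" for \<eta> t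
  proof -
    have "energy \<eta> \<le> 1/2 * (norm u)\<^sup>2"
      using \<eta> geodesic_horizontal[of \<xi>] unfolding minimizing_geodesic_def energy[symmetric] by simp
    then show ?thesis
      using competitor_energy(2)[of v \<eta> u t, OF v _ start[of \<eta>, OF \<eta>(2)]] \<eta> t \<xi> unfolding minimizing_geodesic_def by simp
  qed
  ultimately show ?thesis
    unfolding unique_minimizing_geodesic_def sr_exp_scaleR by blast
qed

end

theorem lemma22:
  fixes br :: "'a::euclidean_space \<Rightarrow> 'a \<Rightarrow> 'b::euclidean_space"
    and S :: "'a \<Rightarrow> 'a"
    and D C :: "('a \<times> 'b) set"
  assumes "generalized_H_type br S"
    and "D = {(u, v). norm v < 2 * pi / largest_eigenvalue S \<and> S u \<noteq> 0}"
    and "C = UNIV - sr_exp br ` D"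
  shows "smooth_diffeomorphism D (sr_exp br ` D) (sr_exp br)
    \<and> closed C \<and> C \<in> null_sets lborel
    \<and> (\<forall>\<xi>\<in>D. unique_minimizing_geodesic br (\<lambda>t. sr_exp br (t *\<^sub>R \<xi>)))"
proof -
  have "linear S" "\<And>X Y. S X \<bullet> Y = X \<bullet> S Y"
    using assms(1) by (simp_all add: generalized_H_type_def)
  then obtain B where B: "finite B" "pairwise orthogonal B" "\<And>b. b \<in> B \<Longrightarrow> norm b = 1"
    "span B = UNIV" "\<And>b. b \<in> B \<Longrightarrow> S b = (S b \<bullet> b) *\<^sub>R b"
    using symmetric_orthonormal_eigenbasis by blast
  interpret H_type_basis br S B
    using assms(1) B by unfold_locales
  have "D = dom"
    unfolding assms(2) dom_def ..
  then show ?thesis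
    using exp_diffeomorphism open_image complement_null geodesic_unique_minimizing
    unfolding assms(3) by (auto intro: closed_Diff)
qed

end
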